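(* Let $m,n \in \mathbb{N}$ (positive integers), let $Q \subseteq \mathbb{Z}^n$, let $\Psi : \mathbb{Z}^n \to [0,\infty)$, and let $\theta \in \mathbb{R}^m$. Then $$\dim_F E(m,n,Q,\Psi,\theta) \geq \min\{2 s(Q,\Psi),\, mn\}.$$
   Context: $|\cdot|$ denotes the max norm. A point $x = (x_{11},\ldots,x_{1n},\ldots,x_{m1},\ldots,x_{mn}) \in \mathbb{R}^{mn}$ is identified with the $m\times n$ real matrix with entries $x_{ij}$, so that for $q \in \mathbb{Z}^n$, $xq \in \mathbb{R}^m$ is the vector with $i$-th coordinate $\sum_{j=1}^n x_{ij}q_j$. $E(m,n,Q,\Psi,\theta)$ is the set of all $x \in \mathbb{R}^{mn}$ such that $|xq - r - \theta| < \Psi(q)$ for infinitely many $(r,q) \in \mathbb{Z}^m \times Q$. $\Psi_*(q) = \Psi(q)|q|^{-1}$ for $q \neq 0$, and $$s(Q,\Psi) = \inf\Big\{ s \geq 0 : \sum_{q \in Q,\, q\neq 0} \Psi_*(q)^s < \infty \Big\},$$ with $\inf\emptyset=+\infty$. Fourier dimension: for $A \subseteq \mathbb{R}^d$, let $\mathcal{P}(A)$ be the set of Borel probability measures on $\mathbb{R}^d$ whose (closed) support is contained in $A$, and let $\widehat{\mu}(\xi) = \int e^{-2\pi i x\cdot \xi}\,d\mu(x)$. Then $$\dim_F A = \sup\{\beta \in [0,d] : \exists \mu \in \mathcal{P}(A) \text{ and } C>0 \text{ such that } |\widehat{\mu}(\xi)| \leq C|\xi|^{-\beta/2} \text{ for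 all } \xi \in \mathbb{R}^d,\ \xi \neq 0\},$$ with the supremum of the empty set taken to be $0$. *)

theory Defs
  imports "HOL-Probability.Probability"
begin

definition real_vec :: "int ^ 'n \<Rightarrow> real ^ 'n" where
  "real_vec q = (\<chi> j. real_of_int (q $ j))"

text \<open>The max norm is the library's \<^const>\<open>infnorm\<close>: the largest absolute value of a
  coordinate with respect to \<^const>\<open>Basis\<close>, which for \<^typ>\<open>real ^ 'n ^ 'm\<close> is the largest
  absolute value of an entry. Matrices \<^typ>\<open>real ^ 'n ^ 'm\<close> have \<open>m\<close> rows and \<open>n\<close> columns,
  where \<open>m\<close> and \<open>n\<close> are the cardinalities of the arbitrary finite types \<^typ>\<open>'m\<close> and \<^typ>\<open>'n\<close>.\<close>

definition well_approximable ::
  "(int ^ 'n) set \<Rightarrow> (int ^ 'n \<Rightarrow> real) \<Rightarrow> real ^ 'm \<Rightarrow> (real ^ 'n ^ 'm) set" where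
  "well_approximable Q \<Psi> \<theta> =
    {x. infinite {(r :: int ^ 'm, q). q \<in> Q \<and>
          infnorm (x *v real_vec q - real_vec r - \<theta>) < \<Psi> q}}"

definition Psi_star :: "(int ^ 'n \<Rightarrow> real) \<Rightarrow> int ^ 'n \<Rightarrow> real" where
  "Psi_star \<Psi> q = \<Psi> q * inverse (infnorm (real_vec q))"

text \<open>The infimum is taken in the extended reals, where \<open>Inf {} = \<infinity>\<close>. The library's convention
  \<open>0 powr 0 = 0\<close> only affects whether \<open>s = 0\<close> itself belongs to the set, not the infimum:
  if only finitely many values of \<open>\<Psi>\<close> on \<open>Q - {0}\<close> are nonzero, all \<open>s > 0\<close> belong to it anyway.\<close>

definition critical_exponent :: "(int ^ 'n) set \<Rightarrow> (int ^ 'n \<Rightarrow> real) \<Rightarrow> ereal" where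
  "critical_exponent Q \<Psi> =
    Inf (ereal ` {s. s \<ge> 0 \<and> (\<lambda>q. Psi_star \<Psi> q powr s) summable_on (Q - {0})})"

definition measure_support :: "'a::topological_space measure \<Rightarrow> 'a set" where
  "measure_support \<mu> = {x. \<forall>U. open U \<and> x \<in> U \<longrightarrow> emeasure \<mu> U > 0}"

definition borel_prob_measures_on :: "'a::euclidean_space set \<Rightarrow> 'a measure set" where
  "borel_prob_measures_on A =
    {\<mu>. prob_space \<mu> \<and> sets \<mu> = sets borel \<and> measure_support \<mu> \<subseteq> A}"

definition fourier_transform :: "'a::euclidean_space measure \<Rightarrow> 'a \<Rightarrow> complex" where
  "fourier_transform \<mu> \<xi> = (CLINT x|\<mu>. exp (- 2 * pi * \<i> * (x \<bullet> \<xi>)))"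

definition fourier_decay_exponents :: "'a::euclidean_space set \<Rightarrow> real set" where
  "fourier_decay_exponents A =
    {\<beta> \<in> {0..real DIM('a)}. \<exists>\<mu> \<in> borel_prob_measures_on A. \<exists>C > 0. \<forall>\<xi>. \<xi> \<noteq> 0 \<longrightarrow>
      cmod (fourier_transform \<mu> \<xi>) \<le> C * infnorm \<xi> powr (- \<beta> / 2)}"

definition fourier_dim :: "'a::euclidean_space set \<Rightarrow> real" where
  "fourier_dim A =
    (if fourier_decay_exponents A = {} then 0 else Sup (fourier_decay_exponents A))"

end

theory Submission
  imports Defs "HOL-Computational_Algebra.Primes"
begin

text \<open>
  For each \<open>q\<close> take a nonnegative kernel that depends only on \<open>xq - \<theta>\<close>, is \<open>1\<close>-periodic in it, and is supported
  where every coordinate lies within \<open>\<Psi>(q)/2\<close> of an integer. Its Fourier coefficients live on the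
  rank-one matrices \<open>k q\<^sup>T\<close> with \<open>k \<in> \<int>\<^sup>m\<close> and decay in \<open>\<Psi>\<^sub>*(q) |k q\<^sup>T|\<close>. Given \<open>a < a' < s(Q,\<Psi>)\<close>,
  average these kernels over a finite \<open>A \<subseteq> Q\<close> with weights proportional to \<open>\<Psi>\<^sub>*(q)\<^bsup>a'\<^esup>\<close>. A nonzero
  integer matrix \<open>l\<close> has at most \<open>O(|l|\<^bsup>a'-a\<^esup>)\<close> factorisations \<open>k q\<^sup>T\<close> (divisor bound), so the average has coefficients
  \<open>O(|l|\<^bsup>-a\<^esup> / W)\<close>, where \<open>W = \<Sum>\<^bsub>q\<in>A\<^esub> \<Psi>\<^sub>*(q)\<^bsup>a'\<^esup>\<close> can be made arbitrarily large because the series diverges.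
  Multiplying a density with rapidly decaying Fourier transform by such an average therefore changes the
  transform by an arbitrarily small multiple of \<open>(1 + |\<xi>|)\<^bsup>-a\<^esup>\<close>. Iterating over disjoint sets \<open>A\<close> and passing to a weak limit
  gives a measure with decay exponent \<open>2a\<close>, each point of whose support is close to \<open>\<theta>\<close> modulo integers
  for some \<open>q\<close> in every one of the sets \<open>A\<close>.
\<close>

section \<open>The bump function and its Fourier transform\<close>

text \<open>Two levels of control run side by side. A density is kept with Fourier decay of a large
  fixed order \<open>K = 3 * d\<close>, where \<open>d = m * n\<close>, but with a constant that may
  grow at every multiplication; only the change of the transform caused by a multiplication is
  controlled uniformly, at the weaker order \<open>a\<close>. This works because \<open>W\<close> is
  chosen after the constant of the current density is known: the change is at most that constant
  times a fixed \<open>D\<close>, divided by \<open>W\<close>. The changes are prescribed as a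
  geometric series, so they leave mass at least 1/2 and decay of order \<open>a\<close> in the
  limit.

  No monotonicity or size condition on \<open>\<Psi>\<close> is available. The exponent of the
  weights makes this harmless: \<open>\<Psi>\<close> cancels between weight and kernel bound, and
  only the size of the frequency survives. Widths of 1 or more do occur and are met by a constant
  kernel.

  The closed half-width condition \<open>\<Psi> q / 2\<close> passes to a weak limit, while
  positivity of \<open>\<Psi> q\<close> turns it back into the strict inequality of the
  definition.\<close>

definition ex :: "real \<Rightarrow> complex" where
  "ex u = cis (2 * pi * u)"

lemma ex_add: "ex (u + v) = ex u * ex v"
  by (simp add: ex_def cis_mult distrib_left)

lemma norm_ex [simp]: "cmod (ex u) = 1"
  by (simp add: ex_def)

lemma ex_0 [simp]: "ex 0 = 1"
  by (simp add: ex_def)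

lemma ex_of_int [simp]: "ex (of_int k) = 1"
  using cos_int_2pin[of k] sin_int_2pin[of k] by (simp add: ex_def complex_eq_iff)

lemma ex_minus: "ex (- u) = cnj (ex u)"
  by (simp add: ex_def cis_cnj)

lemma ex_sum: "finite A \<Longrightarrow> ex (\<Sum>i\<in>A. f i) = (\<Prod>i\<in>A. ex (f i))"
  by (induction A rule: finite_induct) (auto simp: ex_add)

lemma continuous_on_ex [continuous_intros]:
  "continuous_on S f \<Longrightarrow> continuous_on S (\<lambda>x. ex (f x))"
  unfolding ex_def by (intro continuous_intros)

lemma measurable_ex [measurable]: "ex \<in> borel_measurable borel"
  by (intro borel_measurable_continuous_onI continuous_intros)

lemma ex_has_vector_derivative:
  "((\<lambda>t. ex (v * t)) has_vector_derivative (2 * pi * v) *\<^sub>R (\<i> * ex (v * t))) (at t within S)"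
proof -
  have "((\<lambda>t. exp (\<i> * of_real (2 * pi * (v * t)))) has_vector_derivative
          (\<i> * of_real (2 * pi * v)) * exp (\<i> * of_real (2 * pi * (v * t)))) (at t within S)"
    by (auto intro!: derivative_eq_intros has_vector_derivative_real_field simp: algebra_simps)
  then show ?thesis
    by (simp add: ex_def cis_conv_exp scaleR_conv_of_real algebra_simps)
qed

text \<open>\<open>N\<close> integrations by parts: a factor \<open>t * (1 - t)\<close> kills the
  boundary terms, and differentiating lowers its power by one. The cofactor \<open>r\<close> changes
  at each step, hence the generalisation over it.\<close>

lemma poly_fourier_decay:
  fixes r :: "real poly"
  shows "\<exists>C\<ge>0. \<forall>u. cmod (\<integral>t. indicator {0..1} t *\<^sub>R
      (complex_of_real (poly ([:0, 1, -1:] ^ N * r) t) * ex (- u * t)) \<partial>lborel) \<le> C / (1 + \<bar>u\<bar>) ^ N"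
proof (induction N arbitrary: r)
  case 0
  define T where "T = (\<integral>t. cmod (indicator {0..1} t *\<^sub>R (complex_of_real (poly r t))) \<partial>lborel)"
  have "cmod (\<integral>t. indicator {0..1} t *\<^sub>R (complex_of_real (poly r t) * ex (- u * t)) \<partial>lborel) \<le> T" for u
    unfolding T_def by (rule order_trans[OF integral_norm_bound]) (simp add: norm_mult)
  moreover have "T \<ge> 0" by (simp add: T_def)
  ultimately show ?case by auto
next
  case (Suc N)
  define s :: "real poly" where "s = [:0, 1, -1:]"
  define p where "p = s ^ Suc N * r"
  define r' where "r' = smult (of_nat (Suc N)) (pderiv s * r) + s * pderiv r"
  have p': "pderiv p = s ^ N * r'"
    unfolding p_def r'_def pderiv_mult pderiv_power_Suc by (simp add: algebra_simps)
  let ?I = "\<lambda>p u. (\<integral>t. indicator {0..1} t *\<^sub>R (complex_of_real (poly p t) * ex (- u * t)) \<partial>lborel)"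
  obtain C where C: "C \<ge> 0" "\<And>u. cmod (?I (pderiv p) u) \<le> C / (1 + \<bar>u\<bar>) ^ N"
    using Suc.IH[of r'] unfolding p' s_def by auto
  define T where "T = (\<integral>t. cmod (indicator {0..1} t *\<^sub>R (complex_of_real (poly p t))) \<partial>lborel)"
  have T: "cmod (?I p u) \<le> T" for u
    unfolding T_def by (rule order_trans[OF integral_norm_bound]) (simp add: norm_mult)
  have T0: "T \<ge> 0" by (simp add: T_def)
  have parts: "\<bar>u\<bar> * (2 * pi) * cmod (?I p u) = cmod (?I (pderiv p) u)" for u
  proof -
    have deriv: "((\<lambda>t. complex_of_real (poly p t) * ex (- u * t)) has_vector_derivative
         (complex_of_real (poly (pderiv p) t) * ex (- u * t)
           + complex_of_real (poly p t) * ((2 * pi * (- u)) *\<^sub>R (\<i> * ex (- u * t))))) (at t within {0..1})" for t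
    proof -
      have "((\<lambda>t. complex_of_real (poly p t)) has_vector_derivative
              complex_of_real (poly (pderiv p) t)) (at t within {0..1})"
        by (intro has_vector_derivative_of_real has_field_derivative_at_within[OF poly_DERIV])
      from has_vector_derivative_mult[OF this ex_has_vector_derivative[of "- u"]]
      show ?thesis by (simp add: add.commute)
    qed
    let ?f = "\<lambda>t. complex_of_real (poly (pderiv p) t) * ex (- u * t)"
    let ?g = "\<lambda>t. complex_of_real (poly p t) * ((2 * pi * (- u)) *\<^sub>R (\<i> * ex (- u * t)))"
    have int: "integrable lborel (\<lambda>t. indicator {0..1} t *\<^sub>R ?f t)"
              "integrable lborel (\<lambda>t. indicator {0..1} t *\<^sub>R ?g t)"
      by (rule borel_integrable_compact; auto intro!: continuous_intros)+
    have "(\<integral>t. indicator {0..1} t *\<^sub>R (?f t + ?g t) \<partial>lborel) =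
       complex_of_real (poly p 1) * ex (- u * 1) - complex_of_real (poly p 0) * ex (- u * 0)"
      by (rule integral_FTC_Icc[OF zero_le_one deriv]) (auto intro!: continuous_intros)
    also have "\<dots> = 0"
      by (simp add: p_def s_def)
    finally have "?I (pderiv p) u + (\<integral>t. indicator {0..1} t *\<^sub>R ?g t \<partial>lborel) = 0"
      using int by (simp only: scaleR_add_right Bochner_Integration.integral_add)
    moreover have "(\<integral>t. indicator {0..1} t *\<^sub>R ?g t \<partial>lborel) = (- (2 * pi * u) * \<i>) * ?I p u"
      by (subst integral_mult_right_zero[symmetric], rule Bochner_Integration.integral_cong)
         (auto simp: indicator_def scaleR_conv_of_real)
    ultimately have "?I (pderiv p) u = (2 * pi * u * \<i>) * ?I p u"
      by (simp add: algebra_simps)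
    then show ?thesis by (simp add: norm_mult)
  qed
  \<comment> \<open>Near 0 the trivial bound \<open>T\<close> suffices because
    \<open>1 + \<bar>u\<bar> \<le> 2\<close>; elsewhere
    \<open>1 + \<bar>u\<bar> \<le> 2 * pi * \<bar>u\<bar>\<close> lets the integration by parts gain
    one power.\<close>
  have "cmod (?I p u) \<le> (C + T * 2 ^ Suc N) / (1 + \<bar>u\<bar>) ^ Suc N" for u
  proof (cases "\<bar>u\<bar> \<le> 1")
    case True
    have "cmod (?I p u) * (1 + \<bar>u\<bar>) ^ Suc N \<le> T * 2 ^ Suc N"
      using True T[of u] by (intro mult_mono power_mono T0) auto
    also have "\<dots> \<le> C + T * 2 ^ Suc N" using C by simp
    finally have "cmod (?I p u) * (1 + \<bar>u\<bar>) ^ Suc N \<le> C + T * 2 ^ Suc N" .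
    moreover have "(1 + \<bar>u\<bar>) ^ Suc N > 0" by (intro zero_less_power) auto
    ultimately show ?thesis by (simp only: pos_le_divide_eq)
  next
    case False
    have "3 * \<bar>u\<bar> \<le> (2 * pi) * \<bar>u\<bar>" using pi_gt3 by (intro mult_right_mono) auto
    then have "1 + \<bar>u\<bar> \<le> \<bar>u\<bar> * (2 * pi)" using False by (simp add: mult.commute)
    then have "(1 + \<bar>u\<bar>) * cmod (?I p u) \<le> \<bar>u\<bar> * (2 * pi) * cmod (?I p u)"
      by (intro mult_right_mono) auto
    also have "\<dots> \<le> C / (1 + \<bar>u\<bar>) ^ N" using C(2)[of u] parts by simp
    finally have "(1 + \<bar>u\<bar>) * cmod (?I p u) \<le> C / (1 + \<bar>u\<bar>) ^ N" .
    moreover have "0 < 1 + \<bar>u\<bar>" by simp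
    ultimately have "cmod (?I p u) \<le> C / (1 + \<bar>u\<bar>) ^ N / (1 + \<bar>u\<bar>)"
      by (simp only: pos_le_divide_eq mult.commute)
    also have "\<dots> = C / (1 + \<bar>u\<bar>) ^ Suc N" by (simp add: field_simps)
    also have "\<dots> \<le> (C + T * 2 ^ Suc N) / (1 + \<bar>u\<bar>) ^ Suc N"
      using T0 by (intro divide_right_mono) auto
    finally show ?thesis .
  qed
  moreover have "C + T * 2 ^ Suc N \<ge> 0" using C T0 by simp
  ultimately show ?case unfolding p_def s_def by blast
qed

text \<open>One factor more than the decay order \<open>N\<close> asks for, so that the function
  vanishes at both endpoints even for \<open>N = 0\<close>; extended by zero it is then Lipschitz on
  the whole line.\<close>

definition bump_poly :: "nat \<Rightarrow> real poly" where
  "bump_poly N = [:0, 1, -1:] ^ Suc N"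

definition bump_mass :: "nat \<Rightarrow> real" where
  "bump_mass N = (\<integral>t. indicator {0..1} t *\<^sub>R poly (bump_poly N) t \<partial>lborel)"

definition bump :: "nat \<Rightarrow> real \<Rightarrow> real" where
  "bump N t = indicator {0..1} t * poly (bump_poly N) t / bump_mass N"

lemma poly_bump_poly: "poly (bump_poly N) t = (t * (1 - t)) ^ Suc N"
  by (simp add: bump_poly_def poly_power algebra_simps)

lemma bump_mass_pos: "bump_mass N > 0"
proof -
  have int: "integrable lborel (\<lambda>t. indicator {0..1} t *\<^sub>R poly (bump_poly N) t :: real)"
    by (rule borel_integrable_compact) (auto intro!: continuous_intros)
  have nn: "indicator {0..1} t *\<^sub>R poly (bump_poly N) t \<ge> 0" for t
    by (auto simp: poly_bump_poly indicator_def)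
  have "0 < (\<integral>t. indicator {1/4..3/4::real} t *\<^sub>R ((3/16) ^ Suc N :: real) \<partial>lborel)"
    by simp
  also have "\<dots> \<le> bump_mass N"
    unfolding bump_mass_def
  proof (rule integral_mono)
    fix t :: real
    have "3/16 \<le> t * (1 - t)" if "1/4 \<le> t" "t \<le> 3/4"
    proof -
      have "0 \<le> (t - 1/4) * (3/4 - t)" using that by simp
      then show ?thesis by (simp add: field_simps)
    qed
    then have "(3/16) ^ Suc N \<le> (t * (1 - t)) ^ Suc N" if "1/4 \<le> t" "t \<le> 3/4"
      using that by (intro power_mono) auto
    then show "indicator {1/4..3/4} t *\<^sub>R (3/16) ^ Suc N \<le> indicator {0..1} t *\<^sub>R poly (bump_poly N) t"
      using nn[of t] by (auto simp: indicator_def poly_bump_poly)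
  next
    show "integrable lborel (\<lambda>t. indicator {1/4..3/4::real} t *\<^sub>R ((3/16) ^ Suc N :: real))"
      by (rule borel_integrable_compact) auto
  qed (rule int)
  finally show ?thesis .
qed

lemma bump_nonneg: "bump N t \<ge> 0"
  using bump_mass_pos[of N] by (auto simp: bump_def indicator_def poly_bump_poly)

lemma bump_eq_0: "t \<le> 0 \<or> t \<ge> 1 \<Longrightarrow> bump N t = 0"
  by (auto simp: bump_def indicator_def poly_bump_poly)

lemma bump_measurable [measurable]: "bump N \<in> borel_measurable borel"
  unfolding bump_def
  by (intro borel_measurable_divide borel_measurable_times borel_measurable_continuous_onI[of "poly _"]
      continuous_intros) auto

lemma bump_integrable: "integrable lborel (bump N)"
proof -
  have "integrable lborel (\<lambda>t. indicator {0..1} t *\<^sub>R poly (bump_poly N) t :: real)"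
    by (rule borel_integrable_compact) (auto intro!: continuous_intros)
  then show ?thesis unfolding bump_def by simp
qed

lemma bump_integral: "(\<integral>t. bump N t \<partial>lborel) = 1"
  using bump_mass_pos[of N] unfolding bump_def by (simp add: bump_mass_def)

text \<open>Clamping to the unit interval is 1-Lipschitz, so this form carries the Lipschitz
  constant of the polynomial on \<open>{0..1}\<close> to the whole line.\<close>

lemma bump_eq_clamp: "bump N t = poly (bump_poly N) (max 0 (min 1 t)) / bump_mass N"
  by (auto simp: bump_def indicator_def poly_bump_poly max_def min_def)

lemma bump_lipschitz: "\<exists>L\<ge>0. \<forall>s t. \<bar>bump N s - bump N t\<bar> \<le> L * \<bar>s - t\<bar>"
proof -
  define p where "p = bump_poly N"
  have "bounded ((\<lambda>t. poly (pderiv p) t) ` {0..1})"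
    by (intro compact_imp_bounded compact_continuous_image continuous_intros) auto
  then obtain B where B: "B > 0" "\<And>t. t \<in> {0..1} \<Longrightarrow> \<bar>poly (pderiv p) t\<bar> \<le> B"
    unfolding bounded_pos by auto
  have lip: "\<bar>poly p s - poly p t\<bar> \<le> B * \<bar>s - t\<bar>" if "s \<in> {0..1}" "t \<in> {0..1}" for s t
  proof -
    have "norm (poly p s - poly p t) \<le> B * norm (s - t)"
      by (rule field_differentiable_bound[of "{0..1}" _ "poly (pderiv p)"])
         (use B that in \<open>auto intro: poly_DERIV has_field_derivative_at_within\<close>)
    then show ?thesis by simp
  qed
  have "\<bar>bump N s - bump N t\<bar> \<le> B / bump_mass N * \<bar>s - t\<bar>" for s t
  proof -
    have "\<bar>poly p (max 0 (min 1 s)) - poly p (max 0 (min 1 t))\<bar> \<le> B * \<bar>max 0 (min 1 s) - max 0 (min 1 t)\<bar>"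
      by (rule lip) auto
    also have "\<dots> \<le> B * \<bar>s - t\<bar>" using B by (intro mult_left_mono) auto
    finally show ?thesis
      using bump_mass_pos[of N] unfolding bump_eq_clamp p_def[symmetric]
      by (simp add: diff_divide_distrib[symmetric] divide_right_mono)
  qed
  then show ?thesis using B bump_mass_pos[of N] by (intro exI[of _ "B / bump_mass N"]) auto
qed

definition bump_hat :: "nat \<Rightarrow> real \<Rightarrow> complex" where
  "bump_hat N u = (\<integral>t. complex_of_real (bump N t) * ex (- u * t) \<partial>lborel)"

lemma bump_hat_0: "bump_hat N 0 = 1"
proof -
  have "bump_hat N 0 = complex_of_real (\<integral>t. bump N t \<partial>lborel)"
    unfolding bump_hat_def by (simp only: integral_complex_of_real[symmetric]) simp
  then show ?thesis by (simp add: bump_integral)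
qed

lemma bump_hat_decay: "\<exists>C\<ge>1. \<forall>u. cmod (bump_hat N u) \<le> C / (1 + \<bar>u\<bar>) ^ N"
proof -
  obtain C where C: "C \<ge> 0" "\<And>u. cmod (\<integral>t. indicator {0..1} t *\<^sub>R
      (complex_of_real (poly (bump_poly N) t) * ex (- u * t)) \<partial>lborel) \<le> C / (1 + \<bar>u\<bar>) ^ N"
    using poly_fourier_decay[of N "[:0,1,-1:]"] unfolding bump_poly_def power_Suc2 by blast
  \<comment> \<open>The constant is kept at least 1 because the constant kernel, whose zeroth
    coefficient is 1, has to obey the same bound.\<close>
  have "cmod (bump_hat N u) \<le> max 1 (C / bump_mass N) / (1 + \<bar>u\<bar>) ^ N" for u
  proof -
    have "bump_hat N u = (\<integral>t. indicator {0..1} t *\<^sub>R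
      (complex_of_real (poly (bump_poly N) t) * ex (- u * t)) \<partial>lborel) / bump_mass N"
      unfolding bump_hat_def bump_def
      by (subst integral_divide_zero[symmetric], rule Bochner_Integration.integral_cong)
         (auto simp: indicator_def)
    then have "cmod (bump_hat N u) = cmod (\<integral>t. indicator {0..1} t *\<^sub>R
      (complex_of_real (poly (bump_poly N) t) * ex (- u * t)) \<partial>lborel) / bump_mass N"
      using bump_mass_pos[of N] by (simp add: norm_divide)
    also have "\<dots> \<le> C / (1 + \<bar>u\<bar>) ^ N / bump_mass N"
      using C(2)[of u] bump_mass_pos[of N] by (intro divide_right_mono) auto
    also have "\<dots> = (C / bump_mass N) / (1 + \<bar>u\<bar>) ^ N" by simp
    also have "\<dots> \<le> max 1 (C / bump_mass N) / (1 + \<bar>u\<bar>) ^ N"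
      by (intro divide_right_mono) auto
    finally show ?thesis .
  qed
  then show ?thesis by (intro exI[of _ "max 1 (C / bump_mass N)"]) auto
qed

section \<open>Pointwise convergence of Fourier series\<close>

lemma half_le_sin:
  assumes "0 \<le> x" "x \<le> pi / 2"
  shows "x / 2 \<le> sin x"
proof -
  have "\<bar>sin x - (\<Sum>m<3. sin_coeff m * x ^ m)\<bar> \<le> inverse (fact 3) * \<bar>x\<bar> ^ 3"
    by (rule Maclaurin_sin_bound)
  moreover have "(\<Sum>m<3. sin_coeff m * x ^ m) = x"
    by (simp add: eval_nat_numeral sin_coeff_def)
  ultimately have "\<bar>sin x - x\<bar> \<le> x ^ 3 / 6"
    using assms by (simp add: fact_numeral)
  then have "x - sin x \<le> x ^ 3 / 6" by linarith
  also have "x ^ 3 = x * x ^ 2" by (simp add: eval_nat_numeral)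
  also have "\<dots> \<le> x * 3"
  proof (intro mult_left_mono assms)
    \<comment> \<open>17/10 exceeds pi / 2, and its square 2.89 stays below 3, the value for which
      \<open>x - x ^ 3 / 6\<close> is still at least \<open>x / 2\<close>.\<close>
    have "x \<le> 17/10" using assms pi_approx by simp
    then have "x ^ 2 \<le> (17/10) ^ 2" using assms by (intro power_mono) auto
    then show "x ^ 2 \<le> 3" by (simp add: power2_eq_square)
  qed
  finally show ?thesis by simp
qed

lemma cmod_ex_minus_1: "cmod (ex u - 1) = 2 * \<bar>sin (pi * u)\<bar>"
proof -
  have "(cmod (ex u - 1))\<^sup>2 = (cos (2 * pi * u) - 1)\<^sup>2 + (sin (2 * pi * u))\<^sup>2"
    by (simp add: ex_def cmod_power2)
  also have "\<dots> = 2 - 2 * cos (2 * (pi * u))"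
    using sin_cos_squared_add[of "2 * pi * u"] by (simp add: power2_eq_square algebra_simps)
  also have "\<dots> = (2 * \<bar>sin (pi * u)\<bar>)\<^sup>2"
    by (simp add: cos_double_sin power2_eq_square)
  finally show ?thesis
    by (rule power2_eq_imp_eq) auto
qed

lemma cmod_ex_minus_1_ge_abs:
  assumes "\<bar>u\<bar> \<le> 1 / 2"
  shows "\<bar>u\<bar> \<le> cmod (ex u - 1)"
proof -
  have "\<bar>sin (pi * u)\<bar> = \<bar>sin (pi * \<bar>u\<bar>)\<bar>" by (auto simp: abs_if)
  moreover have "(pi * \<bar>u\<bar>) / 2 \<le> sin (pi * \<bar>u\<bar>)"
    using assms by (intro half_le_sin) (auto simp: field_simps)
  moreover have "1 * \<bar>u\<bar> \<le> pi * \<bar>u\<bar>"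
    using pi_gt3 by (intro mult_right_mono) auto
  ultimately show ?thesis unfolding cmod_ex_minus_1 by linarith
qed

text \<open>For \<open>\<bar>u\<bar> \<le> 1\<close> the minimum is the distance from
  \<open>u\<close> to the nearest integer. Since \<open>ex\<close> has period 1, a shift by 1 or -1
  reduces the range beyond 1/2 to the previous case.\<close>

lemma cmod_ex_minus_1_ge:
  assumes "\<bar>u\<bar> \<le> 1"
  shows "min \<bar>u\<bar> (1 - \<bar>u\<bar>) \<le> cmod (ex u - 1)"
proof (cases "\<bar>u\<bar> \<le> 1 / 2")
  case True
  then show ?thesis using cmod_ex_minus_1_ge_abs[of u] by auto
next
  case False
  define k :: int where "k = (if u > 0 then 1 else -1)"
  have "ex (u - of_int k) = ex u"
    using ex_add[of "u - of_int k" "of_int k"] by simp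
  moreover have "\<bar>u - of_int k\<bar> = 1 - \<bar>u\<bar>"
    using assms False by (auto simp: k_def)
  ultimately show ?thesis
    using cmod_ex_minus_1_ge_abs[of "u - of_int k"] False by auto
qed

section \<open>Orthogonality, Bessel's inequality and Riemann-Lebesgue\<close>

lemma ex_integral_unit_interval:
  "(\<integral>y. ex (of_int k * y) \<partial>restrict_space lborel {0..1}) = (if k = 0 then 1 else 0)"
proof (cases "k = 0")
  case True
  then show ?thesis
    by (simp add: measure_restrict_space)
next
  case False
  have "(\<integral>y. indicator {0..1} y *\<^sub>R ex (of_int k * y) \<partial>lborel) =
      ex (of_int k * 1) / (2 * pi * k * \<i>) - ex (of_int k * 0) / (2 * pi * k * \<i>)"
  proof (rule integral_FTC_Icc[OF zero_le_one])
    fix t :: real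
    have "((\<lambda>a. ex (of_int k * a) / (2 * pi * k * \<i>)) has_vector_derivative
       ((2 * pi * of_int k) *\<^sub>R (\<i> * ex (of_int k * t))) / (2 * pi * k * \<i>)) (at t within {0..1})"
      by (intro has_vector_derivative_divide ex_has_vector_derivative)
    then show "((\<lambda>a. ex (of_int k * a) / (2 * pi * k * \<i>)) has_vector_derivative ex (of_int k * t)) (at t within {0..1})"
      using False by (simp add: scaleR_conv_of_real)
  qed (auto intro!: continuous_intros)
  also have "\<dots> = 0" by simp
  finally show ?thesis using False by (simp add: integral_restrict_space)
qed

lemma unit_interval_finite_measure: "finite_measure (restrict_space lborel {0..1::real})"
  by (rule finite_measureI) (simp add: space_restrict_space emeasure_restrict_space)

lemma unit_interval_integrable:
  fixes h :: "real \<Rightarrow> 'a :: {banach, second_countable_topology}"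
  assumes "h \<in> borel_measurable borel" "\<And>y. y \<in> {0..1} \<Longrightarrow> norm (h y) \<le> B"
  shows "integrable (restrict_space lborel {0..1}) h"
proof -
  interpret finite_measure "restrict_space lborel {0..1::real}"
    by (rule unit_interval_finite_measure)
  show ?thesis
    using assms by (intro integrable_const_bound[of _ B] AE_I2) (auto simp: space_restrict_space intro: measurable_restrict_space1)
qed

lemma measurable_cnj [measurable]: "cnj \<in> borel_measurable borel"
  by (intro borel_measurable_continuous_onI continuous_intros)

text \<open>Expansion of the nonnegative integral of \<open>(cmod (h y - p y))^2\<close>, with
  \<open>p\<close> the projection of \<open>h\<close> onto the characters in \<open>S\<close>: both
  cross terms and the square of \<open>p\<close> integrate to the same \<open>s\<close>.\<close>

lemma bessel_unit_interval:
  fixes h :: "real \<Rightarrow> complex"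
  assumes h [measurable]: "h \<in> borel_measurable borel"
    and B: "\<And>y. y \<in> {0..1} \<Longrightarrow> cmod (h y) \<le> B"
    and S: "finite S"
  defines "a \<equiv> \<lambda>k :: int. \<integral>y. h y * ex (- of_int k * y) \<partial>restrict_space lborel {0..1}"
  shows "(\<Sum>k\<in>S. (cmod (a k))\<^sup>2) \<le> (\<integral>y. (cmod (h y))\<^sup>2 \<partial>restrict_space lborel {0..1})"
proof -
  let ?U = "restrict_space lborel {0..1::real}"
  define p where "p y = (\<Sum>k\<in>S. a k * ex (of_int k * y))" for y
  define P where "P = (\<Sum>k\<in>S. cmod (a k))"
  have p_meas [measurable]: "p \<in> borel_measurable borel"
    unfolding p_def by measurable
  have p_bd: "cmod (p y) \<le> P" for y
    unfolding p_def P_def by (rule order_trans[OF norm_sum]) (simp add: norm_mult)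
  have P0: "P \<ge> 0" unfolding P_def by (intro sum_nonneg) auto
  have B0: "B \<ge> 0" using B[of 0] norm_ge_zero[of "h 0"] by (auto intro: order_trans simp del: norm_ge_zero)
  have i_hh: "integrable ?U (\<lambda>y. h y * cnj (h y))"
    by (rule unit_interval_integrable[of _ "B * B"]) (auto simp: norm_mult intro!: mult_mono B B0)
  have i_hp: "integrable ?U (\<lambda>y. h y * cnj (p y))"
    by (rule unit_interval_integrable[of _ "B * P"]) (auto simp: norm_mult intro!: mult_mono B B0 p_bd)
  have i_ph: "integrable ?U (\<lambda>y. p y * cnj (h y))"
    by (rule unit_interval_integrable[of _ "P * B"]) (auto simp: norm_mult intro!: mult_mono B P0 p_bd)
  have i_pp: "integrable ?U (\<lambda>y. p y * cnj (p y))"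
    by (rule unit_interval_integrable[of _ "P * P"]) (auto simp: norm_mult intro!: mult_mono P0 p_bd)
  have i_he: "integrable ?U (\<lambda>y. h y * ex (- of_int k * y))" for k
    by (rule unit_interval_integrable[of _ B]) (auto simp: norm_mult intro!: B)
  define s where "s = (\<Sum>k\<in>S. a k * cnj (a k))"
  have hp: "(\<integral>y. h y * cnj (p y) \<partial>?U) = s"
  proof -
    have "(\<integral>y. h y * cnj (p y) \<partial>?U) = (\<integral>y. (\<Sum>k\<in>S. cnj (a k) * (h y * ex (- of_int k * y))) \<partial>?U)"
      by (rule Bochner_Integration.integral_cong) (auto simp: p_def sum_distrib_left ex_minus mult_ac)
    also have "\<dots> = (\<Sum>k\<in>S. cnj (a k) * a k)"
      using i_he by (simp add: a_def)
    finally show ?thesis by (simp add: s_def mult.commute)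
  qed
  have "(\<integral>y. p y * cnj (h y) \<partial>?U) = cnj (\<integral>y. h y * cnj (p y) \<partial>?U)"
    using integral_bounded_linear[OF bounded_linear_cnj i_hp] by (simp add: mult.commute)
  then have ph: "(\<integral>y. p y * cnj (h y) \<partial>?U) = s"
    unfolding hp by (simp add: s_def mult.commute)
  have pp: "(\<integral>y. p y * cnj (p y) \<partial>?U) = s"
  proof -
    have i_e: "integrable ?U (\<lambda>y. ex (of_int k * y))" for k
      by (rule unit_interval_integrable[of _ 1]) auto
    have "(\<integral>y. p y * cnj (p y) \<partial>?U) =
        (\<integral>y. (\<Sum>k\<in>S. \<Sum>l\<in>S. (a k * cnj (a l)) * ex (of_int (k - l) * y)) \<partial>?U)"
    proof (rule Bochner_Integration.integral_cong)
      fix y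
      have "p y * cnj (p y) = (\<Sum>k\<in>S. \<Sum>l\<in>S. (a k * ex (of_int k * y)) * (cnj (a l) * ex (- (of_int l * y))))"
        by (simp add: p_def sum_product ex_minus)
      also have "\<dots> = (\<Sum>k\<in>S. \<Sum>l\<in>S. (a k * cnj (a l)) * ex (of_int (k - l) * y))"
        by (intro sum.cong refl) (simp add: algebra_simps ex_add[symmetric])
      finally show "p y * cnj (p y) = \<dots>" .
    qed auto
    also have "\<dots> = (\<Sum>k\<in>S. \<Sum>l\<in>S. (a k * cnj (a l)) * (if k - l = 0 then 1 else 0))"
      using i_e by (simp add: ex_integral_unit_interval del: right_minus_eq of_int_diff eq_iff_diff_eq_0[symmetric])
    also have "\<dots> = s"
      using S by (simp add: s_def if_distrib[of "(*) _"] cong: if_cong)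
    finally show ?thesis .
  qed
  have "(\<integral>y. complex_of_real ((cmod (h y - p y))\<^sup>2) \<partial>?U) =
     (\<integral>y. (h y * cnj (h y) - h y * cnj (p y)) - (p y * cnj (h y) - p y * cnj (p y)) \<partial>?U)"
    by (rule Bochner_Integration.integral_cong)
       (auto simp: complex_norm_square algebra_simps simp del: of_real_power)
  also have "\<dots> = (\<integral>y. h y * cnj (h y) \<partial>?U) - s"
    using i_hh i_hp i_ph i_pp hp ph pp by simp
  also have "(\<integral>y. h y * cnj (h y) \<partial>?U) = complex_of_real (\<integral>y. (cmod (h y))\<^sup>2 \<partial>?U)"
    by (subst integral_complex_of_real[symmetric]) (simp add: complex_norm_square del: of_real_power)
  also have "s = complex_of_real (\<Sum>k\<in>S. (cmod (a k))\<^sup>2)"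
    by (simp add: s_def complex_norm_square del: of_real_power)
  finally have "(\<integral>y. (cmod (h y - p y))\<^sup>2 \<partial>?U) = (\<integral>y. (cmod (h y))\<^sup>2 \<partial>?U) - (\<Sum>k\<in>S. (cmod (a k))\<^sup>2)"
    by (simp only: integral_complex_of_real of_real_diff[symmetric] of_real_eq_iff)
  moreover have "(\<integral>y. (cmod (h y - p y))\<^sup>2 \<partial>?U) \<ge> 0" by simp
  ultimately show ?thesis by simp
qed

text \<open>Square summability from Bessel makes the coefficients tend to 0 along any sequence of
  distinct frequencies. The form with injective \<open>f\<close> serves both ends \<open>N\<close>
  and \<open>- N - 1\<close> of a telescoped symmetric sum.\<close>

lemma riemann_lebesgue_unit_interval:
  fixes h :: "real \<Rightarrow> complex"
  assumes h [measurable]: "h \<in> borel_measurable borel"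
    and B: "\<And>y. y \<in> {0..1} \<Longrightarrow> cmod (h y) \<le> B"
    and f: "inj (f :: nat \<Rightarrow> int)"
  shows "(\<lambda>n. \<integral>y. h y * ex (- of_int (f n) * y) \<partial>restrict_space lborel {0..1}) \<longlonglongrightarrow> 0"
proof -
  define a where "a k = (\<integral>y. h y * ex (- of_int k * y) \<partial>restrict_space lborel {0..1})" for k :: int
  have "summable (\<lambda>n. (cmod (a (f n)))\<^sup>2)"
  proof (rule summableI_nonneg_bounded)
    fix n
    have "(\<Sum>i<n. (cmod (a (f i)))\<^sup>2) = (\<Sum>k\<in>f ` {..<n}. (cmod (a k))\<^sup>2)"
      using f by (subst sum.reindex) (auto intro: inj_on_subset)
    also have "\<dots> \<le> (\<integral>y. (cmod (h y))\<^sup>2 \<partial>restrict_space lborel {0..1})"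
      unfolding a_def by (rule bessel_unit_interval[OF h B]) auto
    finally show "(\<Sum>i<n. (cmod (a (f i)))\<^sup>2) \<le> (\<integral>y. (cmod (h y))\<^sup>2 \<partial>restrict_space lborel {0..1})" .
  qed auto
  then have "(\<lambda>n. (cmod (a (f n)))\<^sup>2) \<longlonglongrightarrow> 0"
    by (rule summable_LIMSEQ_zero)
  then have "(\<lambda>n. sqrt ((cmod (a (f n)))\<^sup>2)) \<longlonglongrightarrow> sqrt 0"
    by (rule tendsto_real_sqrt)
  then have "(\<lambda>n. a (f n)) \<longlonglongrightarrow> 0"
    by (simp add: tendsto_norm_zero_iff)
  then show ?thesis by (simp add: a_def)
qed

lemma sum_telescope_int:
  fixes G :: "int \<Rightarrow> 'a :: ab_group_add"
  shows "(\<Sum>k\<in>{- int N..int N}. G (k - 1) - G k) = G (- int N - 1) - G (int N)"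
proof (induction N)
  case (Suc N)
  have "{- int (Suc N)..int (Suc N)} = insert (- int (Suc N)) (insert (int (Suc N)) {- int N..int N})"
    by auto
  then show ?case by (simp add: Suc.IH algebra_simps diff_diff_eq2) (metis add.commute minus_add_distrib uminus_add_conv_diff)
qed simp

text \<open>Chernoff's argument: dividing \<open>\<phi> - \<phi> y\<^sub>0\<close> by \<open>e\<^bsup>2\<pi>i(y - y\<^sub>0)\<^esup> - 1\<close> leaves a bounded function,
  whose Fourier coefficients turn the partial sums into a telescoping sum.\<close>

lemma fourier_series_pointwise:
  fixes \<phi> :: "real \<Rightarrow> real"
  assumes meas [measurable]: "\<phi> \<in> borel_measurable borel"
    and lip: "\<And>x y. x \<in> {0..1} \<Longrightarrow> y \<in> {0..1} \<Longrightarrow> \<bar>\<phi> x - \<phi> y\<bar> \<le> L * \<bar>x - y\<bar>"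
    and per: "\<phi> 0 = \<phi> 1"
    and y0: "y0 \<in> {0..1}"
  defines "c \<equiv> \<lambda>k :: int. \<integral>y. complex_of_real (\<phi> y) * ex (- of_int k * y) \<partial>restrict_space lborel {0..1}"
  shows "(\<lambda>N. \<Sum>k\<in>{- int N..int N}. c k * ex (of_int k * y0)) \<longlonglongrightarrow> \<phi> y0"
proof -
  let ?U = "restrict_space lborel {0..1::real}"
  define g where "g y = complex_of_real (\<phi> y - \<phi> y0) / (ex (y - y0) - 1)" for y
  have g_meas [measurable]: "g \<in> borel_measurable borel"
    unfolding g_def by measurable
  have L0: "L \<ge> 0" using lip[of 0 1] by simp
  \<comment> \<open>Because \<open>\<phi> 0 = \<phi> 1\<close>, the Lipschitz bound also holds along
    the complementary arc through the endpoints, of length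
    \<open>1 - \<bar>y - y0\<bar>\<close>.\<close>
  have near: "\<bar>\<phi> y - \<phi> y0\<bar> \<le> L * min \<bar>y - y0\<bar> (1 - \<bar>y - y0\<bar>)" if y: "y \<in> {0..1}" for y
  proof -
    have "\<bar>\<phi> y - \<phi> y0\<bar> \<le> L * (1 - \<bar>y - y0\<bar>)"
    proof (cases "y \<ge> y0")
      case True
      then show ?thesis
        using lip[of y 1] lip[of 0 y0] y y0 per by (auto simp: algebra_simps)
    next
      case False
      then show ?thesis
        using lip[of y 0] lip[of 1 y0] y y0 per by (auto simp: algebra_simps)
    qed
    then show ?thesis using lip[of y y0] y y0 by (auto simp: min_def)
  qed
  \<comment> \<open>Where the denominator of \<open>g\<close> vanishes, \<open>g\<close> is 0 by the
    convention for division; the identity survives because there the circle distance from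
    \<open>y\<close> to \<open>y0\<close> is 0, so \<open>\<phi> y = \<phi> y0\<close>.\<close>
  have eq: "complex_of_real (\<phi> y) = \<phi> y0 + (ex (y - y0) - 1) * g y" if y: "y \<in> {0..1}" for y
  proof (cases "ex (y - y0) = 1")
    case True
    have "min \<bar>y - y0\<bar> (1 - \<bar>y - y0\<bar>) \<le> cmod (ex (y - y0) - 1)"
      using y y0 by (intro cmod_ex_minus_1_ge) auto
    then have "L * min \<bar>y - y0\<bar> (1 - \<bar>y - y0\<bar>) \<le> L * 0"
      using True by (intro mult_left_mono L0) auto
    then have "\<phi> y = \<phi> y0" using near[OF y] by simp
    then show ?thesis using True by simp
  qed (simp add: g_def)
  have g_bd: "cmod (g y) \<le> L" if y: "y \<in> {0..1}" for y
  proof (cases "ex (y - y0) = 1")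
    case False
    have "\<bar>\<phi> y - \<phi> y0\<bar> \<le> L * min \<bar>y - y0\<bar> (1 - \<bar>y - y0\<bar>)" by (rule near[OF y])
    also have "\<dots> \<le> L * cmod (ex (y - y0) - 1)"
      using y y0 by (intro mult_left_mono L0 cmod_ex_minus_1_ge) auto
    finally show ?thesis
      using False by (simp add: g_def norm_divide divide_le_eq del: of_real_diff)
  qed (use L0 in \<open>simp add: g_def\<close>)
  define G where "G k = (\<integral>y. g y * ex (- of_int k * y) \<partial>?U) * ex (of_int k * y0)" for k :: int
  have i_g: "integrable ?U (\<lambda>y. g y * ex (- of_int k * y))" for k
    by (rule unit_interval_integrable[of _ L]) (auto simp: norm_mult g_bd)
  have i_e: "integrable ?U (\<lambda>y. ex (of_int k * y))" for k
    by (rule unit_interval_integrable[of _ 1]) auto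
  \<comment> \<open>The factor \<open>ex (y - y0)\<close> shifts the frequency from \<open>k\<close>
    to \<open>k - 1\<close>, and the twist by \<open>ex (of_int k * y0)\<close> in \<open>G\<close>
    absorbs its phase; the constant \<open>\<phi> y0\<close> contributes only at
    \<open>k = 0\<close>.\<close>
  have c: "c k * ex (of_int k * y0) = (if k = 0 then \<phi> y0 else 0) + (G (k - 1) - G k)" for k
  proof -
    have "c k = (\<integral>y. \<phi> y0 * ex (of_int (- k) * y) +
        (ex (- y0) * (g y * ex (- of_int (k - 1) * y)) - g y * ex (- of_int k * y)) \<partial>?U)"
      unfolding c_def
    proof (rule Bochner_Integration.integral_cong)
      fix y assume "y \<in> space ?U"
      then have y: "y \<in> {0..1}" by (simp add: space_restrict_space)
      have "ex (- of_int (k - 1) * y) = ex (- of_int k * y) * ex y"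
        by (simp add: ex_add[symmetric] algebra_simps)
      moreover have "ex (y - y0) = ex (- y0) * ex y"
        by (simp add: ex_add[symmetric])
      ultimately show "complex_of_real (\<phi> y) * ex (- of_int k * y) = \<phi> y0 * ex (of_int (- k) * y) +
        (ex (- y0) * (g y * ex (- of_int (k - 1) * y)) - g y * ex (- of_int k * y))"
        unfolding eq[OF y] by (simp add: algebra_simps)
    qed auto
    also have "\<dots> = complex_of_real (\<phi> y0) * (if - k = 0 then 1 else 0) +
        (ex (- y0) * (\<integral>y. g y * ex (- of_int (k - 1) * y) \<partial>?U) - (\<integral>y. g y * ex (- of_int k * y) \<partial>?U))"
      unfolding ex_integral_unit_interval[symmetric]
      by (intro has_bochner_integral_integral_eq has_bochner_integral_add has_bochner_integral_diff
          has_bochner_integral_mult_right has_bochner_integral_integrable i_g i_e)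
    finally have ck: "c k = \<dots>" .
    have "c k * ex (of_int k * y0) = (if k = 0 then \<phi> y0 else 0) +
       ((\<integral>y. g y * ex (- of_int (k - 1) * y) \<partial>?U) * (ex (- y0) * ex (of_int k * y0)) - G k)"
      unfolding ck G_def by (simp only: ring_distribs mult_ac) simp
    also have "ex (- y0) * ex (of_int k * y0) = ex (of_int (k - 1) * y0)"
      by (simp add: ex_add[symmetric] algebra_simps)
    finally show ?thesis by (simp add: G_def)
  qed
  have "(\<Sum>k\<in>{- int N..int N}. c k * ex (of_int k * y0)) = \<phi> y0 + (G (- int N - 1) - G (int N))" for N
    unfolding c sum.distrib sum_telescope_int by (simp add: of_real_sum[symmetric] del: of_real_sum)
  moreover have G0: "(\<lambda>N. G (f N)) \<longlonglongrightarrow> 0" if f: "inj f" for f :: "nat \<Rightarrow> int"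
  proof (rule tendsto_norm_zero_cancel)
    have "(\<lambda>n. cmod (\<integral>y. g y * ex (- of_int (f n) * y) \<partial>?U)) \<longlonglongrightarrow> 0"
      by (intro tendsto_norm_zero riemann_lebesgue_unit_interval[OF g_meas g_bd f])
    then show "(\<lambda>N. cmod (G (f N))) \<longlonglongrightarrow> 0"
      by (simp add: G_def norm_mult)
  qed
  have "(\<lambda>N. \<phi> y0 + (G (- int N - 1) - G (int N))) \<longlonglongrightarrow> complex_of_real (\<phi> y0) + (0 - 0)"
    by (intro tendsto_intros G0) (auto simp: inj_def)
  ultimately show ?thesis by simp
qed

section \<open>Periodic kernels and the base measure\<close>

text \<open>The coefficients \<open>c\<close> are tied to \<open>\<phi>\<close> only by pointwise
  convergence of symmetric partial sums. \<open>c 0 = 1\<close> encodes mean value 1, and the bound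
  in \<open>\<delta> * \<bar>of_int k\<bar>\<close> is the scaling of a bump of width
  \<open>\<delta>\<close>.\<close>

definition is_periodic_kernel :: "nat \<Rightarrow> real \<Rightarrow> real \<Rightarrow> (real \<Rightarrow> real) \<Rightarrow> (int \<Rightarrow> complex) \<Rightarrow> bool" where
  "is_periodic_kernel N C \<delta> \<phi> c \<longleftrightarrow>
     \<phi> \<in> borel_measurable borel \<and> (\<forall>y. 0 \<le> \<phi> y) \<and> (\<forall>y. \<phi> y \<noteq> 0 \<longrightarrow> infdist y \<int> \<le> \<delta>) \<and>
     c 0 = 1 \<and> (\<forall>k. cmod (c k) \<le> C / (1 + \<delta> * \<bar>of_int k\<bar>) ^ N) \<and>
     (\<forall>y. (\<lambda>n. \<Sum>k\<in>{- int n..int n}. c k * ex (of_int k * y)) \<longlonglongrightarrow> complex_of_real (\<phi> y))"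

text \<open>\<open>C\<close> precedes \<open>\<delta>\<close>: rescaling a single bump to width
  \<open>\<delta>\<close> turns its coefficients into samples of the one function
  \<open>bump_hat N\<close> at the points \<open>k * \<delta>\<close>.\<close>

lemma periodic_kernel: "\<exists>C\<ge>1. \<forall>\<delta>>0. \<exists>\<phi> c. is_periodic_kernel N C \<delta> \<phi> c"
proof -
  have infdist_frac: "infdist y \<int> \<le> frac y" for y :: real
    using infdist_le[of "real_of_int \<lfloor>y\<rfloor>" "\<int> :: real set" y] by (simp add: dist_real_def frac_def)
  obtain C where C: "C \<ge> 1" "\<And>u. cmod (bump_hat N u) \<le> C / (1 + \<bar>u\<bar>) ^ N"
    using bump_hat_decay[of N] by blast
  show ?thesis
  proof (intro exI[of _ C] conjI C(1) allI impI)
    fix \<delta> :: real assume \<delta>: "\<delta> > 0"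
    show "\<exists>\<phi> c. is_periodic_kernel N C \<delta> \<phi> c"
    proof (cases "\<delta> \<ge> 1")
      \<comment> \<open>Every real lies within distance 1 of the integers, so the constant kernel 1
        serves for such wide \<open>\<delta>\<close>.\<close>
      case True
      have "infdist y \<int> \<le> \<delta>" for y :: real
        using True infdist_frac[of y] frac_lt_1[of y] by linarith
      moreover have "(\<Sum>k\<in>{- int n..int n}. (if k = 0 then 1 else 0) * ex (of_int k * y)) = 1" for n y
        by (simp add: if_distrib[of "\<lambda>c. c * _"] cong: if_cong)
      ultimately show ?thesis
        unfolding is_periodic_kernel_def
        using C(1) \<delta> by (intro exI[of _ "\<lambda>_. 1"] exI[of _ "\<lambda>k. if k = 0 then 1 else 0"]) auto
    next
      case False
      \<comment> \<open>For \<open>\<delta> < 1\<close> the rescaled bump lives in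
        \<open>{0..\<delta>}\<close> and fits into one period, so composing it with
        \<open>frac\<close> is its periodisation.\<close>
      define \<phi>0 where "\<phi>0 y = bump N (y / \<delta>) / \<delta>" for y
      define \<phi> where "\<phi> y = \<phi>0 (frac y)" for y
      define c where "c k = bump_hat N (of_int k * \<delta>)" for k :: int
      have [measurable]: "\<phi>0 \<in> borel_measurable borel"
        unfolding \<phi>0_def by measurable
      have [measurable]: "(frac :: real \<Rightarrow> real) \<in> borel_measurable borel"
        unfolding frac_def by measurable
      have meas: "\<phi> \<in> borel_measurable borel"
        unfolding \<phi>_def by measurable
      have supp: "infdist y \<int> \<le> \<delta>" if "\<phi> y \<noteq> 0" for y
      proof -
        have "frac y / \<delta> < 1"
          using that bump_eq_0[of "frac y / \<delta>" N] by (auto simp: \<phi>_def \<phi>0_def not_less[symmetric])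
        then show ?thesis using infdist_frac[of y] \<delta> by (simp add: field_simps)
      qed
      have zero: "\<phi>0 y = 0" if "y \<notin> {0..1}" for y
      proof -
        have "y / \<delta> \<le> 0 \<or> y / \<delta> \<ge> 1"
          using that \<delta> False by (auto simp: field_simps not_le)
        then show ?thesis using bump_eq_0[of "y / \<delta>" N] by (simp add: \<phi>0_def)
      qed
      obtain L where L: "L \<ge> 0" "\<And>s t. \<bar>bump N s - bump N t\<bar> \<le> L * \<bar>s - t\<bar>"
        using bump_lipschitz[of N] by blast
      have lip: "\<bar>\<phi>0 x - \<phi>0 y\<bar> \<le> L / \<delta>\<^sup>2 * \<bar>x - y\<bar>" for x y
      proof -
        have "\<bar>\<phi>0 x - \<phi>0 y\<bar> = \<bar>bump N (x / \<delta>) - bump N (y / \<delta>)\<bar> / \<delta>"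
          using \<delta> by (simp add: \<phi>0_def diff_divide_distrib[symmetric])
        also have "\<dots> \<le> L * \<bar>x / \<delta> - y / \<delta>\<bar> / \<delta>"
          using \<delta> by (intro divide_right_mono L) auto
        also have "\<dots> = L / \<delta>\<^sup>2 * \<bar>x - y\<bar>"
          using \<delta> by (simp add: diff_divide_distrib[symmetric] power2_eq_square)
        finally show ?thesis .
      qed
      have ends: "\<phi>0 0 = 0" "\<phi>0 1 = 0"
        using \<delta> False by (auto simp: \<phi>0_def bump_eq_0)
      have coeff: "(\<integral>y. complex_of_real (\<phi>0 y) * ex (- of_int k * y) \<partial>restrict_space lborel {0..1}) = c k" for k
      proof -
        have "(\<integral>y. complex_of_real (\<phi>0 y) * ex (- of_int k * y) \<partial>restrict_space lborel {0..1}) =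
            (\<integral>y. indicator {0..1} y *\<^sub>R (complex_of_real (\<phi>0 y) * ex (- of_int k * y)) \<partial>lborel)"
          by (rule integral_restrict_space) simp
        also have "\<dots> = (\<integral>y. complex_of_real (\<phi>0 y) * ex (- of_int k * y) \<partial>lborel)"
          by (rule Bochner_Integration.integral_cong) (auto simp: indicator_def zero)
        also have "\<dots> = \<bar>\<delta>\<bar> *\<^sub>R (\<integral>t. complex_of_real (\<phi>0 (0 + \<delta> * t)) * ex (- of_int k * (0 + \<delta> * t)) \<partial>lborel)"
          by (rule lborel_integral_real_affine) (use \<delta> in simp)
        also have "\<dots> = (\<integral>t. \<bar>\<delta>\<bar> *\<^sub>R (complex_of_real (\<phi>0 (0 + \<delta> * t)) * ex (- of_int k * (0 + \<delta> * t))) \<partial>lborel)"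
          by simp
        also have "\<dots> = c k"
          unfolding c_def bump_hat_def
          by (rule Bochner_Integration.integral_cong) (use \<delta> in \<open>auto simp: \<phi>0_def scaleR_conv_of_real mult_ac\<close>)
        finally show ?thesis .
      qed
      have series: "(\<lambda>n. \<Sum>k\<in>{- int n..int n}. c k * ex (of_int k * y)) \<longlonglongrightarrow> complex_of_real (\<phi> y)" for y
      proof -
        have "(\<lambda>n. \<Sum>k\<in>{- int n..int n}. c k * ex (of_int k * frac y)) \<longlonglongrightarrow> complex_of_real (\<phi>0 (frac y))"
          unfolding coeff[symmetric]
          by (rule fourier_series_pointwise[where L = "L / \<delta>\<^sup>2"])
             (use lip ends less_imp_le[OF frac_lt_1[of y]] in auto)
        moreover have "ex (of_int k * y) = ex (of_int k * frac y)" for k :: int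
        proof -
          have "ex (of_int k * y) = ex (of_int k * frac y + of_int (k * \<lfloor>y\<rfloor>))"
            by (simp add: frac_def algebra_simps)
          then show ?thesis by (simp only: ex_add ex_of_int mult_1_right)
        qed
        ultimately show ?thesis by (simp add: \<phi>_def)
      qed
      have "cmod (c k) \<le> C / (1 + \<delta> * \<bar>of_int k\<bar>) ^ N" for k
        using C(2)[of "of_int k * \<delta>"] \<delta> by (simp add: c_def abs_mult mult.commute)
      moreover have "c 0 = 1" by (simp add: c_def bump_hat_0)
      moreover have "0 \<le> \<phi> y" for y using \<delta> by (simp add: \<phi>_def \<phi>0_def bump_nonneg)
      ultimately show ?thesis
        unfolding is_periodic_kernel_def using meas supp series by blast
    qed
  qed
qed

section \<open>A product measure on the unit cube with rapid Fourier decay\<close>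

lemma one_plus_sum_le_prod:
  fixes f :: "'b \<Rightarrow> real"
  assumes "finite A" "\<And>x. x \<in> A \<Longrightarrow> f x \<ge> 0"
  shows "1 + sum f A \<le> (\<Prod>x\<in>A. 1 + f x)"
  using assms
proof (induction A rule: finite_induct)
  case (insert x A)
  have "1 + sum f (insert x A) \<le> (1 + f x) * (1 + sum f A)"
    using insert by (simp add: algebra_simps sum_nonneg)
  also have "\<dots> \<le> (1 + f x) * (\<Prod>x\<in>A. 1 + f x)"
    using insert by (intro mult_left_mono) auto
  finally show ?case using insert by simp
qed simp

text \<open>The transform factorises over coordinates, and the product of the factors
  \<open>1 + \<bar>b \<bullet> \<xi>\<bar>\<close> dominates \<open>1 + norm \<xi>\<close>. The cube
  is half-open because its points are later recovered from floor-based binary expansions; the bump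
  vanishes at 1.\<close>

lemma smooth_cube_measure:
  "\<exists>(M :: 'a :: euclidean_space measure) C. prob_space M \<and> sets M = sets borel \<and> C \<ge> 0 \<and>
     (AE x in M. \<forall>b\<in>Basis. x \<bullet> b \<in> {0..<1}) \<and>
     (\<forall>\<xi>. cmod (\<integral>x. ex (- (x \<bullet> \<xi>)) \<partial>M) \<le> C / (1 + norm \<xi>) ^ N)"
proof -
  define \<nu> where "\<nu> = density lborel (\<lambda>t. ennreal (bump N t))"
  have "prob_space \<nu>"
  proof (rule prob_spaceI)
    have "emeasure \<nu> (space \<nu>) = (\<integral>\<^sup>+t. ennreal (bump N t) \<partial>lborel)"
      by (simp add: \<nu>_def emeasure_density)
    also have "\<dots> = ennreal (\<integral>t. bump N t \<partial>lborel)"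
      by (intro nn_integral_eq_integral bump_integrable) (simp add: bump_nonneg)
    finally show "emeasure \<nu> (space \<nu>) = 1" by (simp add: bump_integral)
  qed
  then interpret \<nu>: prob_space \<nu> .
  have sets_\<nu> [measurable_cong]: "sets \<nu> = sets borel" by (simp add: \<nu>_def)
  interpret P: product_prob_space "\<lambda>_ :: 'a. \<nu>" Basis by unfold_locales
  define \<Phi> :: "('a \<Rightarrow> real) \<Rightarrow> 'a" where "\<Phi> f = (\<Sum>b\<in>Basis. f b *\<^sub>R b)" for f
  have \<Phi>_meas [measurable]: "\<Phi> \<in> measurable (Pi\<^sub>M Basis (\<lambda>_. \<nu>)) borel"
    unfolding \<Phi>_def by measurable
  have \<Phi>_inner: "\<Phi> f \<bullet> b = f b" if "b \<in> Basis" for f b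
    using that by (simp add: \<Phi>_def inner_sum_left inner_Basis if_distrib cong: if_cong)
  define M where "M = distr (Pi\<^sub>M Basis (\<lambda>_. \<nu>)) borel \<Phi>"
  obtain C where C: "C \<ge> 1" "\<And>u. cmod (bump_hat N u) \<le> C / (1 + \<bar>u\<bar>) ^ N"
    using bump_hat_decay[of N] by blast
  have "prob_space M"
    unfolding M_def by (rule P.prob_space_distr) simp
  moreover have "AE x in M. \<forall>b\<in>Basis. x \<bullet> b \<in> {0..<1}"
  proof -
    have "0 \<le> t \<and> t < 1" if "0 < bump N t" for t
      using that bump_eq_0[of t N] by (metis less_irrefl not_le nle_le)
    then have "AE t in \<nu>. t \<in> {0..<1}"
      unfolding \<nu>_def by (subst AE_density) (auto intro!: AE_I2)
    then have "AE f in Pi\<^sub>M Basis (\<lambda>_. \<nu>). f b \<in> {0..<1}" if "b \<in> Basis" for b :: 'a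
      using that by (intro P.AE_component[where P = "\<lambda>t. t \<in> {0..<1}"])
    then have "AE f in Pi\<^sub>M Basis (\<lambda>_. \<nu>). \<forall>b\<in>(Basis :: 'a set). f b \<in> {0..<1}"
      by (intro AE_finite_allI finite_Basis)
    then have "AE f in Pi\<^sub>M Basis (\<lambda>_. \<nu>). \<forall>b\<in>(Basis :: 'a set). \<Phi> f \<bullet> b \<in> {0..<1}"
      by (simp add: \<Phi>_inner)
    then show ?thesis
      unfolding M_def by (subst AE_distr_iff) auto
  qed
  moreover have "cmod (\<integral>x. ex (- (x \<bullet> \<xi>)) \<partial>M) \<le> C ^ DIM('a) / (1 + norm \<xi>) ^ N" for \<xi>
  proof -
    have "(\<integral>x. ex (- (x \<bullet> \<xi>)) \<partial>M) = (\<integral>f. ex (- (\<Phi> f \<bullet> \<xi>)) \<partial>Pi\<^sub>M Basis (\<lambda>_. \<nu>))"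
      unfolding M_def by (rule integral_distr) auto
    also have "\<dots> = (\<integral>f. (\<Prod>b\<in>Basis. ex (- (b \<bullet> \<xi>) * f b)) \<partial>Pi\<^sub>M Basis (\<lambda>_. \<nu>))"
    proof (rule Bochner_Integration.integral_cong)
      fix f :: "'a \<Rightarrow> real"
      have "- (\<Phi> f \<bullet> \<xi>) = (\<Sum>b\<in>Basis. - (b \<bullet> \<xi>) * f b)"
        by (simp add: \<Phi>_def inner_sum_left sum_negf mult.commute)
      then show "ex (- (\<Phi> f \<bullet> \<xi>)) = (\<Prod>b\<in>Basis. ex (- (b \<bullet> \<xi>) * f b))"
        by (simp add: ex_sum)
    qed simp
    also have "\<dots> = (\<Prod>b\<in>Basis. \<integral>t. ex (- (b \<bullet> \<xi>) * t) \<partial>\<nu>)"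
      by (rule P.product_integral_prod) (auto intro!: \<nu>.integrable_const_bound[of _ 1])
    also have "\<dots> = (\<Prod>b\<in>Basis. bump_hat N (b \<bullet> \<xi>))"
    proof (rule prod.cong[OF refl])
      fix b :: 'a
      have "(\<integral>t. ex (- (b \<bullet> \<xi>) * t) \<partial>\<nu>) = (\<integral>t. bump N t *\<^sub>R ex (- (b \<bullet> \<xi>) * t) \<partial>lborel)"
        unfolding \<nu>_def by (rule integral_density) (auto simp: bump_nonneg)
      then show "(\<integral>t. ex (- (b \<bullet> \<xi>) * t) \<partial>\<nu>) = bump_hat N (b \<bullet> \<xi>)"
        by (simp add: bump_hat_def scaleR_conv_of_real)
    qed
    finally have "cmod (\<integral>x. ex (- (x \<bullet> \<xi>)) \<partial>M) = (\<Prod>b\<in>Basis. cmod (bump_hat N (b \<bullet> \<xi>)))"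
      by (simp add: prod_norm)
    also have "\<dots> \<le> (\<Prod>b\<in>(Basis :: 'a set). C / (1 + \<bar>b \<bullet> \<xi>\<bar>) ^ N)"
      by (intro prod_mono) (auto simp: C)
    also have "\<dots> = C ^ DIM('a) / (\<Prod>b\<in>(Basis :: 'a set). 1 + \<bar>b \<bullet> \<xi>\<bar>) ^ N"
      by (simp add: prod_dividef prod_power_distrib)
    also have "\<dots> \<le> C ^ DIM('a) / (1 + norm \<xi>) ^ N"
    proof (intro divide_left_mono power_mono mult_pos_pos zero_less_power prod_pos)
      have "norm \<xi> \<le> (\<Sum>b\<in>Basis. \<bar>\<xi> \<bullet> b\<bar>)" by (rule norm_le_l1)
      then show "1 + norm \<xi> \<le> (\<Prod>b\<in>(Basis :: 'a set). 1 + \<bar>b \<bullet> \<xi>\<bar>)"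
        using one_plus_sum_le_prod[of "Basis :: 'a set" "\<lambda>b. \<bar>b \<bullet> \<xi>\<bar>"] by (simp add: inner_commute)
    qed (use C in \<open>auto simp: add_pos_nonneg\<close>)
    finally show ?thesis .
  qed
  moreover have "sets M = sets borel" by (simp add: M_def)
  ultimately show ?thesis
    using C by (intro exI[of _ M] exI[of _ "C ^ DIM('a)"]) auto
qed

section \<open>Lattice sums and the divisor bound\<close>

lemma sum_int_inverse_square_bounded:
  "\<exists>B>0. \<forall>K. finite K \<longrightarrow> (\<Sum>k\<in>K. 1 / (1 + \<bar>real_of_int k\<bar>) ^ 2) \<le> B"
proof -
  define g where "g n = 1 / (1 + real n) ^ 2" for n
  have "summable (\<lambda>n. inverse (real n ^ 2))"
    by (rule inverse_power_summable) simp
  then have "summable (\<lambda>n. inverse (real (Suc n) ^ 2))"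
    by (subst summable_Suc_iff)
  then have sg: "summable g"
    by (simp add: g_def[abs_def] inverse_eq_divide add.commute)
  have g0: "g n \<ge> 0" for n by (simp add: g_def)
  have sym: "(\<Sum>k\<in>{- int R..int R}. g (nat \<bar>k\<bar>)) \<le> 2 * (\<Sum>n\<le>R. g n)" for R
  proof (induction R)
    case 0
    then show ?case using g0[of 0] by simp
  next
    case (Suc R)
    have "{- int (Suc R)..int (Suc R)} = insert (- int (Suc R)) (insert (int (Suc R)) {- int R..int R})"
      by auto
    then have "(\<Sum>k\<in>{- int (Suc R)..int (Suc R)}. g (nat \<bar>k\<bar>)) =
        2 * g (Suc R) + (\<Sum>k\<in>{- int R..int R}. g (nat \<bar>k\<bar>))"
      by (simp del: of_nat_Suc)
    then show ?case using Suc.IH by simp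
  qed
  have "(\<Sum>k\<in>K. 1 / (1 + \<bar>real_of_int k\<bar>) ^ 2) \<le> 2 * suminf g" if K: "finite K" for K
  proof -
    define R where "R = nat (Max (insert 0 (abs ` K)))"
    have R: "K \<subseteq> {- int R..int R}"
    proof
      fix k assume "k \<in> K"
      then have "\<bar>k\<bar> \<le> Max (insert 0 (abs ` K))" using K by (intro Max_ge) auto
      then show "k \<in> {- int R..int R}" by (auto simp: R_def)
    qed
    have "(\<Sum>k\<in>K. 1 / (1 + \<bar>real_of_int k\<bar>) ^ 2) = (\<Sum>k\<in>K. g (nat \<bar>k\<bar>))"
      by (simp add: g_def)
    also have "\<dots> \<le> (\<Sum>k\<in>{- int R..int R}. g (nat \<bar>k\<bar>))"
      using R g0 by (intro sum_mono2) auto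
    also have "\<dots> \<le> 2 * (\<Sum>n\<le>R. g n)" by (rule sym)
    also have "\<dots> \<le> 2 * suminf g"
      using sum_le_suminf[OF sg, of "{..R}"] g0 by simp
    finally show ?thesis .
  qed
  moreover have "suminf g > 0"
    by (rule suminf_pos[OF sg]) (simp add: g_def)
  ultimately show ?thesis by (intro exI[of _ "2 * suminf g"]) auto
qed

text \<open>Replacing \<open>t\<close> by its floor increases each distance by at most 1, so each
  term changes by a factor of at most 4. Uniformity in \<open>t\<close> becomes uniformity in the
  frequency \<open>\<xi>\<close>.\<close>

lemma sum_int_shifted_inverse_square_bounded:
  "\<exists>B>0. \<forall>t K. finite K \<longrightarrow> (\<Sum>k\<in>K. 1 / (1 + \<bar>t - real_of_int k\<bar>) ^ 2) \<le> B"
proof -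
  obtain B where B: "B > 0" "\<And>K. finite K \<Longrightarrow> (\<Sum>k\<in>K. 1 / (1 + \<bar>real_of_int k\<bar>) ^ 2) \<le> B"
    using sum_int_inverse_square_bounded by blast
  have "(\<Sum>k\<in>K. 1 / (1 + \<bar>t - real_of_int k\<bar>) ^ 2) \<le> 4 * B" if K: "finite K" for t K
  proof -
    have "(\<Sum>k\<in>K. 1 / (1 + \<bar>t - real_of_int k\<bar>) ^ 2) \<le>
       (\<Sum>k\<in>K. 4 * (1 / (1 + \<bar>real_of_int (k - \<lfloor>t\<rfloor>)\<bar>) ^ 2))"
    proof (rule sum_mono)
      fix k
      have "\<bar>real_of_int (k - \<lfloor>t\<rfloor>)\<bar> \<le> \<bar>t - real_of_int k\<bar> + 1"
        using of_int_floor_le[of t] real_of_int_floor_add_one_ge[of t] by (simp add: abs_le_iff) linarith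
      moreover have "(1 + u) / 2 \<le> 1 + v" if "u \<le> v + 1" "0 \<le> v" for u v :: real
        using that by simp
      ultimately have "(1 + \<bar>real_of_int (k - \<lfloor>t\<rfloor>)\<bar>) / 2 \<le> 1 + \<bar>t - real_of_int k\<bar>"
        by (metis abs_ge_zero)
      then have "((1 + \<bar>real_of_int (k - \<lfloor>t\<rfloor>)\<bar>) / 2) ^ 2 \<le> (1 + \<bar>t - real_of_int k\<bar>) ^ 2"
        by (intro power_mono) auto
      then have "1 / (1 + \<bar>t - real_of_int k\<bar>) ^ 2 \<le> 1 / ((1 + \<bar>real_of_int (k - \<lfloor>t\<rfloor>)\<bar>) / 2) ^ 2"
        by (intro divide_left_mono mult_pos_pos zero_less_power) (auto simp: add_pos_nonneg)
      then show "1 / (1 + \<bar>t - real_of_int k\<bar>) ^ 2 \<le> 4 * (1 / (1 + \<bar>real_of_int (k - \<lfloor>t\<rfloor>)\<bar>) ^ 2)"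
        by (simp add: power_divide)
    qed
    also have "\<dots> = 4 * (\<Sum>j\<in>(\<lambda>k. k - \<lfloor>t\<rfloor>) ` K. 1 / (1 + \<bar>real_of_int j\<bar>) ^ 2)"
      by (subst sum.reindex) (auto simp: sum_distrib_left inj_on_def)
    also have "\<dots> \<le> 4 * B" using K by (intro mult_left_mono B) auto
    finally show ?thesis .
  qed
  then show ?thesis using B by (intro exI[of _ "4 * B"]) auto
qed

definition int_lattice :: "'a :: euclidean_space set" where
  "int_lattice = {x. \<forall>b\<in>Basis. x \<bullet> b \<in> \<int>}"

text \<open>Two powers are assigned to each coordinate, whose distance is at most the norm; the sum
  over a box of lattice points then factorises into shifted one-dimensional sums.\<close>

lemma lattice_sum_bounded:
  "\<exists>B>0. \<forall>(\<xi> :: 'a :: euclidean_space) L. finite L \<longrightarrow> L \<subseteq> int_lattice \<longrightarrow>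
     (\<Sum>l\<in>L. 1 / (1 + norm (\<xi> - l)) ^ (2 * DIM('a))) \<le> B"
proof -
  obtain B where B: "B > 0" "\<And>t K. finite K \<Longrightarrow> (\<Sum>k\<in>K. 1 / (1 + \<bar>t - real_of_int k\<bar>) ^ 2) \<le> B"
    using sum_int_shifted_inverse_square_bounded by blast
  have "(\<Sum>l\<in>L. 1 / (1 + norm (\<xi> - l)) ^ (2 * DIM('a))) \<le> B ^ DIM('a)"
    if L: "finite L" "L \<subseteq> int_lattice" for \<xi> :: 'a and L
  proof -
    define F where "F l = restrict (\<lambda>b. \<lfloor>l \<bullet> b\<rfloor>) (Basis :: 'a set)" for l :: 'a
    define K where "K b = (\<lambda>l. \<lfloor>l \<bullet> b\<rfloor>) ` L" for b
    define h where "h b k = 1 / (1 + \<bar>\<xi> \<bullet> b - real_of_int k\<bar>) ^ 2" for b k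
    have inner: "real_of_int \<lfloor>l \<bullet> b\<rfloor> = l \<bullet> b" if "l \<in> L" "b \<in> Basis" for l b
    proof -
      have "l \<bullet> b \<in> \<int>" using that L(2) by (auto simp: int_lattice_def)
      then show ?thesis by (rule of_int_floor)
    qed
    have inj: "inj_on F L"
    proof (rule inj_onI)
      fix l l' assume l: "l \<in> L" "l' \<in> L" "F l = F l'"
      have "l \<bullet> b = l' \<bullet> b" if "b \<in> Basis" for b
      proof -
        have "\<lfloor>l \<bullet> b\<rfloor> = \<lfloor>l' \<bullet> b\<rfloor>"
          using fun_cong[OF l(3), of b] that by (simp add: F_def)
        then show ?thesis using inner[OF l(1) that] inner[OF l(2) that] by metis
      qed
      then show "l = l'" by (rule euclidean_eqI)
    qed
    have "(\<Sum>l\<in>L. 1 / (1 + norm (\<xi> - l)) ^ (2 * DIM('a))) \<le> (\<Sum>l\<in>L. \<Prod>b\<in>Basis. h b (F l b))"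
    proof (rule sum_mono)
      fix l assume l: "l \<in> L"
      have "1 / (1 + norm (\<xi> - l)) ^ (2 * DIM('a)) = (\<Prod>b\<in>(Basis :: 'a set). 1 / (1 + norm (\<xi> - l)) ^ 2)"
        by (simp add: power_mult power_one_over)
      also have "\<dots> \<le> (\<Prod>b\<in>Basis. h b (F l b))"
      proof (rule prod_mono, intro conjI)
        fix b :: 'a assume b: "b \<in> Basis"
        have "\<bar>\<xi> \<bullet> b - real_of_int \<lfloor>l \<bullet> b\<rfloor>\<bar> \<le> norm (\<xi> - l)"
          unfolding inner[OF l b] using Basis_le_norm[OF b, of "\<xi> - l"] by (simp add: inner_diff_left)
        then show "1 / (1 + norm (\<xi> - l)) ^ 2 \<le> h b (F l b)"
          using b unfolding h_def F_def
          by (auto intro!: divide_left_mono mult_pos_pos power_mono zero_less_power simp: add_pos_nonneg)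
      qed auto
      finally show "1 / (1 + norm (\<xi> - l)) ^ (2 * DIM('a)) \<le> (\<Prod>b\<in>Basis. h b (F l b))" .
    qed
    also have "\<dots> = (\<Sum>g\<in>F ` L. \<Prod>b\<in>Basis. h b (g b))"
      using inj by (simp add: sum.reindex)
    also have "\<dots> \<le> (\<Sum>g\<in>PiE Basis K. \<Prod>b\<in>Basis. h b (g b))"
    proof (rule sum_mono2)
      show "finite (PiE Basis K)" using L by (intro finite_PiE) (auto simp: K_def)
      show "F ` L \<subseteq> PiE Basis K" by (auto simp: F_def K_def)
    qed (auto simp: h_def intro!: prod_nonneg)
    also have "\<dots> = (\<Prod>b\<in>Basis. \<Sum>k\<in>K b. h b k)"
      by (rule prod_sum_PiE[symmetric]) (use L in \<open>auto simp: K_def\<close>)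
    also have "\<dots> \<le> (\<Prod>b\<in>(Basis :: 'a set). B)"
    proof (rule prod_mono, intro conjI)
      fix b :: 'a
      show "0 \<le> (\<Sum>k\<in>K b. h b k)" by (intro sum_nonneg) (auto simp: h_def)
      show "(\<Sum>k\<in>K b. h b k) \<le> B"
        unfolding h_def by (rule B) (use L in \<open>auto simp: K_def\<close>)
    qed
    finally show ?thesis by simp
  qed
  then show ?thesis using B by (intro exI[of _ "B ^ DIM('a)"]) auto
qed

section \<open>The divisor function\<close>

lemma card_divisors_le_prod:
  assumes "(n :: nat) > 0"
  shows "card {d. d dvd n} \<le> (\<Prod>p\<in>prime_factors n. multiplicity p n + 1)"
proof -
  define F where "F d = restrict (\<lambda>p. multiplicity p d) (prime_factors n)" for d
  have "inj_on F {d. d dvd n}"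
  proof (rule inj_onI)
    fix d d' assume d: "d \<in> {d. d dvd n}" "d' \<in> {d. d dvd n}" "F d = F d'"
    then have pos: "d > 0" "d' > 0" using assms by (auto intro!: Nat.gr0I)
    show "d = d'"
    proof (rule multiplicity_eq_nat[OF pos])
      fix p :: nat assume p: "prime p"
      show "multiplicity p d = multiplicity p d'"
      proof (cases "p \<in> prime_factors n")
        case True
        then show ?thesis using fun_cong[OF d(3), of p] by (simp add: F_def)
      next
        case False
        then have "\<not> p dvd n" using p assms by (auto simp: prime_factors_dvd)
        then have "\<not> p dvd d" "\<not> p dvd d'" using d by (auto dest: dvd_trans)
        then show ?thesis by (simp add: not_dvd_imp_multiplicity_0)
      qed
    qed
  qed
  moreover have "F ` {d. d dvd n} \<subseteq> PiE (prime_factors n) (\<lambda>p. {..multiplicity p n})"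
    using assms by (auto simp: F_def intro!: dvd_imp_multiplicity_le)
  ultimately have "card {d. d dvd n} \<le> card (PiE (prime_factors n) (\<lambda>p. {..multiplicity p n}))"
    by (intro card_inj_on_le finite_PiE) auto
  then show ?thesis by (simp add: card_PiE)
qed

lemma divisor_bound:
  assumes \<epsilon>: "\<epsilon> > 0"
  shows "\<exists>D\<ge>1. \<forall>n>0. real (card {d :: nat. d dvd n}) \<le> D * real n powr \<epsilon>"
proof -
  \<comment> \<open>\<open>C\<close> makes \<open>C * (\<epsilon> * ln 2) \<ge> 1\<close>, so that
    \<open>a + 1 \<le> C * (1 + a * (\<epsilon> * ln 2)) \<le> C * 2 powr (a * \<epsilon>)\<close>;
    \<open>P\<close> is the threshold from which \<open>p powr \<epsilon> \<ge> 2\<close>.\<close>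
  define C where "C = max 1 (1 / (\<epsilon> * ln 2))"
  define P where "P = nat \<lceil>2 powr (1 / \<epsilon>)\<rceil>"
  have C: "C \<ge> 1" "1 \<le> C * (\<epsilon> * ln 2)"
  proof -
    have "1 / (\<epsilon> * ln 2) \<le> C" by (simp add: C_def)
    then show "1 \<le> C * (\<epsilon> * ln 2)" using \<epsilon> by (simp add: field_simps)
  qed (simp add: C_def)
  have pow: "(real p ^ a) powr \<epsilon> = (real p powr \<epsilon>) ^ a" if "prime p" for p a :: nat
    using that by (simp add: powr_realpow[symmetric] powr_powr mult.commute prime_gt_0_nat)
  have factor: "real a + 1 \<le> (if p < P then C else 1) * (real p ^ a) powr \<epsilon>" if p: "prime p" for p a :: nat
  proof (cases "p < P")
    case True
    have "real a + 1 \<le> C * (1 + real a * (\<epsilon> * ln 2))"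
      using C mult_left_mono[OF C(2), of "real a"] by (simp add: algebra_simps)
    also have "\<dots> \<le> C * exp (real a * (\<epsilon> * ln 2))"
      using C by (intro mult_left_mono exp_ge_add_one_self) auto
    also have "exp (real a * (\<epsilon> * ln 2)) = (2 powr \<epsilon>) ^ a"
      by (simp add: powr_def exp_of_nat_mult)
    also have "C * \<dots> \<le> C * (real p powr \<epsilon>) ^ a"
      using C \<epsilon> prime_ge_2_nat[OF p] by (intro mult_left_mono power_mono powr_mono2) auto
    finally show ?thesis using True by (simp add: pow[OF p])
  next
    case False
    have "2 = (2 powr (1 / \<epsilon>)) powr \<epsilon>" using \<epsilon> by (simp add: powr_powr)
    also have "\<dots> \<le> real p powr \<epsilon>"
      using False \<epsilon> by (intro powr_mono2) (auto simp: P_def not_less nat_le_iff ceiling_le_iff)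
    finally have "2 ^ a \<le> (real p powr \<epsilon>) ^ a" by (intro power_mono) auto
    moreover have "real a + 1 \<le> 2 ^ a"
      using less_exp[of a] by (metis Suc_leI of_nat_Suc of_nat_le_iff of_nat_numeral of_nat_power add.commute)
    ultimately show ?thesis using False by (simp add: pow[OF p])
  qed
  have "real (card {d. d dvd n}) \<le> C ^ P * real n powr \<epsilon>" if n: "n > 0" for n :: nat
  proof -
    have "real (card {d. d dvd n}) \<le> real (\<Prod>p\<in>prime_factors n. multiplicity p n + 1)"
      using card_divisors_le_prod[OF n] by (simp only: of_nat_le_iff)
    also have "\<dots> = (\<Prod>p\<in>prime_factors n. real (multiplicity p n) + 1)" by (simp add: add.commute)
    also have "\<dots> \<le> (\<Prod>p\<in>prime_factors n. (if p < P then C else 1) * (real p ^ multiplicity p n) powr \<epsilon>)"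
      by (intro prod_mono conjI factor) auto
    also have "\<dots> = (\<Prod>p\<in>prime_factors n. if p < P then C else 1) * (\<Prod>p\<in>prime_factors n. (real p ^ multiplicity p n) powr \<epsilon>)"
      by (rule prod.distrib)
    also have "(\<Prod>p\<in>prime_factors n. (real p ^ multiplicity p n) powr \<epsilon>) = (\<Prod>p\<in>prime_factors n. real p ^ multiplicity p n) powr \<epsilon>"
      by (rule prod_powr_distrib[symmetric])
    also have "(\<Prod>p\<in>prime_factors n. real p ^ multiplicity p n) = real (\<Prod>p\<in>prime_factors n. p ^ multiplicity p n)"
      by simp
    also have "(\<Prod>p\<in>prime_factors n. p ^ multiplicity p n) = n"
      using prime_factorization_nat[OF n] by simp
    also have "(\<Prod>p\<in>prime_factors n. if p < P then C else 1) = C ^ card (prime_factors n \<inter> {p. p < P})"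
      by (simp add: prod.If_cases)
    also have "\<dots> \<le> C ^ P"
    proof (rule power_increasing[OF _ C(1)])
      have "card (prime_factors n \<inter> {p. p < P}) \<le> card {..<P}" by (intro card_mono) auto
      then show "card (prime_factors n \<inter> {p. p < P}) \<le> P" by simp
    qed
    finally show ?thesis by (simp add: mult_right_mono)
  qed
  then show ?thesis using C by (intro exI[of _ "C ^ P"]) auto
qed

section \<open>Integer rank-one matrices\<close>

definition outer :: "('m :: finite \<Rightarrow> int) \<Rightarrow> int ^ 'n \<Rightarrow> real ^ 'n ^ 'm" where
  "outer k q = (\<chi> i j. of_int (k i) * of_int (q $ j))"

lemma outer_nth [simp]: "outer k q $ i $ j = of_int (k i) * of_int (q $ j)"
  by (simp add: outer_def)

lemma matrix_entry_le_norm: "\<bar>x $ i $ j\<bar> \<le> norm (x :: real ^ 'n ^ 'm)"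
  using Finite_Cartesian_Product.norm_nth_le[of "x $ i" j] Finite_Cartesian_Product.norm_nth_le[of x i] by simp

lemma outer_in_int_lattice: "outer k q \<in> int_lattice"
  by (auto simp: int_lattice_def Basis_vec_def inner_axis)

text \<open>Fix a nonzero entry \<open>z = k i * q $ j\<close>. The number \<open>q $ j\<close>
  divides \<open>z\<close> and determines the whole factorisation: column \<open>j\<close> of
  \<open>l\<close> yields \<open>k\<close>, then row \<open>i\<close> yields \<open>q\<close>. The
  fibre is thus no larger than the set of positive and negative divisors of \<open>z\<close>, and
  \<open>\<bar>z\<bar> \<le> norm l\<close>.\<close>

lemma card_outer_fibre:
  assumes \<epsilon>: "\<epsilon> > 0"
  shows "\<exists>D>0. \<forall>(l :: real ^ 'n ^ 'm) S. l \<noteq> 0 \<longrightarrow> (\<forall>(k, q)\<in>S. outer k q = l) \<longrightarrow>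
           real (card S) \<le> D * norm l powr \<epsilon>"
proof -
  obtain D where D: "D \<ge> 1" "\<And>n. n > 0 \<Longrightarrow> real (card {d :: nat. d dvd n}) \<le> D * real n powr \<epsilon>"
    using divisor_bound[OF \<epsilon>] by blast
  have "real (card S) \<le> (2 * D) * norm l powr \<epsilon>"
    if l: "l \<noteq> 0" and S_outer: "\<forall>(k, q)\<in>S. outer k q = l"
    for l :: "real ^ 'n ^ 'm" and S :: "(('m \<Rightarrow> int) \<times> (int ^ 'n)) set"
  proof (cases "S = {}")
    case True
    then show ?thesis using D by simp
  next
    case False
    from S_outer have S: "outer k q = l" if "(k, q) \<in> S" for k q
      using that by auto
    from l obtain i j where ij: "l $ i $ j \<noteq> 0" by (metis vec_eq_iff zero_index)
    from False obtain k0 q0 where kq0: "(k0, q0) \<in> S" by auto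
    define z where "z = k0 i * q0 $ j"
    have z: "l $ i $ j = of_int z" using S[OF kq0] by (auto simp: z_def)
    have z0: "z \<noteq> 0" using ij z by auto
    define A where "A = {d :: nat. d dvd nat \<bar>z\<bar>}"
    have entry: "k i' * q $ j' = k' i' * q' $ j'" if "(k, q) \<in> S" "(k', q') \<in> S" for k q k' q' i' j'
    proof -
      have "outer k q $ i' $ j' = outer k' q' $ i' $ j'" using S that by metis
      then show ?thesis by (simp flip: of_int_mult)
    qed
    have kq: "k i * q $ j = z" if "(k, q) \<in> S" for k q
      using entry[OF that kq0] by (simp add: z_def)
    have "inj_on (\<lambda>(k, q). q $ j) S"
    proof (rule inj_onI, clarify)
      fix k q k' q' assume kq': "(k, q) \<in> S" "(k', q') \<in> S" and eq: "q $ j = q' $ j"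
      have qj: "q' $ j \<noteq> 0" using kq[OF kq'(2)] z0 by auto
      have k: "k i' = k' i'" for i' using entry[OF kq', of i' j] eq qj by simp
      have ki: "k' i \<noteq> 0" using kq[OF kq'(2)] z0 by auto
      have "q $ j' = q' $ j'" for j' using entry[OF kq', of i j'] k[of i] ki by simp
      then show "k = k' \<and> q = q'" using k by (auto simp: vec_eq_iff)
    qed
    moreover have "(\<lambda>(k, q). q $ j) ` S \<subseteq> int ` A \<union> (\<lambda>d. - int d) ` A"
    proof clarify
      fix k q assume "(k, q) \<in> S" and *: "q $ j \<notin> (\<lambda>d. - int d) ` A"
      then have "q $ j dvd z" using kq by (metis dvd_triv_right)
      then have "nat \<bar>q $ j\<bar> \<in> A" by (simp add: A_def nat_abs_dvd_iff[symmetric] flip: dvd_nat_abs_iff)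
      moreover have "q $ j = int (nat \<bar>q $ j\<bar>) \<or> q $ j = - int (nat \<bar>q $ j\<bar>)" by auto
      ultimately show "q $ j \<in> int ` A" using * by (metis image_eqI)
    qed
    moreover have A: "finite A" unfolding A_def by (rule finite_divisors_nat) (use z0 in simp)
    ultimately have "card S \<le> card (int ` A \<union> (\<lambda>d. - int d) ` A)"
      by (intro card_inj_on_le) auto
    also have "\<dots> \<le> card A + card A"
      using card_Un_le[of "int ` A" "(\<lambda>d. - int d) ` A"] card_image_le[OF A, of int]
        card_image_le[OF A, of "\<lambda>d. - int d"] by linarith
    finally have "real (card S) \<le> 2 * real (card A)" by simp
    also have "real (card A) \<le> D * real (nat \<bar>z\<bar>) powr \<epsilon>"
      unfolding A_def using z0 by (intro D) auto
    also have "real (nat \<bar>z\<bar>) powr \<epsilon> \<le> norm l powr \<epsilon>"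
      using matrix_entry_le_norm[of l i j] \<epsilon> z by (intro powr_mono2) auto
    finally show ?thesis using D by simp
  qed
  then show ?thesis using D by (intro exI[of _ "2 * D"] conjI allI impI) auto
qed

section \<open>Weak limits on the cube\<close>

text \<open>Schoenberg's space-filling curve: \<open>tooth\<close> reads off the leading ternary digit of its argument
  modulo \<open>2\<close> whenever that digit is \<open>0\<close> or \<open>2\<close>.\<close>

definition tooth :: "real \<Rightarrow> real" where
  "tooth u = max 0 (min 1 (1/2 - cos (pi * u)))"

lemma tooth_bounds: "0 \<le> tooth u" "tooth u \<le> 1"
  by (auto simp: tooth_def)

lemma tooth_shift: "tooth (2 * of_int k + u) = tooth u"
proof -
  have "cos (pi * (2 * of_int k + u)) = cos (pi * u + 2 * pi * of_int k)"
    by (simp add: algebra_simps)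
  also have "\<dots> = cos (pi * u)"
    unfolding cos_add cos_int_2pin sin_int_2pin by simp
  finally show ?thesis by (simp add: tooth_def)
qed

lemma tooth_eq_0: "0 \<le> u \<Longrightarrow> u \<le> 1/3 \<Longrightarrow> tooth u = 0"
  using cos_monotone_0_pi_le[of "pi * u" "pi / 3"] by (simp add: tooth_def cos_60)

lemma tooth_eq_1:
  assumes "2/3 \<le> u" "u \<le> 1"
  shows "tooth u = 1"
proof -
  have "cos (pi * u) \<le> cos (pi - pi / 3)"
    using assms by (intro cos_monotone_0_pi_le) (auto simp: field_simps)
  also have "\<dots> = - 1/2" by (simp only: cos_pi_minus cos_60)
  finally show ?thesis by (simp add: tooth_def)
qed

lemma continuous_on_tooth: "continuous_on UNIV (\<lambda>t. tooth (c * t))"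
  unfolding tooth_def by (intro continuous_intros)

section \<open>Binary expansions and ternary codes with digits 0 and 2\<close>

definition binary_digit :: "real \<Rightarrow> nat \<Rightarrow> int" where
  "binary_digit y j = \<lfloor>2 * (2 ^ j * y)\<rfloor> - 2 * \<lfloor>2 ^ j * y\<rfloor>"

lemma binary_digit_cases: "binary_digit y j = 0 \<or> binary_digit y j = 1"
  unfolding binary_digit_def by linarith

lemma binary_expansion:
  assumes "y \<in> {0..<1}"
  shows "(\<lambda>j. of_int (binary_digit y j) / 2 ^ Suc j) sums y"
proof -
  \<comment> \<open>The digits are differences of consecutive floors, so the sum telescopes;
    \<open>0 \<le> y < 1\<close> enters at \<open>n = 0\<close>, where the floor must be 0.\<close>
  have "(\<Sum>j<n. of_int (binary_digit y j) / 2 ^ Suc j) = of_int \<lfloor>2 ^ n * y\<rfloor> / (2 ^ n :: real)" for n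
  proof (induction n)
    case 0
    then show ?case using assms by (simp add: floor_eq_iff)
  next
    case (Suc n)
    then show ?case by (simp add: binary_digit_def field_simps)
  qed
  moreover have "(\<lambda>n. of_int \<lfloor>2 ^ n * y\<rfloor> / (2 ^ n :: real)) \<longlonglongrightarrow> y"
  proof (rule tendsto_sandwich)
    have "y - (1/2) ^ n \<le> of_int \<lfloor>2 ^ n * y\<rfloor> / 2 ^ n" for n
    proof -
      have "2 ^ n * y - 1 \<le> of_int \<lfloor>2 ^ n * y\<rfloor>" by linarith
      then have "(2 ^ n * y - 1) / 2 ^ n \<le> of_int \<lfloor>2 ^ n * y\<rfloor> / 2 ^ n" by (intro divide_right_mono) auto
      then show ?thesis by (simp add: diff_divide_distrib power_one_over)
    qed
    then show "\<forall>\<^sub>F n in sequentially. y - (1/2) ^ n \<le> of_int \<lfloor>2 ^ n * y\<rfloor> / 2 ^ n" by simp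
    have "of_int \<lfloor>2 ^ n * y\<rfloor> / 2 ^ n \<le> y" for n
      by (simp add: divide_le_eq mult.commute)
    then show "\<forall>\<^sub>F n in sequentially. of_int \<lfloor>2 ^ n * y\<rfloor> / 2 ^ n \<le> y" by simp
    have "(\<lambda>n. y - (1/2) ^ n) \<longlonglongrightarrow> y - 0"
      by (intro tendsto_intros LIMSEQ_power_zero) auto
    then show "(\<lambda>n. y - (1/2) ^ n) \<longlonglongrightarrow> y" by simp
  qed auto
  ultimately show ?thesis unfolding sums_def by simp
qed

definition ternary_tail :: "(nat \<Rightarrow> int) \<Rightarrow> nat \<Rightarrow> real" where
  "ternary_tail c k = (\<Sum>i. 2 * of_int (c (k + i)) / 3 ^ Suc i)"

context
  fixes c :: "nat \<Rightarrow> int"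
  assumes c: "\<And>k. c k = 0 \<or> c k = 1"
begin

lemma ternary_sums_geometric: "(\<lambda>i. 2 / 3 ^ Suc i) sums (1 :: real)"
  using sums_mult[OF geometric_sums[of "1/3 :: real"], of "2/3"] by (simp add: power_divide)

lemma ternary_term_bounds: "0 \<le> 2 * of_int (c k) / (3 ^ Suc i :: real)" "2 * of_int (c k) / (3 ^ Suc i :: real) \<le> 2 / 3 ^ Suc i"
  using c[of k] by auto

lemma ternary_summable: "summable (\<lambda>i. 2 * of_int (c (k + i)) / (3 ^ Suc i :: real))"
proof (rule summable_comparison_test'[OF sums_summable[OF ternary_sums_geometric], of 0])
  fix i
  show "norm (2 * of_int (c (k + i)) / (3 ^ Suc i :: real)) \<le> 2 / 3 ^ Suc i"
    using c[of "k + i"] by auto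
qed

lemma ternary_tail_bounds: "0 \<le> ternary_tail c k" "ternary_tail c k \<le> 1"
proof -
  show "0 \<le> ternary_tail c k"
    unfolding ternary_tail_def by (intro suminf_nonneg ternary_summable ternary_term_bounds)
  have "ternary_tail c k \<le> (\<Sum>i. 2 / 3 ^ Suc i)"
    unfolding ternary_tail_def
    by (intro suminf_le ternary_summable ternary_term_bounds sums_summable[OF ternary_sums_geometric])
  then show "ternary_tail c k \<le> 1"
    using ternary_sums_geometric by (simp add: sums_iff)
qed

lemma ternary_tail_Suc: "3 * ternary_tail c k = 2 * of_int (c k) + ternary_tail c (Suc k)"
proof -
  have "ternary_tail c k = 2 * of_int (c k) / 3 + (\<Sum>i. 2 * of_int (c (k + Suc i)) / 3 ^ Suc (Suc i))"
    unfolding ternary_tail_def using suminf_split_head[OF ternary_summable[of k]] by simp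
  also have "(\<Sum>i. 2 * of_int (c (k + Suc i)) / 3 ^ Suc (Suc i)) = (\<Sum>i. (1/3) * (2 * of_int (c (Suc k + i)) / (3 ^ Suc i :: real)))"
    by (intro arg_cong[of _ _ suminf] ext) simp
  also have "\<dots> = (1/3) * ternary_tail c (Suc k)"
    unfolding ternary_tail_def by (rule suminf_mult[OF ternary_summable])
  finally show ?thesis by simp
qed

text \<open>All ternary digits \<open>2 * c k\<close> are even, so multiplying by
  \<open>3 ^ k\<close> gives an even integer plus the tail from place \<open>k\<close>, and
  \<open>tooth\<close> has period 2. The tail lies in \<open>[0, 1/3]\<close> or
  \<open>[2/3, 1]\<close> according to its leading digit, and on each of these \<open>tooth\<close>
  is constant.\<close>

lemma tooth_ternary: "tooth (3 ^ k * ternary_tail c 0) = of_int (c k)"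
proof -
  have "\<exists>E :: int. 3 ^ k * ternary_tail c 0 = 2 * of_int E + ternary_tail c k"
  proof (induction k)
    case (Suc k)
    then obtain E :: int where E: "3 ^ k * ternary_tail c 0 = 2 * of_int E + ternary_tail c k" by blast
    have "3 ^ Suc k * ternary_tail c 0 = 3 * (3 ^ k * ternary_tail c 0)" by simp
    also have "\<dots> = 2 * of_int (3 * E + c k) + ternary_tail c (Suc k)"
      unfolding E distrib_left ternary_tail_Suc by simp
    finally show ?case by blast
  qed (auto intro: exI[of _ 0])
  then have "tooth (3 ^ k * ternary_tail c 0) = tooth (ternary_tail c k)"
    using tooth_shift by auto
  also have "\<dots> = of_int (c k)"
    using c[of k] ternary_tail_Suc[of k] ternary_tail_bounds[of "Suc k"]
    by (auto intro!: tooth_eq_0 tooth_eq_1)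
  finally show ?thesis .
qed

end

text \<open>\<open>h\<close> must be continuous, since test functions are pulled back along it; the
  section \<open>g\<close> need only be Borel. Half-open sides are what
  \<open>binary_expansion\<close> handles.\<close>

lemma cube_parametrization:
  "\<exists>(h :: real \<Rightarrow> 'a :: euclidean_space) g. continuous_on UNIV h \<and> g \<in> borel_measurable borel \<and>
     (\<forall>x. g x \<in> {0..1}) \<and> (\<forall>x. (\<forall>b\<in>Basis. x \<bullet> b \<in> {0..<1}) \<longrightarrow> h (g x) = x)"
proof -
  let ?D = "DIM('a)"
  obtain e where e: "bij_betw e {0..<?D} (Basis :: 'a set)"
    using ex_bij_betw_nat_finite[OF finite_Basis] by blast
  \<comment> \<open>The digits of the coordinates are interleaved: place \<open>k\<close> carries
    digit \<open>k div ?D\<close> of coordinate \<open>k mod ?D\<close>, so \<open>h0 i\<close>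
    reads the places \<open>j * ?D + i\<close>.\<close>
  define c where "c x k = binary_digit (x \<bullet> e (k mod ?D)) (k div ?D)" for x k
  define g where "g x = ternary_tail (c x) 0" for x
  define h0 where "h0 i t = (\<Sum>j. tooth (3 ^ (j * ?D + i) * t) / 2 ^ Suc j)" for i t
  define h where "h t = (\<Sum>i\<in>{0..<?D}. h0 i t *\<^sub>R e i)" for t
  have c01: "c x k = 0 \<or> c x k = 1" for x k
    unfolding c_def by (rule binary_digit_cases)
  have "continuous_on UNIV (h0 i)" for i
  proof -
    have "uniform_limit UNIV (\<lambda>n t. \<Sum>j<n. tooth (3 ^ (j * ?D + i) * t) / 2 ^ Suc j) (h0 i) sequentially"
      unfolding h0_def
    proof (rule Weierstrass_m_test)
      show "norm (tooth (3 ^ (j * ?D + i) * t) / 2 ^ Suc j) \<le> (1/2) ^ Suc j" for j t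
        using tooth_bounds[of "3 ^ (j * ?D + i) * t"] by (simp add: power_one_over field_simps)
      show "summable (\<lambda>j. (1/2 :: real) ^ Suc j)"
        unfolding summable_Suc_iff by (rule summable_geometric) simp
    qed
    then show ?thesis
      by (rule uniform_limit_theorem[rotated])
         (auto intro!: always_eventually continuous_intros continuous_on_tooth)
  qed
  then have "continuous_on UNIV h"
    unfolding h_def by (intro continuous_intros)
  moreover have "g \<in> borel_measurable borel"
    unfolding g_def ternary_tail_def c_def binary_digit_def by measurable
  moreover have "g x \<in> {0..1}" for x
    unfolding g_def using ternary_tail_bounds[of "c x" 0] c01 by auto
  moreover have "h (g x) = x" if x: "\<forall>b\<in>Basis. x \<bullet> b \<in> {0..<1}" for x
  proof -
    have "h0 i (g x) = x \<bullet> e i" if i: "i \<in> {0..<?D}" for i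
    proof -
      have "h0 i (g x) = (\<Sum>j. of_int (c x (j * ?D + i)) / 2 ^ Suc j)"
        unfolding h0_def g_def by (simp add: tooth_ternary[OF c01])
      also have "\<dots> = (\<Sum>j. of_int (binary_digit (x \<bullet> e i) j) / 2 ^ Suc j)"
        using i by (simp add: c_def)
      also have "\<dots> = x \<bullet> e i"
        by (rule sums_unique[symmetric], rule binary_expansion)
           (use x i bij_betwE[OF e] in auto)
      finally show ?thesis .
    qed
    then have "h (g x) = (\<Sum>i\<in>{0..<?D}. (x \<bullet> e i) *\<^sub>R e i)"
      unfolding h_def by simp
    also have "\<dots> = (\<Sum>b\<in>Basis. (x \<bullet> b) *\<^sub>R b)"
      by (rule sum.reindex_bij_betw[OF e])
    also have "\<dots> = x" by (rule euclidean_representation)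
    finally show ?thesis .
  qed
  ultimately show ?thesis by blast
qed

text \<open>Transporting the measures to the line along a Borel section of the space-filling curve reduces
  sequential compactness on the cube to Helly's theorem.\<close>

lemma cube_densities_weak_limit:
  fixes M :: "'a :: euclidean_space measure"
  assumes M: "prob_space M" and sets_M: "sets M = sets borel"
    and cube: "AE x in M. \<forall>b\<in>Basis. x \<bullet> b \<in> {0..<1}"
    and \<rho>_meas: "\<And>n. \<rho> n \<in> borel_measurable borel"
    and \<rho>_nonneg: "\<And>n x. 0 \<le> \<rho> n x"
    and \<rho>_int: "\<And>n. integrable M (\<rho> n)" "\<And>n. (\<integral>x. \<rho> n x \<partial>M) = 1"
  shows "\<exists>\<mu> r. prob_space \<mu> \<and> sets \<mu> = sets borel \<and> strict_mono (r :: nat \<Rightarrow> nat) \<and>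
     (\<forall>(f :: 'a \<Rightarrow> complex) B. continuous_on UNIV f \<longrightarrow> (\<forall>x. cmod (f x) \<le> B) \<longrightarrow>
        (\<lambda>n. \<integral>x. \<rho> (r n) x *\<^sub>R f x \<partial>M) \<longlonglongrightarrow> (\<integral>x. f x \<partial>\<mu>))"
proof -
  interpret prob_space M by fact
  note [measurable] = \<rho>_meas
  note [measurable_cong] = sets_M
  obtain h :: "real \<Rightarrow> 'a" and g where hg: "continuous_on UNIV h" "g \<in> borel_measurable borel"
      "\<And>x. g x \<in> {0..1}" "\<And>x. (\<forall>b\<in>Basis. x \<bullet> b \<in> {0..<1}) \<Longrightarrow> h (g x) = x"
    using cube_parametrization by blast
  have h_meas [measurable]: "h \<in> borel_measurable borel"
    using hg(1) by (rule borel_measurable_continuous_onI)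
  note [measurable] = hg(2)
  define P where "P n = density M (\<lambda>x. ennreal (\<rho> n x))" for n
  define N where "N n = distr (P n) borel g" for n
  have P_prob: "prob_space (P n)" for n
  proof (rule prob_spaceI)
    have "emeasure (P n) (space (P n)) = (\<integral>\<^sup>+x. ennreal (\<rho> n x) \<partial>M)"
      by (simp add: P_def emeasure_density cong: nn_integral_cong)
    also have "\<dots> = ennreal (\<integral>x. \<rho> n x \<partial>M)"
      by (intro nn_integral_eq_integral \<rho>_int) (simp add: \<rho>_nonneg)
    finally show "emeasure (P n) (space (P n)) = 1" by (simp add: \<rho>_int)
  qed
  have sets_P [measurable_cong]: "sets (P n) = sets borel" for n by (simp add: P_def sets_M)
  have N_prob: "prob_space (N n)" for n
    unfolding N_def by (rule prob_space.prob_space_distr[OF P_prob]) simp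
  have N_real: "real_distribution (N n)" for n
    by (intro real_distribution.intro real_distribution_axioms.intro N_prob) (simp_all add: N_def)
  have "tight N"
    unfolding tight_def
  proof (intro conjI allI impI)
    fix \<epsilon> :: real assume "\<epsilon> > 0"
    \<comment> \<open>The left end -1 leaves room for the value 0 of \<open>g\<close>, which the
      half-open interval \<open>{0<..1}\<close> would miss.\<close>
    have "measure (N n) {-1<..1} = 1" for n
    proof -
      have "g x \<in> {-1<..1}" for x using hg(3)[of x] by auto
      then have "g -` {-1<..1} \<inter> space (P n) = space (P n)" by blast
      then show ?thesis
        unfolding N_def using prob_space.prob_space[OF P_prob[of n]] by (simp add: measure_distr)
    qed
    then show "\<exists>a b. a < b \<and> (\<forall>n. 1 - \<epsilon> < measure (N n) {a<..b})"
      using \<open>\<epsilon> > 0\<close> by (intro exI[of _ "-1"] exI[of _ 1]) auto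
  qed (rule N_real)
  from tight_imp_convergent_subsubsequence[OF this strict_mono_id]
  obtain r \<nu> where r: "strict_mono (r :: nat \<Rightarrow> nat)" and \<nu>: "real_distribution \<nu>"
    and conv: "weak_conv_m (N \<circ> r) \<nu>" by (auto simp: id_def comp_def)
  interpret \<nu>: real_distribution \<nu> by fact
  define \<mu> where "\<mu> = distr \<nu> borel h"
  have "(\<lambda>n. \<integral>x. \<rho> (r n) x *\<^sub>R f x \<partial>M) \<longlonglongrightarrow> (\<integral>x. f x \<partial>\<mu>)"
    if f: "continuous_on UNIV f" "\<And>x. cmod (f x) \<le> B" for f :: "'a \<Rightarrow> complex" and B
  proof -
    have f_meas [measurable]: "f \<in> borel_measurable borel"
      using f(1) by (rule borel_measurable_continuous_onI)
    have "continuous_on UNIV (f \<circ> h)"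
      using f(1) hg(1) by (intro continuous_on_compose) (auto intro: continuous_on_subset)
    then have fh: "isCont (\<lambda>t. f (h t)) t" for t
      by (simp add: continuous_on_eq_continuous_at comp_def)
    have "(\<lambda>n. integral\<^sup>L (N (r n)) (\<lambda>t. f (h t))) \<longlonglongrightarrow> integral\<^sup>L \<nu> (\<lambda>t. f (h t))"
      using weak_conv_imp_integral_bdd_continuous_conv[of "N \<circ> r" \<nu> "\<lambda>t. f (h t)" B] N_real \<nu> conv fh f(2)
      by (simp add: comp_def)
    moreover have "integral\<^sup>L \<nu> (\<lambda>t. f (h t)) = (\<integral>x. f x \<partial>\<mu>)"
      unfolding \<mu>_def by (subst integral_distr) auto
    moreover have "integral\<^sup>L (N n) (\<lambda>t. f (h t)) = (\<integral>x. \<rho> n x *\<^sub>R f x \<partial>M)" for n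
    proof -
      have "integral\<^sup>L (N n) (\<lambda>t. f (h t)) = (\<integral>x. f (h (g x)) \<partial>P n)"
        unfolding N_def by (subst integral_distr) auto
      also have "\<dots> = (\<integral>x. \<rho> n x *\<^sub>R f (h (g x)) \<partial>M)"
        unfolding P_def by (subst integral_density) (auto simp: \<rho>_nonneg)
      \<comment> \<open>\<open>h\<close> is known to undo \<open>g\<close> only on the half-open
        cube, which carries all of the mass of \<open>M\<close>.\<close>
      also have "\<dots> = (\<integral>x. \<rho> n x *\<^sub>R f x \<partial>M)"
      proof (rule integral_cong_AE)
        show "AE x in M. \<rho> n x *\<^sub>R f (h (g x)) = \<rho> n x *\<^sub>R f x"
          using cube by eventually_elim (simp add: hg(4))
      qed auto
      finally show ?thesis .
    qed
    ultimately show ?thesis by simp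
  qed
  moreover have "prob_space \<mu>"
    unfolding \<mu>_def by (rule \<nu>.prob_space_distr) simp
  ultimately show ?thesis
    using r by (intro exI[of _ \<mu>] exI[of _ r]) (auto simp: \<mu>_def)
qed

section \<open>Sums over rank-one frequencies\<close>

lemma outer_row: "outer k q $ i = real_of_int (k i) *\<^sub>R real_vec q"
  by (simp add: vec_eq_iff real_vec_def)

lemma norm_outer:
  "norm (outer k q) = norm (\<chi> i. real_of_int (k i)) * norm (real_vec q)"
proof -
  have "norm (outer k q) = L2_set (\<lambda>i. norm (real_vec q) * \<bar>real_of_int (k i)\<bar>) UNIV"
    unfolding norm_vec_def[of "outer k q"] outer_row by (simp add: mult.commute)
  also have "\<dots> = norm (real_vec q) * L2_set (\<lambda>i. \<bar>real_of_int (k i)\<bar>) UNIV"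
    by (rule L2_set_right_distrib[symmetric]) simp
  finally show ?thesis by (simp add: norm_vec_def[of "\<chi> i. real_of_int (k i)"] mult.commute)
qed

text \<open>Through this identity a product of characters in the coordinates of
  \<open>x *v real_vec q\<close> becomes one character of \<open>x\<close> with frequency
  \<open>outer k q\<close>.\<close>

lemma inner_outer: "x \<bullet> outer k q = (\<Sum>i\<in>UNIV. real_of_int (k i) * (x $ i \<bullet> real_vec q))"
  unfolding inner_vec_def[of x] by (simp only: outer_row inner_scaleR_right)

text \<open>Peetre's inequality: decay in \<open>x - y\<close> is exchanged for decay in
  \<open>x\<close> at the price of a power of \<open>1 + norm y\<close>.\<close>

lemma one_plus_norm_peetre:
  fixes x y :: "'a :: real_normed_vector"
  shows "1 + norm x \<le> (1 + norm (x - y)) * (1 + norm y)"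
proof -
  have "norm x \<le> norm (x - y) + norm y" using norm_triangle_sub[of x y] by linarith
  moreover have "0 \<le> norm (x - y) * norm y" by simp
  ultimately show ?thesis
    by (simp only: distrib_left distrib_right mult_1_left mult_1_right)
qed

lemma one_plus_norm_int_vec_le_prod:
  "1 + c * norm (\<chi> i. real_of_int (k i)) \<le> (\<Prod>i\<in>UNIV. 1 + c * \<bar>real_of_int (k i)\<bar>)" if "c \<ge> 0"
proof -
  have "norm (\<chi> i. real_of_int (k i)) \<le> (\<Sum>i\<in>UNIV. \<bar>real_of_int (k i)\<bar>)"
    using norm_le_l1_cart[of "\<chi> i. real_of_int (k i)"] by simp
  then have "1 + c * norm (\<chi> i. real_of_int (k i)) \<le> 1 + (\<Sum>i\<in>UNIV. c * \<bar>real_of_int (k i)\<bar>)"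
    using that by (simp add: sum_distrib_left[symmetric] mult_left_mono)
  also have "\<dots> \<le> (\<Prod>i\<in>UNIV. 1 + c * \<bar>real_of_int (k i)\<bar>)"
    using that by (intro one_plus_sum_le_prod) auto
  finally show ?thesis .
qed

text \<open>Multi-indices are functions rather than vectors, so that a product of one-dimensional
  sums expands by \<open>prod_sum_PiE\<close>.\<close>

definition int_box :: "nat \<Rightarrow> ('m :: finite \<Rightarrow> int) set" where
  "int_box n = PiE UNIV (\<lambda>_. {- int n..int n})"

lemma finite_int_box [simp]: "finite (int_box n)"
  unfolding int_box_def by (intro finite_PiE) auto

lemma zero_in_int_box: "(\<lambda>_. 0) \<in> int_box n"
  by (auto simp: int_box_def PiE_def)

lemma prod_sum_int_box:
  fixes f :: "'m :: finite \<Rightarrow> int \<Rightarrow> 'c :: comm_semiring_1"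
  shows "(\<Prod>i\<in>UNIV. \<Sum>k\<in>{- int n..int n}. f i k) = (\<Sum>k\<in>int_box n. \<Prod>i\<in>UNIV. f i (k i))"
  unfolding int_box_def by (rule prod_sum_PiE) auto

text \<open>Only finiteness uniformly in \<open>n\<close> matters here; the bound may depend on
  \<open>q\<close> and \<open>\<delta>\<close>. Of the \<open>K + 2\<close> powers per coordinate,
  \<open>K\<close> absorb the weight and 2 remain for summation.\<close>

lemma weighted_box_sum_bounded:
  fixes q :: "int ^ 'n"
  assumes "\<delta> > 0" "C \<ge> 0"
  shows "\<exists>E. \<forall>n. (\<Sum>k\<in>int_box n. (\<Prod>i\<in>(UNIV :: 'm :: finite set). C / (1 + \<delta> * \<bar>real_of_int (k i)\<bar>) ^ (K + 2)) *
            (1 + norm (outer k q)) ^ K) \<le> E"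
proof -
  obtain B where B: "B > 0" "\<And>K. finite K \<Longrightarrow> (\<Sum>k\<in>K. 1 / (1 + \<bar>real_of_int k\<bar>) ^ 2) \<le> B"
    using sum_int_inverse_square_bounded by blast
  \<comment> \<open>With \<open>\<delta>' \<le> 1\<close> and
    \<open>\<delta>' \<le> \<delta>\<close> one has
    \<open>\<delta>' * (1 + t) \<le> 1 + \<delta> * t\<close>, which removes \<open>\<delta>\<close>
    from the sum.\<close>
  define \<delta>' where "\<delta>' = min 1 \<delta>"
  have \<delta>': "\<delta>' > 0" "\<delta>' \<le> 1" "\<delta>' \<le> \<delta>" using assms by (auto simp: \<delta>'_def)
  define A where "A = C / \<delta>' ^ (K + 2)"
  have A: "A \<ge> 0" using assms \<delta>' by (simp add: A_def)
  define L where "L = (1 + norm (real_vec q)) ^ K"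
  have L: "L \<ge> 0" by (simp add: L_def)
  have "(\<Sum>k\<in>int_box n. (\<Prod>i\<in>(UNIV :: 'm set). C / (1 + \<delta> * \<bar>real_of_int (k i)\<bar>) ^ (K + 2)) *
            (1 + norm (outer k q)) ^ K) \<le> L * (A * B) ^ CARD('m)" for n
  proof -
    have "(\<Sum>k\<in>int_box n. (\<Prod>i\<in>(UNIV :: 'm set). C / (1 + \<delta> * \<bar>real_of_int (k i)\<bar>) ^ (K + 2)) *
            (1 + norm (outer k q)) ^ K) \<le>
         (\<Sum>k\<in>int_box n. L * (\<Prod>i\<in>(UNIV :: 'm set). A * (1 / (1 + \<bar>real_of_int (k i)\<bar>) ^ 2)))"
    proof (rule sum_mono)
      fix k :: "'m \<Rightarrow> int"
      let ?k = "\<chi> i. real_of_int (k i)"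
      have "1 + norm (outer k q) \<le> (1 + norm (real_vec q)) * (1 + norm ?k)"
        by (simp add: norm_outer algebra_simps)
      also have "1 + norm ?k \<le> (\<Prod>i\<in>UNIV. 1 + \<bar>real_of_int (k i)\<bar>)"
        using one_plus_norm_int_vec_le_prod[of 1 k] by simp
      finally have "(1 + norm (outer k q)) ^ K \<le> ((1 + norm (real_vec q)) * (\<Prod>i\<in>UNIV. 1 + \<bar>real_of_int (k i)\<bar>)) ^ K"
        by (intro power_mono) (auto simp: mult_left_mono)
      also have "\<dots> = L * (\<Prod>i\<in>UNIV. (1 + \<bar>real_of_int (k i)\<bar>) ^ K)"
        by (simp add: L_def power_mult_distrib prod_power_distrib)
      finally have "(\<Prod>i\<in>(UNIV :: 'm set). C / (1 + \<delta> * \<bar>real_of_int (k i)\<bar>) ^ (K + 2)) * (1 + norm (outer k q)) ^ K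
         \<le> (\<Prod>i\<in>(UNIV :: 'm set). C / (1 + \<delta> * \<bar>real_of_int (k i)\<bar>) ^ (K + 2)) * (L * (\<Prod>i\<in>UNIV. (1 + \<bar>real_of_int (k i)\<bar>) ^ K))"
        using assms by (intro mult_left_mono prod_nonneg) auto
      also have "\<dots> = L * (\<Prod>i\<in>(UNIV :: 'm set). C / (1 + \<delta> * \<bar>real_of_int (k i)\<bar>) ^ (K + 2) * (1 + \<bar>real_of_int (k i)\<bar>) ^ K)"
        unfolding prod.distrib by (simp only: mult_ac)
      also have "\<dots> \<le> L * (\<Prod>i\<in>(UNIV :: 'm set). A * (1 / (1 + \<bar>real_of_int (k i)\<bar>) ^ 2))"
      proof (intro mult_left_mono prod_mono conjI L)
        fix i
        define t where "t = \<bar>real_of_int (k i)\<bar>"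
        have t: "t \<ge> 0" by (simp add: t_def)
        have "\<delta>' * (1 + t) \<le> 1 + \<delta> * t"
          using \<delta>' t mult_right_mono[OF \<delta>'(3) t] by (simp add: distrib_left)
        then have "(\<delta>' * (1 + t)) ^ (K + 2) \<le> (1 + \<delta> * t) ^ (K + 2)"
          using \<delta>' t by (intro power_mono) auto
        then have "C / (1 + \<delta> * t) ^ (K + 2) * (1 + t) ^ K \<le> C / (\<delta>' * (1 + t)) ^ (K + 2) * (1 + t) ^ K"
          using \<delta>' t assms by (intro mult_right_mono divide_left_mono mult_pos_pos zero_less_power) (auto simp: add_pos_nonneg)
        also have "\<dots> = A * (1 / (1 + t) ^ 2)"
          using t by (simp add: A_def power_mult_distrib power_add power2_eq_square)
        finally show "C / (1 + \<delta> * t) ^ (K + 2) * (1 + t) ^ K \<le> A * (1 / (1 + t) ^ 2)" .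
        show "0 \<le> C / (1 + \<delta> * t) ^ (K + 2) * (1 + t) ^ K" using assms t by auto
      qed
      finally show "(\<Prod>i\<in>(UNIV :: 'm set). C / (1 + \<delta> * \<bar>real_of_int (k i)\<bar>) ^ (K + 2)) * (1 + norm (outer k q)) ^ K
         \<le> L * (\<Prod>i\<in>(UNIV :: 'm set). A * (1 / (1 + \<bar>real_of_int (k i)\<bar>) ^ 2))" .
    qed
    also have "\<dots> = L * (\<Prod>i\<in>(UNIV :: 'm set). A * (\<Sum>k\<in>{- int n..int n}. 1 / (1 + \<bar>real_of_int k\<bar>) ^ 2))"
      unfolding sum_distrib_left prod_sum_int_box by (rule refl)
    also have "\<dots> \<le> L * (\<Prod>i\<in>(UNIV :: 'm set). A * B)"
      using L A by (intro mult_left_mono prod_mono conjI mult_nonneg_nonneg sum_nonneg B) auto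
    finally show ?thesis by simp
  qed
  then show ?thesis by blast
qed

text \<open>\<open>D\<close> is independent of \<open>A\<close>, \<open>n\<close> and
  \<open>\<xi>\<close>. The kernel product is at most a constant times the power \<open>- a'\<close>
  of \<open>\<Psi> q\<close> times the norm of \<open>k\<close>, so \<open>\<Psi>\<close> cancels
  against the weight and \<open>norm (outer k q) powr (- a')\<close> is left. Collecting equal
  frequencies \<open>l\<close> costs \<open>norm l powr (a' - a)\<close>. The surviving
  \<open>norm l powr (- a)\<close> is traded for \<open>(1 + norm \<xi>) powr (- a)\<close> with
  \<open>d\<close> of the \<open>K = 3 * d\<close> powers, and the other \<open>2 * d\<close> sum
  over the lattice.\<close>

lemma frequency_sum_bound:
  fixes \<Psi> :: "int ^ 'n \<Rightarrow> real"
  assumes a: "0 \<le> a" "a < a'" "a' \<le> real K" and K: "K = 3 * DIM(real ^ 'n ^ 'm)"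
    and a_le: "a \<le> real (DIM(real ^ 'n ^ 'm))" and C: "C \<ge> 0"
  shows "\<exists>D>0. \<forall>A n (\<xi> :: real ^ 'n ^ 'm). finite A \<longrightarrow> (\<forall>q\<in>A. q \<noteq> 0 \<and> \<Psi> q > 0) \<longrightarrow>
     (\<Sum>(k, q)\<in>(int_box n - {\<lambda>_. 0}) \<times> A. Psi_star \<Psi> q powr a' *
        (\<Prod>i\<in>UNIV. C / (1 + \<Psi> q / 2 * \<bar>real_of_int (k i)\<bar>) ^ (K + 2)) / (1 + norm (\<xi> - outer k q)) ^ K)
     \<le> D * (1 + norm \<xi>) powr (- a)"
proof -
  define d where "d = DIM(real ^ 'n ^ 'm)"
  obtain D0 where D0: "D0 > 0" "\<And>(l :: real ^ 'n ^ 'm) S. l \<noteq> 0 \<Longrightarrow> (\<forall>(k, q)\<in>S. outer k q = l) \<Longrightarrow>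
           real (card S) \<le> D0 * norm l powr (a' - a)"
    using card_outer_fibre[of "a' - a", where ?'m = 'm and ?'n = 'n] a by auto
  obtain B where B: "B > 0" "\<And>(\<xi> :: real ^ 'n ^ 'm) L. finite L \<Longrightarrow> L \<subseteq> int_lattice \<Longrightarrow>
     (\<Sum>l\<in>L. 1 / (1 + norm (\<xi> - l)) ^ (2 * d)) \<le> B"
    using lattice_sum_bounded[where ?'a = "real ^ 'n ^ 'm"] unfolding d_def by auto
  \<comment> \<open>The 2 comes from the half-width \<open>\<Psi> q / 2\<close>, the root from
    comparing the \<open>infnorm\<close> in \<open>Psi_star\<close> with the Euclidean norm.\<close>
  define R where "R = (2 * sqrt (real CARD('n))) powr a'"
  \<comment> \<open>Adding 1 keeps \<open>D\<close> positive even for \<open>C = 0\<close>.\<close>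
  define D where "D = C ^ CARD('m) * R * (D0 * (2 powr a * B)) + 1"
  have R: "R \<ge> 0" by (simp add: R_def)
  have "(\<Sum>(k, q)\<in>(int_box n - {\<lambda>_. 0}) \<times> A. Psi_star \<Psi> q powr a' *
        (\<Prod>i\<in>UNIV. C / (1 + \<Psi> q / 2 * \<bar>real_of_int (k i)\<bar>) ^ (K + 2)) / (1 + norm (\<xi> - outer k q)) ^ K)
     \<le> D * (1 + norm \<xi>) powr (- a)"
    if A: "finite A" "\<forall>q\<in>A. q \<noteq> 0 \<and> \<Psi> q > 0" for A n and \<xi> :: "real ^ 'n ^ 'm"
  proof -
    define T where "T = (int_box n - {\<lambda>_ :: 'm. 0}) \<times> A"
    have T: "finite T" using A by (simp add: T_def)
    define G where "G l = norm l powr (- a') / (1 + norm (\<xi> - l)) ^ K" for l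
    have kq: "norm (\<chi> i. real_of_int (k i)) > 0" "norm (real_vec q) > 0" "\<Psi> q > 0" "infnorm (real_vec q) > 0"
      if "(k, q) \<in> T" for k q
    proof -
      from that have "k \<noteq> (\<lambda>_. 0)" "q \<noteq> 0" "\<Psi> q > 0" using A by (auto simp: T_def)
      then show "norm (\<chi> i. real_of_int (k i)) > 0" "\<Psi> q > 0" by (auto simp: vec_eq_iff)
      have "real_vec q \<noteq> 0" using \<open>q \<noteq> 0\<close> by (auto simp: vec_eq_iff real_vec_def)
      then show "norm (real_vec q) > 0" "infnorm (real_vec q) > 0" by (auto simp: infnorm_pos_lt)
    qed
    have weight: "Psi_star \<Psi> q powr a' * (\<Prod>i\<in>UNIV. C / (1 + \<Psi> q / 2 * \<bar>real_of_int (k i)\<bar>) ^ (K + 2))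
        \<le> C ^ CARD('m) * R * norm (outer k q) powr (- a')" if "(k, q) \<in> T" for k q
    proof -
      let ?k = "norm (\<chi> i. real_of_int (k i))"
      note pos = kq[OF that]
      have "(\<Prod>i\<in>UNIV. C / (1 + \<Psi> q / 2 * \<bar>real_of_int (k i)\<bar>) ^ (K + 2)) =
          C ^ CARD('m) / (\<Prod>i\<in>UNIV. 1 + \<Psi> q / 2 * \<bar>real_of_int (k i)\<bar>) ^ (K + 2)"
        by (simp add: prod_dividef prod_power_distrib del: power_add power_Suc add_2_eq_Suc')
      also have "\<dots> \<le> C ^ CARD('m) / (1 + \<Psi> q / 2 * ?k) ^ (K + 2)"
        using pos C one_plus_norm_int_vec_le_prod[of "\<Psi> q / 2" k]
        by (intro divide_left_mono power_mono mult_pos_pos zero_less_power prod_pos) (auto simp: add_pos_nonneg)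
      also have "\<dots> \<le> C ^ CARD('m) / (\<Psi> q / 2 * ?k) powr a'"
      proof (intro divide_left_mono mult_pos_pos zero_less_power)
        have "(\<Psi> q / 2 * ?k) powr a' \<le> (1 + \<Psi> q / 2 * ?k) powr a'"
          using pos a by (intro powr_mono2) auto
        also have "\<dots> \<le> (1 + \<Psi> q / 2 * ?k) powr real (K + 2)"
          using pos a by (intro powr_mono) auto
        also have "\<dots> = (1 + \<Psi> q / 2 * ?k) ^ (K + 2)"
          using pos by (intro powr_realpow) (auto simp: add_pos_nonneg)
        finally show "(\<Psi> q / 2 * ?k) powr a' \<le> (1 + \<Psi> q / 2 * ?k) ^ (K + 2)" .
      qed (use pos C in \<open>auto simp: add_pos_nonneg\<close>)
      finally have 1: "(\<Prod>i\<in>UNIV. C / (1 + \<Psi> q / 2 * \<bar>real_of_int (k i)\<bar>) ^ (K + 2)) \<le> C ^ CARD('m) / (\<Psi> q / 2 * ?k) powr a'" .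
      have "Psi_star \<Psi> q / (\<Psi> q / 2 * ?k) = 2 / (infnorm (real_vec q) * ?k)"
        using pos by (simp add: Psi_star_def field_simps)
      also have "\<dots> \<le> 2 * sqrt (real CARD('n)) / (norm (real_vec q) * ?k)"
        using pos norm_le_infnorm[of "real_vec q"] by (simp add: field_simps)
      also have "\<dots> = 2 * sqrt (real CARD('n)) / norm (outer k q)"
        by (simp add: norm_outer mult.commute)
      finally have "(Psi_star \<Psi> q / (\<Psi> q / 2 * ?k)) powr a' \<le> (2 * sqrt (real CARD('n)) / norm (outer k q)) powr a'"
        using pos a by (intro powr_mono2) (auto simp: Psi_star_def)
      then have 2: "Psi_star \<Psi> q powr a' / (\<Psi> q / 2 * ?k) powr a' \<le> R * norm (outer k q) powr (- a')"
      proof -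
        have "(Psi_star \<Psi> q / (\<Psi> q / 2 * ?k)) powr a' = Psi_star \<Psi> q powr a' / (\<Psi> q / 2 * ?k) powr a'"
          by (rule powr_divide)
        moreover have "(2 * sqrt (real CARD('n)) / norm (outer k q)) powr a' = R / norm (outer k q) powr a'"
          unfolding R_def by (rule powr_divide)
        ultimately show ?thesis
          using \<open>(Psi_star \<Psi> q / (\<Psi> q / 2 * ?k)) powr a' \<le> _\<close> by (simp only: powr_minus_divide) simp
      qed
      have "Psi_star \<Psi> q powr a' * (\<Prod>i\<in>UNIV. C / (1 + \<Psi> q / 2 * \<bar>real_of_int (k i)\<bar>) ^ (K + 2))
         \<le> Psi_star \<Psi> q powr a' * (C ^ CARD('m) / (\<Psi> q / 2 * ?k) powr a')"
        by (intro mult_left_mono 1) auto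
      also have "\<dots> = C ^ CARD('m) * (Psi_star \<Psi> q powr a' / (\<Psi> q / 2 * ?k) powr a')" by simp
      also have "\<dots> \<le> C ^ CARD('m) * (R * norm (outer k q) powr (- a'))"
        using C by (intro mult_left_mono 2) auto
      finally show ?thesis by (simp add: mult.assoc)
    qed
    have outer_T: "outer k q \<noteq> 0" if "(k, q) \<in> T" for k q
      using kq[OF that] norm_outer[of k q] by (metis mult_pos_pos norm_zero less_irrefl)
    \<comment> \<open>A nonzero integer matrix has norm at least 1, which gives
      \<open>1 + norm l \<le> 2 * norm l\<close> below; this is where excluding \<open>k = 0\<close>
      matters.\<close>
    have norm_ge_1: "norm l \<ge> 1" if l: "l \<in> (\<lambda>(k, q). outer k q) ` T" for l :: "real ^ 'n ^ 'm"
    proof -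
      from l obtain k q where kq': "(k, q) \<in> T" "l = outer k q" by auto
      then have "l \<noteq> 0" using outer_T by auto
      then obtain i j where ij: "l $ i $ j \<noteq> 0" by (metis vec_eq_iff zero_index)
      have "l $ i $ j = real_of_int (k i * q $ j)" by (simp add: kq')
      then have "k i * q $ j \<noteq> 0" using ij by auto
      then have "1 \<le> \<bar>k i * q $ j\<bar>" by linarith
      then have "1 \<le> real_of_int \<bar>k i * q $ j\<bar>" by (simp only: of_int_1_le_iff)
      also have "\<dots> = \<bar>l $ i $ j\<bar>" by (simp add: kq' abs_mult)
      also have "\<dots> \<le> norm l" by (rule matrix_entry_le_norm)
      finally show ?thesis .
    qed
    have fibre: "(\<Sum>p\<in>{p \<in> T. (\<lambda>(k, q). outer k q) p = l}. G l) \<le>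
        D0 * (2 powr a * (1 + norm \<xi>) powr (- a)) * (1 / (1 + norm (\<xi> - l)) ^ (2 * d))"
      if l: "l \<in> (\<lambda>(k, q). outer k q) ` T" for l
    proof -
      note l1 = norm_ge_1[OF l]
      have "(\<Sum>p\<in>{p \<in> T. (\<lambda>(k, q). outer k q) p = l}. G l) =
          real (card {p \<in> T. (\<lambda>(k, q). outer k q) p = l}) * G l"
        by (rule sum_constant)
      also have "\<dots> \<le> D0 * norm l powr (a' - a) * G l"
        using l1 by (intro mult_right_mono D0) (auto simp: G_def)
      also have "\<dots> = D0 * (norm l powr (a' - a) * norm l powr (- a')) / (1 + norm (\<xi> - l)) ^ K"
        by (simp add: G_def)
      also have "norm l powr (a' - a) * norm l powr (- a') = norm l powr (- a)"
        by (simp add: powr_add[symmetric])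
      \<comment> \<open>Peetre's inequality with \<open>y = l\<close>; the hypothesis
        \<open>a \<le> d\<close> bounds the loss by \<open>d\<close> full powers of
        \<open>1 + norm (\<xi> - l)\<close>.\<close>
      also have "D0 * norm l powr (- a) / (1 + norm (\<xi> - l)) ^ K \<le>
          D0 * (2 powr a * (1 + norm \<xi>) powr (- a) * (1 + norm (\<xi> - l)) ^ d) / (1 + norm (\<xi> - l)) ^ K"
      proof (intro divide_right_mono mult_left_mono)
        have pos: "norm l powr a > 0" "(1 + norm \<xi>) powr a > 0" "1 + norm (\<xi> - l) > 0"
        proof -
          have "norm l > 0" "1 + norm \<xi> > 0" "1 + norm (\<xi> - l) > 0"
            using l1 norm_ge_zero[of \<xi>] norm_ge_zero[of "\<xi> - l"] by linarith+
          then show "norm l powr a > 0" "(1 + norm \<xi>) powr a > 0" "1 + norm (\<xi> - l) > 0"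
            by auto
        qed
        have "1 + norm \<xi> \<le> (1 + norm (\<xi> - l)) * (2 * norm l)"
          using one_plus_norm_peetre[of \<xi> l] l1 mult_left_mono[of "1 + norm l" "2 * norm l" "1 + norm (\<xi> - l)"] by simp
        then have "(1 + norm \<xi>) powr a \<le> ((1 + norm (\<xi> - l)) * (2 * norm l)) powr a"
          using a by (intro powr_mono2) auto
        also have "\<dots> = (1 + norm (\<xi> - l)) powr a * (2 powr a * norm l powr a)"
          by (simp add: powr_mult)
        also have "\<dots> \<le> (1 + norm (\<xi> - l)) powr real d * (2 powr a * norm l powr a)"
          using a_le by (intro mult_right_mono powr_mono) (auto simp: d_def)
        also have "(1 + norm (\<xi> - l)) powr real d = (1 + norm (\<xi> - l)) ^ d"
          using pos by (intro powr_realpow)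
        finally have "(1 + norm \<xi>) powr a \<le> (1 + norm (\<xi> - l)) ^ d * (2 powr a * norm l powr a)" .
        then have "1 / norm l powr a \<le> 2 powr a * (1 + norm (\<xi> - l)) ^ d / (1 + norm \<xi>) powr a"
          using pos by (simp add: divide_simps mult_ac)
        then show "norm l powr (- a) \<le> 2 powr a * (1 + norm \<xi>) powr (- a) * (1 + norm (\<xi> - l)) ^ d"
          by (simp add: powr_minus_divide)
      qed (use D0 in auto)
      also have "\<dots> = D0 * (2 powr a * (1 + norm \<xi>) powr (- a)) * (1 / (1 + norm (\<xi> - l)) ^ (2 * d))"
      proof -
        have "1 + norm (\<xi> - l) > 0" by (simp add: add_pos_nonneg)
        then have "(1 + norm (\<xi> - l)) ^ d / (1 + norm (\<xi> - l)) ^ (d + 2 * d) = 1 / (1 + norm (\<xi> - l)) ^ (2 * d)"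
          unfolding power_add by simp
        moreover have "K = d + 2 * d" by (simp add: K d_def)
        ultimately show ?thesis by (metis (no_types) mult.assoc times_divide_eq_right)
      qed
      finally show ?thesis .
    qed
    have "(\<Sum>(k, q)\<in>T. Psi_star \<Psi> q powr a' *
        (\<Prod>i\<in>UNIV. C / (1 + \<Psi> q / 2 * \<bar>real_of_int (k i)\<bar>) ^ (K + 2)) / (1 + norm (\<xi> - outer k q)) ^ K)
       \<le> (\<Sum>(k, q)\<in>T. (C ^ CARD('m) * R) * G (outer k q))"
    proof (rule sum_mono, clarify)
      fix k q assume "(k, q) \<in> T"
      from divide_right_mono[OF weight[OF this], of "(1 + norm (\<xi> - outer k q)) ^ K"]
      show "Psi_star \<Psi> q powr a' * (\<Prod>i\<in>UNIV. C / (1 + \<Psi> q / 2 * \<bar>real_of_int (k i)\<bar>) ^ (K + 2)) /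
         (1 + norm (\<xi> - outer k q)) ^ K \<le> (C ^ CARD('m) * R) * G (outer k q)"
        by (simp add: G_def)
    qed
    also have "\<dots> = (C ^ CARD('m) * R) * (\<Sum>p\<in>T. G ((\<lambda>(k, q). outer k q) p))"
      by (simp add: sum_distrib_left case_prod_unfold)
    finally have le: "(\<Sum>(k, q)\<in>T. Psi_star \<Psi> q powr a' *
        (\<Prod>i\<in>UNIV. C / (1 + \<Psi> q / 2 * \<bar>real_of_int (k i)\<bar>) ^ (K + 2)) / (1 + norm (\<xi> - outer k q)) ^ K)
       \<le> (C ^ CARD('m) * R) * (\<Sum>p\<in>T. G ((\<lambda>(k, q). outer k q) p))" .
    have "(\<Sum>p\<in>T. G ((\<lambda>(k, q). outer k q) p)) =
        (\<Sum>l\<in>(\<lambda>(k, q). outer k q) ` T. \<Sum>p\<in>{p \<in> T. (\<lambda>(k, q). outer k q) p = l}. G l)"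
      by (subst sum.image_gen[OF T, of _ "\<lambda>(k, q). outer k q"]) (auto intro!: sum.cong)
    also have "\<dots> \<le> (\<Sum>l\<in>(\<lambda>(k, q). outer k q) ` T. D0 * (2 powr a * (1 + norm \<xi>) powr (- a)) * (1 / (1 + norm (\<xi> - l)) ^ (2 * d)))"
      by (intro sum_mono fibre)
    also have "\<dots> = D0 * (2 powr a * (1 + norm \<xi>) powr (- a)) * (\<Sum>l\<in>(\<lambda>(k, q). outer k q) ` T. 1 / (1 + norm (\<xi> - l)) ^ (2 * d))"
      by (rule sum_distrib_left[symmetric])
    also have "\<dots> \<le> D0 * (2 powr a * (1 + norm \<xi>) powr (- a)) * B"
      using D0 T by (intro mult_left_mono B) (auto simp: outer_in_int_lattice)
    finally have "(\<Sum>p\<in>T. G ((\<lambda>(k, q). outer k q) p)) \<le> D0 * (2 powr a * (1 + norm \<xi>) powr (- a)) * B" .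
    then have "(C ^ CARD('m) * R) * (\<Sum>p\<in>T. G ((\<lambda>(k, q). outer k q) p)) \<le>
        (C ^ CARD('m) * R) * (D0 * (2 powr a * (1 + norm \<xi>) powr (- a)) * B)"
      using C R by (intro mult_left_mono) auto
    also have "\<dots> = (D - 1) * (1 + norm \<xi>) powr (- a)"
      by (simp add: D_def)
    also have "\<dots> \<le> D * (1 + norm \<xi>) powr (- a)" by (intro mult_right_mono) auto
    finally show ?thesis using le unfolding T_def by linarith
  qed
  moreover have "D > 0"
    using C R D0 B unfolding D_def by (intro add_nonneg_pos mult_nonneg_nonneg) auto
  ultimately show ?thesis by blast
qed

section \<open>The approximation step\<close>

definition ft :: "'a :: euclidean_space measure \<Rightarrow> ('a \<Rightarrow> real) \<Rightarrow> 'a \<Rightarrow> complex" where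
  "ft M f \<xi> = (\<integral>x. complex_of_real (f x) * ex (- (x \<bullet> \<xi>)) \<partial>M)"

lemma ft_integrable:
  fixes M :: "'a :: euclidean_space measure"
  assumes "prob_space M" "sets M = sets borel" "f \<in> borel_measurable borel" "\<And>x. \<bar>f x\<bar> \<le> B"
  shows "integrable M (\<lambda>x. complex_of_real (f x) * ex (- (x \<bullet> \<xi>)))"
proof -
  interpret prob_space M by fact
  note [measurable] = assms(3)
  note [measurable_cong] = assms(2)
  show ?thesis
  proof (rule integrable_const_bound[of _ B])
    show "(\<lambda>x. complex_of_real (f x) * ex (- (x \<bullet> \<xi>))) \<in> borel_measurable M" by measurable
  qed (simp add: norm_mult assms(4))
qed

text \<open>Multiplication by a trigonometric polynomial superposes shifted transforms.
  \<open>F\<close> is only a pointwise limit of such polynomials, and the uniform coefficient bound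
  \<open>H\<close> supplies dominated convergence. The bound serves twice: with all frequencies for
  decay of order \<open>K\<close>, and without frequency 0 for the size of the change.\<close>

lemma ft_mult_bound:
  fixes f F :: "'a :: euclidean_space \<Rightarrow> real" and \<alpha> :: "'p \<Rightarrow> complex"
  assumes M: "prob_space M" and sets_M: "sets M = sets borel"
    and f: "f \<in> borel_measurable borel" "\<And>x. \<bar>f x\<bar> \<le> B"
    and lim: "\<And>x. (\<lambda>n. \<Sum>p\<in>T n. \<alpha> p * ex (x \<bullet> \<kappa> p)) \<longlonglongrightarrow> complex_of_real (F x)"
    and H: "\<And>n :: nat. (\<Sum>p\<in>T n. cmod (\<alpha> p)) \<le> H"
    and R: "\<And>n. (\<Sum>p\<in>T n. cmod (\<alpha> p) * cmod (ft M f (\<xi> - \<kappa> p))) \<le> R"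
  shows "cmod (ft M (\<lambda>x. f x * F x) \<xi>) \<le> R"
proof -
  interpret prob_space M by fact
  note [measurable] = f(1)
  note [measurable_cong] = sets_M
  define G where "G n x = (\<Sum>p\<in>T n. \<alpha> p * ex (x \<bullet> \<kappa> p))" for n x
  have G_meas [measurable]: "G n \<in> borel_measurable borel" for n
    unfolding G_def by measurable
  have G_bound: "cmod (G n x) \<le> H" for n x
    unfolding G_def by (rule order_trans[OF norm_sum]) (simp add: norm_mult H)
  have F_meas [measurable]: "(\<lambda>x. complex_of_real (F x)) \<in> borel_measurable borel"
    by (rule borel_measurable_LIMSEQ_metric[OF G_meas]) (use lim in \<open>simp add: G_def\<close>)
  have H0: "H \<ge> 0" using G_bound[of 0 0] norm_ge_zero order_trans by blast
  have conv: "(\<lambda>n. \<integral>x. complex_of_real (f x) * G n x * ex (- (x \<bullet> \<xi>)) \<partial>M) \<longlonglongrightarrow>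
      (\<integral>x. complex_of_real (f x) * complex_of_real (F x) * ex (- (x \<bullet> \<xi>)) \<partial>M)"
  proof (rule integral_dominated_convergence[where w = "\<lambda>_. B * H"])
    show "AE x in M. (\<lambda>n. complex_of_real (f x) * G n x * ex (- (x \<bullet> \<xi>))) \<longlonglongrightarrow>
        complex_of_real (f x) * complex_of_real (F x) * ex (- (x \<bullet> \<xi>))"
      using lim by (intro AE_I2 tendsto_intros) (simp add: G_def)
    show "AE x in M. norm (complex_of_real (f x) * G n x * ex (- (x \<bullet> \<xi>))) \<le> B * H" for n
      using f(2) G_bound abs_ge_zero[of "f _"] by (intro AE_I2) (auto simp: norm_mult intro!: mult_mono H0 order_trans[OF abs_ge_zero f(2)])
  qed auto
  have bound: "cmod (\<integral>x. complex_of_real (f x) * G n x * ex (- (x \<bullet> \<xi>)) \<partial>M) \<le> R" for n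
  proof -
    have "(\<integral>x. complex_of_real (f x) * G n x * ex (- (x \<bullet> \<xi>)) \<partial>M) =
        (\<integral>x. (\<Sum>p\<in>T n. \<alpha> p * (complex_of_real (f x) * ex (- (x \<bullet> (\<xi> - \<kappa> p))))) \<partial>M)"
    proof (rule Bochner_Integration.integral_cong)
      fix x
      have "ex (- (x \<bullet> (\<xi> - \<kappa> p))) = ex (x \<bullet> \<kappa> p) * ex (- (x \<bullet> \<xi>))" for p
        by (simp add: ex_add[symmetric] inner_diff_right)
      then show "complex_of_real (f x) * G n x * ex (- (x \<bullet> \<xi>)) =
          (\<Sum>p\<in>T n. \<alpha> p * (complex_of_real (f x) * ex (- (x \<bullet> (\<xi> - \<kappa> p)))))"
        unfolding G_def sum_distrib_left sum_distrib_right by (intro sum.cong refl) simp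
    qed simp
    also have "\<dots> = (\<Sum>p\<in>T n. \<alpha> p * ft M f (\<xi> - \<kappa> p))"
      using ft_integrable[OF M sets_M f] by (simp add: ft_def)
    finally have "cmod (\<integral>x. complex_of_real (f x) * G n x * ex (- (x \<bullet> \<xi>)) \<partial>M) \<le>
        (\<Sum>p\<in>T n. cmod (\<alpha> p * ft M f (\<xi> - \<kappa> p)))"
      by (simp only: norm_sum)
    also have "\<dots> \<le> R" using R[of n] by (simp add: norm_mult)
    finally show ?thesis .
  qed
  have "cmod (\<integral>x. complex_of_real (f x) * complex_of_real (F x) * ex (- (x \<bullet> \<xi>)) \<partial>M) \<le> R"
    by (rule Lim_norm_ubound[OF sequentially_bot conv]) (simp add: bound)
  then show ?thesis by (simp add: ft_def)
qed

text \<open>The bounds are existential: they may grow from step to step, because each new set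
  \<open>A\<close> is chosen after them.\<close>

definition admissible :: "'a :: euclidean_space measure \<Rightarrow> nat \<Rightarrow> ('a \<Rightarrow> real) \<Rightarrow> bool" where
  "admissible M K f \<longleftrightarrow> f \<in> borel_measurable borel \<and> (\<forall>x. 0 \<le> f x) \<and> (\<exists>B. \<forall>x. f x \<le> B) \<and>
     (\<exists>C\<ge>0. \<forall>\<xi>. cmod (ft M f \<xi>) \<le> C / (1 + norm \<xi>) ^ K)"

text \<open>The weak inequality makes this a closed set for finite \<open>A\<close>; half the width
  leaves room for the strict inequality in \<open>well_approximable\<close>.\<close>

definition near_set :: "(int ^ 'n \<Rightarrow> real) \<Rightarrow> real ^ 'm \<Rightarrow> (int ^ 'n) set \<Rightarrow> (real ^ 'n ^ 'm) set" where
  "near_set \<Psi> \<theta> A = (\<Union>q\<in>A. {x. \<forall>i. infdist (x $ i \<bullet> real_vec q - \<theta> $ i) \<int> \<le> \<Psi> q / 2})"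

text \<open>Removing finitely many terms cannot make the finite sums of a divergent nonnegative
  family bounded. Discarding zero terms ensures \<open>\<Psi> q > 0\<close> for the chosen
  \<open>q\<close>, so every kernel has positive width.\<close>

lemma large_finite_sum_outside:
  fixes f :: "'b \<Rightarrow> real"
  assumes f: "\<And>x. f x \<ge> 0" and nsum: "\<not> f summable_on X" and E: "finite E"
  shows "\<exists>A. finite A \<and> A \<subseteq> X \<and> A \<inter> E = {} \<and> (\<forall>x\<in>A. f x > 0) \<and> sum f A > W"
proof (rule ccontr)
  assume *: "\<not> ?thesis"
  have "bdd_above (sum f ` {F. F \<subseteq> X \<and> finite F})"
  proof (rule bdd_aboveI2)
    fix F assume F: "F \<in> {F. F \<subseteq> X \<and> finite F}"
    have "sum f F = sum f (F \<inter> E) + sum f (F - E)"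
      using F by (intro sum.Int_Diff) auto
    also have "sum f (F \<inter> E) \<le> sum f E" using E f by (intro sum_mono2) auto
    also have "sum f (F - E) = sum f {x \<in> F - E. f x > 0}"
      using F f by (intro sum.mono_neutral_right) (auto simp: not_less intro: order_antisym)
    also have "\<dots> \<le> W"
    proof (rule ccontr)
      assume "\<not> sum f {x \<in> F - E. f x > 0} \<le> W"
      then show False using * F by (auto dest!: spec[of _ "{x \<in> F - E. f x > 0}"])
    qed
    finally show "sum f F \<le> sum f E + W" by simp
  qed
  then have "f summable_on X"
    using f by (intro nonneg_bdd_above_summable_on) auto
  then show False using nsum by simp
qed

text \<open>\<open>F\<close> is the weighted average of kernels. Its zeroth coefficient is 1, so
  \<open>F - 1\<close> has only nonzero frequencies, to which \<open>frequency_sum_bound\<close>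
  applies with the factor \<open>C / W\<close>, where \<open>C\<close> is the decay constant of
  \<open>f\<close>.\<close>

lemma approximation_step:
  fixes M :: "(real ^ 'n ^ 'm) measure" and \<Psi> :: "int ^ 'n \<Rightarrow> real" and \<theta> :: "real ^ 'm"
  assumes M: "prob_space M" and sets_M: "sets M = sets borel"
    and \<Psi>: "\<And>q. \<Psi> q \<ge> 0"
    and nsum: "\<not> (\<lambda>q. Psi_star \<Psi> q powr a') summable_on (Q - {0})"
    and a: "0 \<le> a" "a < a'" "a' \<le> real K" and K: "K = 3 * DIM(real ^ 'n ^ 'm)"
    and a_le: "a \<le> real (DIM(real ^ 'n ^ 'm))"
    and f: "admissible M K f" and X0: "finite X0" and \<eta>: "\<eta> > 0"
  shows "\<exists>A F. finite A \<and> A \<subseteq> Q \<and> A \<inter> X0 = {} \<and> (\<forall>q\<in>A. \<Psi> q > 0) \<and> (\<forall>x. F x \<noteq> 0 \<longrightarrow> x \<in> near_set \<Psi> \<theta> A) \<and>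
     admissible M K (\<lambda>x. f x * F x) \<and>
     (\<forall>\<xi>. cmod (ft M (\<lambda>x. f x * F x) \<xi> - ft M f \<xi>) \<le> \<eta> * (1 + norm \<xi>) powr (- a))"
proof -
  obtain C0 where C0: "C0 \<ge> 1" "\<forall>\<delta>>0. \<exists>\<phi> c. is_periodic_kernel (K + 2) C0 \<delta> \<phi> c"
    using periodic_kernel[of "K + 2"] by blast
  then obtain \<phi> c where \<phi>c: "\<And>\<delta>. \<delta> > 0 \<Longrightarrow> is_periodic_kernel (K + 2) C0 \<delta> (\<phi> \<delta>) (c \<delta>)"
    by metis
  obtain D where D: "D > 0" "\<And>A n (\<xi> :: real ^ 'n ^ 'm). finite A \<Longrightarrow> (\<forall>q\<in>A. q \<noteq> 0 \<and> \<Psi> q > 0) \<Longrightarrow>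
     (\<Sum>(k, q)\<in>(int_box n - {\<lambda>_. 0}) \<times> A. Psi_star \<Psi> q powr a' *
        (\<Prod>i\<in>UNIV. C0 / (1 + \<Psi> q / 2 * \<bar>real_of_int (k i)\<bar>) ^ (K + 2)) / (1 + norm (\<xi> - outer k q)) ^ K)
     \<le> D * (1 + norm \<xi>) powr (- a)"
    using frequency_sum_bound[OF a K a_le, of C0 \<Psi>] C0(1) by auto
  from f obtain B C where f_meas [measurable]: "f \<in> borel_measurable borel" and f0: "\<And>x. 0 \<le> f x"
    and B: "\<And>x. f x \<le> B" and C: "C \<ge> 0" "\<And>\<xi>. cmod (ft M f \<xi>) \<le> C / (1 + norm \<xi>) ^ K"
    unfolding admissible_def by blast
  have f_abs: "\<bar>f x\<bar> \<le> B" for x using f0[of x] B[of x] by simp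
  \<comment> \<open>The change will be bounded by \<open>C * D / W\<close> times the decay factor,
    hence the threshold \<open>C * D / \<eta>\<close>; the 1 keeps \<open>W\<close>
    positive.\<close>
  define W0 where "W0 = max 1 (C * D / \<eta>)"
  obtain A where A: "finite A" "A \<subseteq> Q - {0}" "A \<inter> X0 = {}" "\<forall>q\<in>A. Psi_star \<Psi> q powr a' > 0"
      "(\<Sum>q\<in>A. Psi_star \<Psi> q powr a') > W0"
    using large_finite_sum_outside[OF _ nsum X0, of W0] by auto
  define W where "W = (\<Sum>q\<in>A. Psi_star \<Psi> q powr a')"
  have W: "W > 0" "C * D / W \<le> \<eta>"
  proof -
    have W1: "W \<ge> 1" "W \<ge> C * D / \<eta>" using A(5) by (auto simp: W_def W0_def)
    then show "W > 0" by simp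
    from W1 \<eta> show "C * D / W \<le> \<eta>" by (simp add: field_simps)
  qed
  have \<Psi>_pos: "\<Psi> q > 0" if "q \<in> A" for q
    using A(4) that \<Psi>[of q] by (auto simp: Psi_star_def less_le)
  define w where "w q = Psi_star \<Psi> q powr a' / W" for q
  have w0: "w q \<ge> 0" for q using W by (simp add: w_def)
  have w1: "(\<Sum>q\<in>A. w q) = 1"
    using W by (simp add: w_def W_def sum_divide_distrib[symmetric])
  \<comment> \<open>The coefficient belonging to the pair \<open>(k, q)\<close>. The shift by
    \<open>\<theta>\<close> enters only as phases, so it is invisible to all norm bounds.\<close>
  define \<alpha> where "\<alpha> = (\<lambda>(k :: 'm \<Rightarrow> int, q).
     complex_of_real (w q) * (\<Prod>i\<in>UNIV. c (\<Psi> q / 2) (k i) * ex (- (of_int (k i) * \<theta> $ i))))"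
  define F where "F x = (\<Sum>q\<in>A. w q * (\<Prod>i\<in>UNIV. \<phi> (\<Psi> q / 2) (x $ i \<bullet> real_vec q - \<theta> $ i)))"
    for x :: "real ^ 'n ^ 'm"
  let ?P = "\<lambda>(k :: 'm \<Rightarrow> int) (q :: int ^ 'n). \<Prod>i\<in>UNIV. C0 / (1 + \<Psi> q / 2 * \<bar>real_of_int (k i)\<bar>) ^ (K + 2)"
  let ?out = "\<lambda>(k :: 'm \<Rightarrow> int, q :: int ^ 'n). outer k q"
  have ker: "is_periodic_kernel (K + 2) C0 (\<Psi> q / 2) (\<phi> (\<Psi> q / 2)) (c (\<Psi> q / 2))" if "q \<in> A" for q
    using \<phi>c \<Psi>_pos[OF that] by simp
  have \<alpha>_norm: "cmod (\<alpha> (k, q)) \<le> w q * ?P k q" if "q \<in> A" for k q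
  proof -
    have "cmod (\<alpha> (k, q)) = w q * (\<Prod>i\<in>UNIV. cmod (c (\<Psi> q / 2) (k i)))"
      using w0 by (simp add: \<alpha>_def norm_mult prod_norm[symmetric])
    also have "\<dots> \<le> w q * ?P k q"
      using ker[OF that] by (intro mult_left_mono w0 prod_mono) (auto simp: is_periodic_kernel_def)
    finally show ?thesis .
  qed
  have series: "(\<lambda>n. \<Sum>p\<in>int_box n \<times> A. \<alpha> p * ex (x \<bullet> ?out p)) \<longlonglongrightarrow> complex_of_real (F x)" for x
  proof -
    let ?y = "\<lambda>i q. x $ i \<bullet> real_vec q - \<theta> $ i"
    have "(\<lambda>n. \<Sum>q\<in>A. complex_of_real (w q) * (\<Prod>i\<in>UNIV. \<Sum>k\<in>{- int n..int n}. c (\<Psi> q / 2) k * ex (of_int k * ?y i q)))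
        \<longlonglongrightarrow> (\<Sum>q\<in>A. complex_of_real (w q) * (\<Prod>i\<in>UNIV. complex_of_real (\<phi> (\<Psi> q / 2) (?y i q))))"
      using ker by (intro tendsto_sum tendsto_mult tendsto_const tendsto_prod) (auto simp: is_periodic_kernel_def)
    moreover have "(\<Sum>q\<in>A. complex_of_real (w q) * (\<Prod>i\<in>UNIV. complex_of_real (\<phi> (\<Psi> q / 2) (?y i q)))) = complex_of_real (F x)"
      by (simp add: F_def)
    moreover have "(\<Sum>q\<in>A. complex_of_real (w q) * (\<Prod>i\<in>UNIV. \<Sum>k\<in>{- int n..int n}. c (\<Psi> q / 2) k * ex (of_int k * ?y i q)))
        = (\<Sum>p\<in>int_box n \<times> A. \<alpha> p * ex (x \<bullet> ?out p))" for n
    proof -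
      have eq: "(\<Prod>i\<in>UNIV. c (\<Psi> q / 2) (k i) * ex (of_int (k i) * ?y i q)) =
          (\<Prod>i\<in>UNIV. c (\<Psi> q / 2) (k i) * ex (- (of_int (k i) * \<theta> $ i))) * ex (x \<bullet> outer k q)" for k :: "'m \<Rightarrow> int" and q
      proof -
        have "ex (of_int (k i) * ?y i q) = ex (- (of_int (k i) * \<theta> $ i)) * ex (of_int (k i) * (x $ i \<bullet> real_vec q))" for i
          by (simp add: ex_add[symmetric] algebra_simps)
        then show ?thesis
          by (simp add: inner_outer ex_sum prod.distrib)
      qed
      have "(\<Sum>q\<in>A. complex_of_real (w q) * (\<Prod>i\<in>UNIV. \<Sum>k\<in>{- int n..int n}. c (\<Psi> q / 2) k * ex (of_int k * ?y i q)))
        = (\<Sum>q\<in>A. \<Sum>k\<in>int_box n. \<alpha> (k, q) * ex (x \<bullet> outer k q))"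
        unfolding prod_sum_int_box sum_distrib_left eq by (simp add: \<alpha>_def mult.assoc)
      also have "\<dots> = (\<Sum>k\<in>int_box n. \<Sum>q\<in>A. \<alpha> (k, q) * ex (x \<bullet> outer k q))"
        by (rule sum.swap)
      also have "\<dots> = (\<Sum>p\<in>int_box n \<times> A. \<alpha> p * ex (x \<bullet> ?out p))"
        by (simp add: sum.cartesian_product case_prod_unfold)
      finally show ?thesis .
    qed
    ultimately show ?thesis by simp
  qed
  have E_ex: "\<exists>E. \<forall>n. (\<Sum>k\<in>int_box n. ?P k q * (1 + norm (outer k q)) ^ K) \<le> E" if "q \<in> A" for q
    by (rule weighted_box_sum_bounded) (use \<Psi>_pos[OF that] C0(1) in auto)
  define E where "E q = (SOME E. \<forall>n. (\<Sum>k\<in>int_box n. ?P k q * (1 + norm (outer k q)) ^ K) \<le> E)" for q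
  have E: "(\<Sum>k\<in>int_box n. ?P k q * (1 + norm (outer k q)) ^ K) \<le> E q" if "q \<in> A" for q n
    using someI_ex[OF E_ex[OF that]] unfolding E_def by blast
  \<comment> \<open>\<open>H\<close> depends on \<open>A\<close> and may be huge: it secures
    boundedness, dominated convergence and decay of order \<open>K\<close>, but does not enter the
    bound on the change.\<close>
  define H where "H = (\<Sum>q\<in>A. w q * E q)"
  have HK: "(\<Sum>p\<in>int_box n \<times> A. cmod (\<alpha> p) * (1 + norm (?out p)) ^ K) \<le> H" for n
  proof -
    have "(\<Sum>p\<in>int_box n \<times> A. cmod (\<alpha> p) * (1 + norm (?out p)) ^ K) =
        (\<Sum>q\<in>A. \<Sum>k\<in>int_box n. cmod (\<alpha> (k, q)) * (1 + norm (outer k q)) ^ K)"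
      by (subst sum.swap) (simp add: sum.cartesian_product case_prod_unfold)
    also have "\<dots> \<le> (\<Sum>q\<in>A. \<Sum>k\<in>int_box n. w q * (?P k q * (1 + norm (outer k q)) ^ K))"
      unfolding mult.assoc[symmetric] by (intro sum_mono mult_right_mono \<alpha>_norm) auto
    also have "\<dots> \<le> H"
      unfolding H_def sum_distrib_left[symmetric] by (intro sum_mono mult_left_mono E w0)
    finally show ?thesis .
  qed
  have H1: "(\<Sum>p\<in>S. cmod (\<alpha> p)) \<le> H" if S: "S \<subseteq> int_box n \<times> A" for n and S
  proof -
    have "(\<Sum>p\<in>S. cmod (\<alpha> p)) \<le> (\<Sum>p\<in>int_box n \<times> A. cmod (\<alpha> p))"
      using S A by (intro sum_mono2) auto
    also have "\<dots> \<le> (\<Sum>p\<in>int_box n \<times> A. cmod (\<alpha> p) * (1 + norm (?out p)) ^ K)"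
    proof (rule sum_mono)
      fix p :: "('m \<Rightarrow> int) \<times> (int ^ 'n)"
      have "1 \<le> (1 + norm (?out p)) ^ K" by (rule one_le_power) simp
      then show "cmod (\<alpha> p) \<le> cmod (\<alpha> p) * (1 + norm (?out p)) ^ K"
        using mult_left_mono[of 1 "(1 + norm (?out p)) ^ K" "cmod (\<alpha> p)"] by simp
    qed
    also have "\<dots> \<le> H" by (rule HK)
    finally show ?thesis .
  qed
  have F0: "F x \<ge> 0" for x
    unfolding F_def using ker by (intro sum_nonneg mult_nonneg_nonneg w0 prod_nonneg) (auto simp: is_periodic_kernel_def)
  have F_le: "F x \<le> H" for x
  proof -
    have "cmod (complex_of_real (F x)) \<le> H"
    proof (rule Lim_norm_ubound[OF sequentially_bot series], rule always_eventually, rule allI)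
      fix n
      show "cmod (\<Sum>p\<in>int_box n \<times> A. \<alpha> p * ex (x \<bullet> ?out p)) \<le> H"
        by (rule order_trans[OF norm_sum]) (simp add: norm_mult H1[OF order_refl])
    qed
    then show ?thesis by simp
  qed
  have F_meas [measurable]: "F \<in> borel_measurable borel"
  proof -
    have "(\<lambda>x. \<phi> (\<Psi> q / 2) (x $ i \<bullet> real_vec q - \<theta> $ i)) \<in> borel_measurable borel" if "q \<in> A" for q i
    proof -
      have "(\<lambda>x :: real ^ 'n ^ 'm. x $ i \<bullet> real_vec q - \<theta> $ i) \<in> borel_measurable borel"
        by (intro borel_measurable_continuous_onI continuous_intros)
      moreover have "\<phi> (\<Psi> q / 2) \<in> borel_measurable borel"
        using ker[OF that] by (simp add: is_periodic_kernel_def)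
      ultimately show ?thesis by (rule measurable_compose)
    qed
    then show ?thesis unfolding F_def
      by (intro borel_measurable_sum borel_measurable_times borel_measurable_const borel_measurable_prod)
  qed
  have H0: "H \<ge> 0" using F0[of 0] F_le[of 0] by linarith
  have B0: "B \<ge> 0" using f0[of 0] B[of 0] by linarith
  have "admissible M K (\<lambda>x. f x * F x)"
    unfolding admissible_def
  proof (intro conjI allI exI)
    show "(\<lambda>x. f x * F x) \<in> borel_measurable borel" by measurable
    show "0 \<le> f x * F x" for x using f0 F0 by simp
    show "f x * F x \<le> B * H" for x using f0 F0 B F_le B0 by (intro mult_mono) auto
    show "C * H \<ge> 0" using C H0 by simp
    fix \<xi>
    show "cmod (ft M (\<lambda>x. f x * F x) \<xi>) \<le> C * H / (1 + norm \<xi>) ^ K"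
    proof (rule ft_mult_bound[OF M sets_M f_meas f_abs series, where H = H])
      fix n
      show "(\<Sum>p\<in>int_box n \<times> A. cmod (\<alpha> p)) \<le> H" by (rule H1[OF order_refl])
      have "(\<Sum>p\<in>int_box n \<times> A. cmod (\<alpha> p) * cmod (ft M f (\<xi> - ?out p))) \<le>
          (\<Sum>p\<in>int_box n \<times> A. C / (1 + norm \<xi>) ^ K * (cmod (\<alpha> p) * (1 + norm (?out p)) ^ K))"
      proof (rule sum_mono)
        fix p :: "('m \<Rightarrow> int) \<times> (int ^ 'n)"
        have pos: "1 + norm \<xi> > 0" "1 + norm (\<xi> - ?out p) > 0" "1 + norm (?out p) > 0"
          by (simp_all add: add_pos_nonneg)
        have "(1 + norm \<xi>) ^ K \<le> ((1 + norm (\<xi> - ?out p)) * (1 + norm (?out p))) ^ K"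
          by (intro power_mono one_plus_norm_peetre) (simp add: add_nonneg_nonneg)
        then have "1 / (1 + norm (\<xi> - ?out p)) ^ K \<le> (1 + norm (?out p)) ^ K / (1 + norm \<xi>) ^ K"
          using pos unfolding power_mult_distrib by (simp add: divide_simps mult.commute)
        then have "C * (1 / (1 + norm (\<xi> - ?out p)) ^ K) \<le> C * ((1 + norm (?out p)) ^ K / (1 + norm \<xi>) ^ K)"
          using C by (intro mult_left_mono)
        then have "cmod (ft M f (\<xi> - ?out p)) \<le> C / (1 + norm \<xi>) ^ K * (1 + norm (?out p)) ^ K"
          using C(2)[of "\<xi> - ?out p"] by simp
        then show "cmod (\<alpha> p) * cmod (ft M f (\<xi> - ?out p)) \<le> C / (1 + norm \<xi>) ^ K * (cmod (\<alpha> p) * (1 + norm (?out p)) ^ K)"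
          using mult_left_mono[of _ _ "cmod (\<alpha> p)"] by (metis mult.left_commute norm_ge_zero)
      qed
      also have "\<dots> \<le> C / (1 + norm \<xi>) ^ K * H"
        unfolding sum_distrib_left[symmetric] using C by (intro mult_left_mono HK) auto
      finally show "(\<Sum>p\<in>int_box n \<times> A. cmod (\<alpha> p) * cmod (ft M f (\<xi> - ?out p))) \<le> C * H / (1 + norm \<xi>) ^ K"
        by simp
    qed
  qed
  moreover have "cmod (ft M (\<lambda>x. f x * F x) \<xi> - ft M f \<xi>) \<le> \<eta> * (1 + norm \<xi>) powr (- a)" for \<xi>
  proof -
    let ?T = "\<lambda>n. (int_box n - {\<lambda>_ :: 'm. 0}) \<times> A"
    \<comment> \<open>The terms with \<open>k = 0\<close> have frequency 0 and coefficients
      \<open>w q\<close>, which sum to 1; dropping them subtracts exactly the constant 1.\<close>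
    have series1: "(\<lambda>n. \<Sum>p\<in>?T n. \<alpha> p * ex (x \<bullet> ?out p)) \<longlonglongrightarrow> complex_of_real (F x - 1)" for x
    proof -
      have "(\<Sum>p\<in>?T n. \<alpha> p * ex (x \<bullet> ?out p)) = (\<Sum>p\<in>int_box n \<times> A. \<alpha> p * ex (x \<bullet> ?out p)) - 1" for n
      proof -
        have "int_box n \<times> A = ?T n \<union> {\<lambda>_. 0} \<times> A" using zero_in_int_box by auto
        then have "(\<Sum>p\<in>int_box n \<times> A. \<alpha> p * ex (x \<bullet> ?out p)) =
            (\<Sum>p\<in>?T n. \<alpha> p * ex (x \<bullet> ?out p)) + (\<Sum>p\<in>{\<lambda>_. 0} \<times> A. \<alpha> p * ex (x \<bullet> ?out p))"
          using A(1) by (simp only:) (intro sum.union_disjoint, auto)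
        also have "(\<Sum>p\<in>{\<lambda>_. 0} \<times> A. \<alpha> p * ex (x \<bullet> ?out p)) =
            (\<Sum>q\<in>A. \<alpha> (\<lambda>_. 0, q) * ex (x \<bullet> outer (\<lambda>_. 0) q))"
          using sum.cartesian_product[of "\<lambda>k q. \<alpha> (k, q) * ex (x \<bullet> outer k q)" A "{\<lambda>_. 0}"]
          by (simp add: case_prod_unfold)
        also have "\<dots> = (\<Sum>q\<in>A. complex_of_real (w q))"
        proof (rule sum.cong[OF refl])
          fix q assume "q \<in> A"
          moreover have "outer (\<lambda>_. 0) q = (0 :: real ^ 'n ^ 'm)" by (simp add: vec_eq_iff)
          ultimately show "\<alpha> (\<lambda>_. 0, q) * ex (x \<bullet> outer (\<lambda>_. 0) q) = complex_of_real (w q)"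
            using ker[of q] by (simp add: \<alpha>_def is_periodic_kernel_def)
        qed
        also have "\<dots> = 1" using w1 by (simp flip: of_real_sum)
        finally show ?thesis by simp
      qed
      moreover have "(\<lambda>n. (\<Sum>p\<in>int_box n \<times> A. \<alpha> p * ex (x \<bullet> ?out p)) - 1) \<longlonglongrightarrow> complex_of_real (F x) - 1"
        by (intro tendsto_intros series)
      ultimately show ?thesis by simp
    qed
    have "cmod (ft M (\<lambda>x. f x * (F x - 1)) \<xi>) \<le> \<eta> * (1 + norm \<xi>) powr (- a)"
    proof (rule ft_mult_bound[OF M sets_M f_meas f_abs series1, where H = H])
      fix n
      show "(\<Sum>p\<in>?T n. cmod (\<alpha> p)) \<le> H" by (rule H1[of _ n]) auto
      have "(\<Sum>p\<in>?T n. cmod (\<alpha> p) * cmod (ft M f (\<xi> - ?out p))) \<le>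
          (\<Sum>(k, q)\<in>?T n. C / W * (Psi_star \<Psi> q powr a' * ?P k q / (1 + norm (\<xi> - outer k q)) ^ K))"
      proof (rule sum_mono)
        fix p assume "p \<in> ?T n"
        then obtain k q where p: "p = (k, q)" and "q \<in> A" by auto
        have "cmod (\<alpha> (k, q)) * cmod (ft M f (\<xi> - outer k q)) \<le> (w q * ?P k q) * (C / (1 + norm (\<xi> - outer k q)) ^ K)"
          using C0(1) \<Psi>_pos[OF \<open>q \<in> A\<close>] by (intro mult_mono \<alpha>_norm \<open>q \<in> A\<close> C mult_nonneg_nonneg w0 prod_nonneg) auto
        also have "\<dots> = C / W * (Psi_star \<Psi> q powr a' * ?P k q / (1 + norm (\<xi> - outer k q)) ^ K)"
          by (simp add: w_def)
        finally show "cmod (\<alpha> p) * cmod (ft M f (\<xi> - ?out p)) \<le>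
           (case p of (k, q) \<Rightarrow> C / W * (Psi_star \<Psi> q powr a' * ?P k q / (1 + norm (\<xi> - outer k q)) ^ K))"
          by (simp only: p case_prod_conv)
      qed
      also have "\<dots> = C / W * (\<Sum>(k, q)\<in>?T n. Psi_star \<Psi> q powr a' * ?P k q / (1 + norm (\<xi> - outer k q)) ^ K)"
        by (simp only: sum_distrib_left case_prod_unfold)
      also have "\<dots> \<le> C / W * (D * (1 + norm \<xi>) powr (- a))"
        using C W A \<Psi>_pos by (intro mult_left_mono D) auto
      also have "\<dots> = C * D / W * (1 + norm \<xi>) powr (- a)" by simp
      also have "\<dots> \<le> \<eta> * (1 + norm \<xi>) powr (- a)"
        by (intro mult_right_mono W) auto
      finally show "(\<Sum>p\<in>?T n. cmod (\<alpha> p) * cmod (ft M f (\<xi> - ?out p))) \<le> \<eta> * (1 + norm \<xi>) powr (- a)" .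
    qed
    moreover have "ft M (\<lambda>x. f x * (F x - 1)) \<xi> = ft M (\<lambda>x. f x * F x) \<xi> - ft M f \<xi>"
    proof -
      have "\<bar>f x * F x\<bar> \<le> B * H" for x
        using f0 F0 B F_le B0 by (simp add: abs_mult mult_mono)
      then have "integrable M (\<lambda>x. complex_of_real (f x * F x) * ex (- (x \<bullet> \<xi>)))"
        by (intro ft_integrable[OF M sets_M]) measurable
      then show ?thesis
        using ft_integrable[OF M sets_M f_meas f_abs, of \<xi>] unfolding ft_def
        by (subst Bochner_Integration.integral_diff[symmetric]) (simp_all add: algebra_simps)
    qed
    ultimately show ?thesis by simp
  qed
  moreover have "x \<in> near_set \<Psi> \<theta> A" if "F x \<noteq> 0" for x
  proof -
    from that obtain q where q: "q \<in> A" "w q * (\<Prod>i\<in>UNIV. \<phi> (\<Psi> q / 2) (x $ i \<bullet> real_vec q - \<theta> $ i)) \<noteq> 0"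
      unfolding F_def by (meson sum.neutral)
    then have "\<forall>i. infdist (x $ i \<bullet> real_vec q - \<theta> $ i) \<int> \<le> \<Psi> q / 2"
      using ker[OF q(1)] by (auto simp: is_periodic_kernel_def)
    then show ?thesis using q(1) by (auto simp: near_set_def)
  qed
  ultimately show ?thesis
    using A \<Psi>_pos by (intro exI[of _ A] exI[of _ F]) auto
qed

section \<open>The limit measure\<close>

lemma closed_near_set: "finite A \<Longrightarrow> closed (near_set \<Psi> \<theta> A)"
  unfolding near_set_def
  by (intro closed_UN ballI closed_Collect_all closed_Collect_le continuous_intros)

lemma infnorm_le_cart:
  fixes v :: "real ^ 'm"
  assumes "\<And>i. \<bar>v $ i\<bar> \<le> c"
  shows "infnorm v \<le> c"
proof -
  have "\<bar>v \<bullet> b\<bar> \<le> c" if "b \<in> Basis" for b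
    using that assms by (auto simp: Basis_vec_def inner_axis)
  then show ?thesis
    unfolding infnorm_Max by (subst Max_le_iff) auto
qed

text \<open>Disjointness of the sets \<open>A n\<close> makes the chosen pairs distinct, hence
  infinite in number; \<open>\<Psi> q > 0\<close> turns the closed bound \<open>\<Psi> q / 2\<close>
  into a strict one.\<close>

lemma near_set_imp_well_approximable:
  fixes \<theta> :: "real ^ 'm"
  assumes A: "\<And>n :: nat. A n \<subseteq> Q" "\<And>n q. q \<in> A n \<Longrightarrow> \<Psi> q > 0" "disjoint_family A"
    and x: "\<And>n. x \<in> near_set \<Psi> \<theta> (A n)"
  shows "x \<in> well_approximable Q \<Psi> \<theta>"
proof -
  let ?S = "{(r :: int ^ 'm, q). q \<in> Q \<and> infnorm (x *v real_vec q - real_vec r - \<theta>) < \<Psi> q}"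
  have "\<exists>p. p \<in> ?S \<and> snd p \<in> A n" for n
  proof -
    from x[of n] obtain q where q: "q \<in> A n" "\<And>i. infdist (x $ i \<bullet> real_vec q - \<theta> $ i) \<int> \<le> \<Psi> q / 2"
      by (auto simp: near_set_def)
    have "\<exists>k :: int. \<bar>x $ i \<bullet> real_vec q - \<theta> $ i - of_int k\<bar> \<le> \<Psi> q / 2" for i
    proof -
      obtain z :: real where z: "z \<in> \<int>" "infdist (x $ i \<bullet> real_vec q - \<theta> $ i) \<int> = dist (x $ i \<bullet> real_vec q - \<theta> $ i) z"
        using infdist_attains_inf[OF closed_Ints, of "x $ i \<bullet> real_vec q - \<theta> $ i"] by (metis Ints_0 empty_iff)
      from z(1) obtain k where "z = of_int k" by (auto elim: Ints_cases)
      then show ?thesis using q(2)[of i] z(2) by (auto simp: dist_real_def)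
    qed
    then obtain r where r: "\<And>i. \<bar>x $ i \<bullet> real_vec q - \<theta> $ i - of_int (r i)\<bar> \<le> \<Psi> q / 2"
      by metis
    have "infnorm (x *v real_vec q - real_vec (\<chi> i. r i) - \<theta>) \<le> \<Psi> q / 2"
    proof (rule infnorm_le_cart)
      fix i
      have eq: "(x *v real_vec q - real_vec (\<chi> i. r i) - \<theta>) $ i = x $ i \<bullet> real_vec q - \<theta> $ i - of_int (r i)"
        by (simp add: matrix_vector_mul_component real_vec_def)
      show "\<bar>(x *v real_vec q - real_vec (\<chi> i. r i) - \<theta>) $ i\<bar> \<le> \<Psi> q / 2"
        unfolding eq by (rule r)
    qed
    also have "\<dots> < \<Psi> q" using A(2)[OF q(1)] by simp
    finally have "(\<chi> i. r i, q) \<in> ?S" using q(1) A(1)[of n] by auto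
    moreover have "snd (\<chi> i. r i, q) \<in> A n" using q(1) by simp
    ultimately show ?thesis by (intro exI conjI)
  qed
  then have "\<forall>n. \<exists>p. p \<in> ?S \<and> snd p \<in> A n" ..
  then obtain p where "\<forall>n. p n \<in> ?S \<and> snd (p n) \<in> A n" by (rule choice[THEN exE])
  then have p: "p n \<in> ?S" "snd (p n) \<in> A n" for n by simp_all
  have "inj p"
  proof (rule injI, rule ccontr)
    fix n n' assume "p n = p n'" "n \<noteq> n'"
    then have "A n \<inter> A n' = {}" using A(3) by (simp add: disjoint_family_on_def)
    moreover have "snd (p n) \<in> A n \<inter> A n'" using p(2)[of n] p(2)[of n'] \<open>p n = p n'\<close> by simp
    ultimately show False by simp
  qed
  then have "infinite (range p)" by (rule range_inj_infinite)
  moreover have "range p \<subseteq> ?S" by (rule image_subsetI) (rule p(1))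
  ultimately have "infinite ?S" by (rule infinite_super[rotated])
  then show ?thesis unfolding well_approximable_def by simp
qed

lemma exp_eq_ex: "exp (- 2 * pi * \<i> * complex_of_real u) = ex (- u)"
  unfolding ex_def cis_conv_exp by (rule arg_cong[of _ _ exp]) simp

lemma well_approximable_measure:
  fixes Q :: "(int ^ 'n) set" and \<Psi> :: "int ^ 'n \<Rightarrow> real" and \<theta> :: "real ^ 'm"
  assumes \<Psi>: "\<And>q. \<Psi> q \<ge> 0"
    and nsum: "\<not> (\<lambda>q. Psi_star \<Psi> q powr a') summable_on (Q - {0})"
    and a: "0 \<le> a" "a < a'" "a' \<le> real (3 * DIM(real ^ 'n ^ 'm))"
    and a_le: "a \<le> real (DIM(real ^ 'n ^ 'm))"
  shows "\<exists>\<mu>\<in>borel_prob_measures_on (well_approximable Q \<Psi> \<theta>).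
           \<exists>C>0. \<forall>\<xi>. cmod (fourier_transform \<mu> \<xi>) \<le> C * (1 + norm \<xi>) powr (- a)"
proof -
  define K where "K = 3 * DIM(real ^ 'n ^ 'm)"
  obtain M :: "(real ^ 'n ^ 'm) measure" and C0 where M: "prob_space M" and sets_M: "sets M = sets borel"
    and C0: "C0 \<ge> 0" and cube: "AE x in M. \<forall>b\<in>Basis. x \<bullet> b \<in> {0..<1}"
    and M_decay: "\<And>\<xi>. cmod (\<integral>x. ex (- (x \<bullet> \<xi>)) \<partial>M) \<le> C0 / (1 + norm \<xi>) ^ K"
    using smooth_cube_measure[of K, where ?'a = "real ^ 'n ^ 'm"] by blast
  interpret prob_space M by fact
  note [measurable_cong] = sets_M
  define g where "g \<xi> = (1 + norm \<xi>) powr (- a)" for \<xi> :: "real ^ 'n ^ 'm"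
  \<comment> \<open>A state is a density together with all \<open>q\<close> used so far, which the
    next step has to avoid. The start is written into the invariant, since dependent choice only
    supplies some state satisfying it.\<close>
  define P where "P n s \<longleftrightarrow> admissible M K (fst s) \<and> finite (snd s) \<and> (n = 0 \<longrightarrow> s = (\<lambda>_. 1, {}))"
    for n :: nat and s :: "(real ^ 'n ^ 'm \<Rightarrow> real) \<times> (int ^ 'n) set"
  \<comment> \<open>The errors \<open>1/4 * (1/2) ^ n\<close> add up to 1/2. As
    \<open>g 0 = 1\<close> and frequency 0 reads off the mass, which starts at 1, the mass never
    falls below 1/2.\<close>
  define R where "R n s s' \<longleftrightarrow> snd s \<subseteq> snd s' \<and> snd s' - snd s \<subseteq> Q \<and> (\<forall>q\<in>snd s' - snd s. \<Psi> q > 0) \<and>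
      (\<forall>x. fst s' x \<noteq> 0 \<longrightarrow> fst s x \<noteq> 0 \<and> x \<in> near_set \<Psi> \<theta> (snd s' - snd s)) \<and>
      (\<forall>\<xi>. cmod (ft M (fst s') \<xi> - ft M (fst s) \<xi>) \<le> 1/4 * (1/2) ^ n * g \<xi>)"
    for n :: nat and s s' :: "(real ^ 'n ^ 'm \<Rightarrow> real) \<times> (int ^ 'n) set"
  have "\<exists>s. \<forall>n. P n (s n) \<and> R n (s n) (s (Suc n))"
  proof (rule dependent_nat_choice)
    have "admissible M K (\<lambda>_. 1)"
      unfolding admissible_def using C0 M_decay by (auto simp: ft_def)
    then show "\<exists>s. P 0 s" by (auto simp: P_def)
  next
    fix s n assume "P n s"
    then have s: "admissible M K (fst s)" "finite (snd s)" by (auto simp: P_def)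
    have pos: "1/4 * (1/2) ^ n > (0 :: real)" by simp
    obtain A F where AF: "finite A" "A \<subseteq> Q" "A \<inter> snd s = {}" "\<forall>q\<in>A. \<Psi> q > 0"
      "\<forall>x. F x \<noteq> 0 \<longrightarrow> x \<in> near_set \<Psi> \<theta> A" "admissible M K (\<lambda>x. fst s x * F x)"
      "\<forall>\<xi>. cmod (ft M (\<lambda>x. fst s x * F x) \<xi> - ft M (fst s) \<xi>) \<le> 1/4 * (1/2) ^ n * g \<xi>"
      using approximation_step[OF M sets_M \<Psi> nsum a(1,2) a(3)[folded K_def] K_def a_le s pos, of \<theta>]
      unfolding g_def by blast
    have "snd s \<union> A - snd s = A" using AF(3) by auto
    then have "R n s (\<lambda>x. fst s x * F x, snd s \<union> A)"
      using AF by (simp add: R_def)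
    moreover have "P (Suc n) (\<lambda>x. fst s x * F x, snd s \<union> A)"
      using AF s by (simp add: P_def)
    ultimately show "\<exists>s'. P (Suc n) s' \<and> R n s s'" by blast
  qed
  then obtain s where s: "\<And>n. P n (s n)" "\<And>n. R n (s n) (s (Suc n))" by blast
  define f where "f n = fst (s n)" for n
  define X where "X n = snd (s n)" for n
  define A where "A n = X (Suc n) - X n" for n
  have f_adm: "admissible M K (f n)" and X_fin: "finite (X n)" for n
    using s(1)[of n] by (auto simp: P_def f_def X_def)
  have f_0: "f 0 = (\<lambda>_. 1)" using s(1)[of 0] by (simp add: P_def f_def)
  have X_Suc: "X n \<subseteq> X (Suc n)" and A_Q: "A n \<subseteq> Q" and A_pos: "\<And>q. q \<in> A n \<Longrightarrow> \<Psi> q > 0"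
    and f_Suc: "\<And>x. f (Suc n) x \<noteq> 0 \<Longrightarrow> f n x \<noteq> 0 \<and> x \<in> near_set \<Psi> \<theta> (A n)"
    and ft_Suc: "\<And>\<xi>. cmod (ft M (f (Suc n)) \<xi> - ft M (f n) \<xi>) \<le> 1/4 * (1/2) ^ n * g \<xi>" for n
    using s(2)[of n] unfolding R_def f_def X_def A_def by auto
  have X_mono: "X n \<subseteq> X n'" if "n \<le> n'" for n n'
    using that X_Suc by (rule lift_Suc_mono_le[of X, rotated])
  have A_disj: "disjoint_family A"
  proof -
    have "A n \<inter> A n' = {}" if "n < n'" for n n'
      using X_mono[of "Suc n" n'] that by (auto simp: A_def)
    then show ?thesis
      unfolding disjoint_family_on_def by (metis Int_commute linorder_neqE_nat)
  qed
  have f_near: "x \<in> near_set \<Psi> \<theta> (A n)" if "n < k" "f k x \<noteq> 0" for n k x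
    using that
  proof (induction k)
    case (Suc k)
    then show ?case using f_Suc[of k x] by (cases "n = k") auto
  qed simp
  have ft_diff: "cmod (ft M (f n) \<xi> - ft M (f 0) \<xi>) \<le> (1/2 - (1/2) ^ Suc n) * g \<xi>" for n \<xi>
  proof (induction n)
    case (Suc n)
    have "cmod (ft M (f (Suc n)) \<xi> - ft M (f 0) \<xi>) \<le>
        cmod (ft M (f (Suc n)) \<xi> - ft M (f n) \<xi>) + cmod (ft M (f n) \<xi> - ft M (f 0) \<xi>)"
      by (rule norm_diff_triangle_le[OF order_refl order_refl])
    also have "\<dots> \<le> 1/4 * (1/2) ^ n * g \<xi> + (1/2 - (1/2) ^ Suc n) * g \<xi>"
      by (intro add_mono ft_Suc Suc.IH)
    also have "\<dots> = (1/2 - (1/2) ^ Suc (Suc n)) * g \<xi>" by (simp add: algebra_simps)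
    finally show ?case .
  qed simp
  have g0: "g \<xi> \<ge> 0" for \<xi> by (simp add: g_def)
  have ft_half: "cmod (ft M (f n) \<xi> - ft M (f 0) \<xi>) \<le> 1/2 * g \<xi>" for n \<xi>
    by (rule order_trans[OF ft_diff]) (intro mult_right_mono g0, simp)
  have f_meas [measurable]: "f n \<in> borel_measurable borel" and f_nonneg: "\<And>x. 0 \<le> f n x" for n
    using f_adm[of n] by (auto simp: admissible_def)
  have f_int: "integrable M (f n)" for n
  proof -
    obtain B where B: "\<And>x. f n x \<le> B" using f_adm[of n] by (auto simp: admissible_def)
    show ?thesis
      by (rule integrable_const_bound[of _ B]) (auto simp: f_nonneg B)
  qed
  define Z where "Z n = (\<integral>x. f n x \<partial>M)" for n
  have Z: "Z n \<ge> 1/2" for n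
  proof -
    have ft_0: "ft M (f n) 0 = complex_of_real (Z n)" for n
      by (simp add: ft_def Z_def)
    have "cmod (ft M (f n) 0 - ft M (f 0) 0) \<le> 1/2" using ft_half[of n 0] by (simp add: g_def)
    then have "cmod (complex_of_real (Z n - 1)) \<le> 1/2"
      unfolding ft_0 by (simp add: Z_def f_0 prob_space)
    then show ?thesis unfolding norm_of_real by linarith
  qed
  have Z_pos: "Z n > 0" for n using Z[of n] by linarith
  obtain \<mu> r where \<mu>: "prob_space \<mu>" "sets \<mu> = sets borel" and r: "strict_mono (r :: nat \<Rightarrow> nat)"
    and conv: "\<And>(h :: real ^ 'n ^ 'm \<Rightarrow> complex) B. continuous_on UNIV h \<Longrightarrow> (\<And>x. cmod (h x) \<le> B) \<Longrightarrow>
        (\<lambda>n. \<integral>x. (f (r n) x / Z (r n)) *\<^sub>R h x \<partial>M) \<longlonglongrightarrow> (\<integral>x. h x \<partial>\<mu>)"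
  proof -
    have "\<exists>\<mu> r. prob_space \<mu> \<and> sets \<mu> = sets borel \<and> strict_mono (r :: nat \<Rightarrow> nat) \<and>
     (\<forall>(h :: real ^ 'n ^ 'm \<Rightarrow> complex) B. continuous_on UNIV h \<longrightarrow> (\<forall>x. cmod (h x) \<le> B) \<longrightarrow>
        (\<lambda>n. \<integral>x. (f (r n) x / Z (r n)) *\<^sub>R h x \<partial>M) \<longlonglongrightarrow> (\<integral>x. h x \<partial>\<mu>))"
      using f_int f_nonneg Z_pos
      by (intro cube_densities_weak_limit[OF M sets_M cube, of "\<lambda>n x. f n x / Z n"])
         (auto simp: less_imp_le Z_def[symmetric] less_imp_neq[OF Z_pos, symmetric])
    then show ?thesis using that by blast
  qed
  interpret \<mu>: prob_space \<mu> by fact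
  note [measurable_cong] = \<mu>(2)
  have "measure_support \<mu> \<subseteq> well_approximable Q \<Psi> \<theta>"
  proof
    fix x assume x: "x \<in> measure_support \<mu>"
    \<comment> \<open>Every density after step \<open>n\<close> vanishes off this closed set, so a
      tent function on a ball in its complement has integral 0 in the limit, and the ball carries no
      mass.\<close>
    have "x \<in> near_set \<Psi> \<theta> (A n)" for n
    proof (rule ccontr)
      assume "x \<notin> near_set \<Psi> \<theta> (A n)"
      moreover have "open (- near_set \<Psi> \<theta> (A n))"
        using X_fin by (intro open_Compl closed_near_set) (simp add: A_def)
      ultimately obtain e where e: "e > 0" "ball x e \<subseteq> - near_set \<Psi> \<theta> (A n)"
        using open_contains_ball by blast
      define t where "t y = max 0 (1 - dist x y / e)" for y
      have t: "0 \<le> t y" "t y \<le> 1" "t y > 0 \<longleftrightarrow> y \<in> ball x e" for y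
        using e(1) by (auto simp: t_def less_max_iff_disj field_simps)
      have t_cont: "continuous_on UNIV t"
        unfolding t_def using e(1) by (intro continuous_intros) auto
      have [measurable]: "t \<in> borel_measurable borel"
        using t_cont by (rule borel_measurable_continuous_onI)
      have ft0: "f k y * t y = 0" if "n < k" for k y
        using f_near[OF that, of y] t[of y] e(2) by (metis Compl_iff less_le mult_eq_0_iff subsetD)
      then have "(\<integral>y. (f (r k) y / Z (r k)) *\<^sub>R complex_of_real (t y) \<partial>M) = 0" if "n < k" for k
      proof -
        have "n < r k" using that seq_suble[OF r, of k] by simp
        then have zero: "(f (r k) y / Z (r k)) *\<^sub>R complex_of_real (t y) = 0" for y
          using ft0[of "r k" y] by auto
        show ?thesis unfolding zero by simp
      qed
      then have "(\<lambda>k. \<integral>y. (f (r k) y / Z (r k)) *\<^sub>R complex_of_real (t y) \<partial>M) \<longlonglongrightarrow> 0"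
        by (intro tendsto_eventually eventually_sequentiallyI[of "Suc n"]) auto
      moreover have "(\<lambda>k. \<integral>y. (f (r k) y / Z (r k)) *\<^sub>R complex_of_real (t y) \<partial>M) \<longlonglongrightarrow> (\<integral>y. complex_of_real (t y) \<partial>\<mu>)"
        using t t_cont by (intro conv[of _ 1] continuous_intros) auto
      ultimately have "(\<integral>y. complex_of_real (t y) \<partial>\<mu>) = 0"
        using LIMSEQ_unique by blast
      then have "(\<integral>y. t y \<partial>\<mu>) = 0" by simp
      moreover have "integrable \<mu> t"
        by (rule \<mu>.integrable_const_bound[of _ 1]) (use t in auto)
      ultimately have "AE y in \<mu>. t y = 0"
        using integral_nonneg_eq_0_iff_AE[of \<mu> t] t by auto
      then have "AE y in \<mu>. y \<notin> ball x e"
        by eventually_elim (metis t(3) less_irrefl)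
      then have "emeasure \<mu> (ball x e) = 0"
        by (subst (asm) AE_iff_measurable[OF _ refl]) (auto simp: ball_def \<mu>(2) sets_eq_imp_space_eq[OF \<mu>(2)])
      moreover have "emeasure \<mu> (ball x e) > 0"
        using x e(1) unfolding measure_support_def by (auto simp del: mem_ball)
      ultimately show False by simp
    qed
    then show "x \<in> well_approximable Q \<Psi> \<theta>"
      by (intro near_set_imp_well_approximable[OF A_Q A_pos A_disj])
  qed
  then have "\<mu> \<in> borel_prob_measures_on (well_approximable Q \<Psi> \<theta>)"
    using \<mu> by (simp add: borel_prob_measures_on_def)
  \<comment> \<open>\<open>C0\<close> comes from the base measure, 1/2 from all changes together,
    and the factor 2 from dividing by a mass of at least 1/2.\<close>
  moreover have "cmod (fourier_transform \<mu> \<xi>) \<le> 2 * (C0 + 1/2) * g \<xi>" for \<xi>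
  proof -
    have eq: "fourier_transform \<mu> \<xi> = (\<integral>x. ex (- (x \<bullet> \<xi>)) \<partial>\<mu>)"
      unfolding fourier_transform_def exp_eq_ex ..
    have lim: "(\<lambda>n. \<integral>x. (f (r n) x / Z (r n)) *\<^sub>R ex (- (x \<bullet> \<xi>)) \<partial>M) \<longlonglongrightarrow> (\<integral>x. ex (- (x \<bullet> \<xi>)) \<partial>\<mu>)"
      by (intro conv[of _ 1] continuous_intros) auto
    have bound: "cmod (\<integral>x. (f n x / Z n) *\<^sub>R ex (- (x \<bullet> \<xi>)) \<partial>M) \<le> 2 * (C0 + 1/2) * g \<xi>" for n
    proof -
      have "(\<integral>x. (f n x / Z n) *\<^sub>R ex (- (x \<bullet> \<xi>)) \<partial>M) = ft M (f n) \<xi> / Z n"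
        unfolding ft_def by (subst integral_divide_zero[symmetric]) (simp add: scaleR_conv_of_real)
      then have "cmod (\<integral>x. (f n x / Z n) *\<^sub>R ex (- (x \<bullet> \<xi>)) \<partial>M) = cmod (ft M (f n) \<xi>) / Z n"
        using Z_pos[of n] by (simp add: norm_divide)
      also have "\<dots> \<le> cmod (ft M (f n) \<xi>) / (1/2)"
        using Z[of n] by (intro divide_left_mono) auto
      also have "cmod (ft M (f n) \<xi>) \<le> (C0 + 1/2) * g \<xi>"
      proof -
        have "cmod (ft M (f 0) \<xi>) \<le> C0 / (1 + norm \<xi>) ^ K"
          using M_decay[of \<xi>] by (simp add: ft_def f_0)
        also have "\<dots> = C0 * (1 + norm \<xi>) powr (- real K)"
          by (simp add: powr_minus_divide powr_realpow add_pos_nonneg)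
        also have "\<dots> \<le> C0 * g \<xi>"
          unfolding g_def using C0 a by (intro mult_left_mono powr_mono) (auto simp: K_def)
        finally have "cmod (ft M (f 0) \<xi>) \<le> C0 * g \<xi>" .
        moreover have "cmod (ft M (f n) \<xi>) \<le> cmod (ft M (f 0) \<xi>) + cmod (ft M (f n) \<xi> - ft M (f 0) \<xi>)"
          using norm_triangle_sub[of "ft M (f n) \<xi>" "ft M (f 0) \<xi>"] .
        ultimately show ?thesis using ft_half[of n \<xi>] by (simp add: distrib_right)
      qed
      finally show ?thesis by (simp add: algebra_simps)
    qed
    show ?thesis
      unfolding eq by (rule Lim_norm_ubound[OF sequentially_bot lim]) (rule always_eventually, rule allI, rule bound)
  qed
  ultimately show ?thesis
    unfolding g_def using C0 by (intro bexI[of _ \<mu>] exI[of _ "2 * (C0 + 1/2)"]) auto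
qed

section \<open>From Fourier decay to Fourier dimension\<close>

lemma bdd_above_fourier_decay_exponents: "bdd_above (fourier_decay_exponents A)"
  unfolding fourier_decay_exponents_def by (rule bdd_aboveI[of _ "real DIM('a)"]) auto

lemma fourier_dim_ge: "\<beta> \<in> fourier_decay_exponents A \<Longrightarrow> \<beta> \<le> fourier_dim A"
  using bdd_above_fourier_decay_exponents[of A] by (auto simp: fourier_dim_def intro: cSup_upper)

lemma fourier_dim_nonneg: "0 \<le> fourier_dim A"
proof (cases "fourier_decay_exponents A = {}")
  case False
  then obtain \<beta> where \<beta>: "\<beta> \<in> fourier_decay_exponents A" by blast
  then have "0 \<le> \<beta>" by (auto simp: fourier_decay_exponents_def)
  then show ?thesis using fourier_dim_ge[OF \<beta>] by linarith
qed (simp add: fourier_dim_def)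

lemma decay_exponent_well_approximable:
  fixes Q :: "(int ^ 'n) set" and \<Psi> :: "int ^ 'n \<Rightarrow> real" and \<theta> :: "real ^ 'm"
  assumes \<Psi>: "\<And>q. \<Psi> q \<ge> 0" and t: "0 < t" "t < real (DIM(real ^ 'n ^ 'm))"
    and crit: "ereal (t / 2) < critical_exponent Q \<Psi>"
  shows "t \<in> fourier_decay_exponents (well_approximable Q \<Psi> \<theta>)"
proof -
  \<comment> \<open>The cap \<open>t / 2 + 1\<close> keeps \<open>a' \<le> 3 * d\<close> even if the
    critical exponent is infinite, because \<open>t < d\<close> and
    \<open>d \<ge> 1\<close>.\<close>
  have "ereal (t / 2) < min (critical_exponent Q \<Psi>) (ereal (t / 2 + 1))" using crit by simp
  from ereal_dense2[OF this] obtain a' where a': "t / 2 < a'" "ereal a' < critical_exponent Q \<Psi>" "a' < t / 2 + 1"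
    by auto
  have "\<not> (\<lambda>q. Psi_star \<Psi> q powr a') summable_on (Q - {0})"
  proof
    assume "(\<lambda>q. Psi_star \<Psi> q powr a') summable_on (Q - {0})"
    then have "critical_exponent Q \<Psi> \<le> ereal a'"
      unfolding critical_exponent_def using a' t by (intro Inf_lower imageI) auto
    then show False using a' by simp
  qed
  moreover have "1 \<le> real (DIM(real ^ 'n ^ 'm))"
    using DIM_positive[where 'a = "real ^ 'n ^ 'm"] by linarith
  ultimately obtain \<mu> C where \<mu>: "\<mu> \<in> borel_prob_measures_on (well_approximable Q \<Psi> \<theta>)" "C > 0"
    "\<And>\<xi>. cmod (fourier_transform \<mu> \<xi>) \<le> C * (1 + norm \<xi>) powr (- (t / 2))"
    using well_approximable_measure[of \<Psi> a' Q "t / 2" \<theta>] \<Psi> t a' by auto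
  have "cmod (fourier_transform \<mu> \<xi>) \<le> C * infnorm \<xi> powr (- t / 2)" if "\<xi> \<noteq> 0" for \<xi>
  proof -
    \<comment> \<open>The exponent is negative, so the easy comparison
      \<open>infnorm \<xi> \<le> norm \<xi>\<close> suffices and no dimensional constant
      arises.\<close>
    have "(1 + norm \<xi>) powr (- (t / 2)) \<le> infnorm \<xi> powr (- (t / 2))"
      using t that infnorm_le_norm[of \<xi>] by (intro powr_mono2') (auto simp: infnorm_pos_lt)
    then have "C * (1 + norm \<xi>) powr (- (t / 2)) \<le> C * infnorm \<xi> powr (- (t / 2))"
      using \<mu>(2) by (intro mult_left_mono) auto
    then show ?thesis using \<mu>(3)[of \<xi>] by simp
  qed
  then show ?thesis
    unfolding fourier_decay_exponents_def using \<mu>(1,2) t by auto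
qed

theorem proposition1p4p4:
  fixes Q :: "(int ^ 'n) set"
    and \<Psi> :: "int ^ 'n \<Rightarrow> real"
    and \<theta> :: "real ^ 'm"
  assumes "\<And>q. \<Psi> q \<ge> 0"
  shows "ereal (fourier_dim (well_approximable Q \<Psi> \<theta>))
           \<ge> min (2 * critical_exponent Q \<Psi>) (ereal (real (CARD('m) * CARD('n))))"
proof (rule dense_le)
  \<comment> \<open>Only values strictly below the minimum are treated: the construction needs room
    between \<open>t / 2\<close> and the critical exponent, and \<open>fourier_dim\<close> is a
    supremum that need not be attained.\<close>
  fix y assume y: "y < min (2 * critical_exponent Q \<Psi>) (ereal (real (CARD('m) * CARD('n))))"
  show "y \<le> ereal (fourier_dim (well_approximable Q \<Psi> \<theta>))"
  proof (cases y)
    case (real t)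
    show ?thesis
    proof (cases "t \<le> 0")
      case True
      then show ?thesis using fourier_dim_nonneg[of "well_approximable Q \<Psi> \<theta>"] real by simp
    next
      case False
      have "ereal (t / 2) < critical_exponent Q \<Psi>"
        using y real by (cases "critical_exponent Q \<Psi>") auto
      then have "t \<in> fourier_decay_exponents (well_approximable Q \<Psi> \<theta>)"
        using y real False by (intro decay_exponent_well_approximable assms) auto
      then show ?thesis using real by (simp add: fourier_dim_ge)
    qed
  qed (use y in auto)
qed

end
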